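(* Let $f:\mathbb{CP}^1\to\mathbb{CP}^1$ be a rational function, and let $\mathcal O$ be a good orbifold on $\mathbb{CP}^1$ such that the orbifold $f^*(\mathcal O)$ is non-ramified. Then $\chi(\mathcal O)>0$, and $f=\theta_{\mathcal O}\circ q$ for some rational function $q$. In particular, $\deg f$ is divisible by $\deg\theta_{\mathcal O}$.
   Context: Rational functions are non-constant, viewed as holomorphic maps $\mathbb{CP}^1\to\mathbb{CP}^1$; $\deg_z f$ denotes the local degree (multiplicity) of $f$ at $z$. An orbifold $\mathcal O=(R,\nu)$ is a (connected) Riemann surface $R$ with a ramification function $\nu:R\to\mathbb N=\{1,2,\dots\}$ equal to $1$ except at isolated points; it is non-ramified if $\nu\equiv1$. For compact $R$ its Euler characteristic is $\chi(\mathcal O)=\chi(R)+\sum_{z\in R}\left(\frac1{\nu(z)}-1\right)$, where $\chi(R)$ is the usual Euler characteristic. $\mathcal O$ is bad if $R=\mathbb{CP}^1$ and either exactly one point has $\nu>1$, or exactly two points $z_1,z_2$ have $\nu>1$ and $\nu(z_1)\ne\nu(z_2)$; otherwise it is good. For a holomorphic map $f:R'\to R$ between compact Riemann surfaces and an orbifold $\mathcal O=(R,\nu)$, the orbifold $f^*(\mathcal O)=(R',\nu')$ is defined by $\nu'(z)=\nu(f(z))/\gcd(\deg_z f,\nu(f(z)))$. For orbifolds $\mathcal O_1=(R_1,\nu_1)$, $\mathcal O_2=(R_2,\nu_2)$, a holomorphic branched covering map $f:R_1\to R_2$ is a covering map between orbifolds $f:\mathcal O_1\to\mathcal O_2$ if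 $\nu_2(f(z))=\nu_1(z)\deg_z f$ for all $z\in R_1$. A universal covering of $\mathcal O$ is a covering map between orbifolds $\theta_{\mathcal O}:\widetilde{\mathcal O}\to\mathcal O$ where $\widetilde{\mathcal O}$ is non-ramified with simply connected underlying surface $\widetilde R$. It exists and is unique up to a conformal isomorphism of $\widetilde R$ whenever $\mathcal O$ is good; $\widetilde R=\mathbb{CP}^1$ if and only if $\chi(\mathcal O)>0$, in which case, for $\mathcal O$ on $\mathbb{CP}^1$, $\theta_{\mathcal O}$ is a rational function. *)

theory Defs
  imports "HOL-Complex_Analysis.Complex_Analysis" "HOL-Computational_Algebra.Computational_Algebra"
begin

section \<open>Riemann surfaces\<close>

record 'a rsurf =
  rtop :: "'a topology"
  ratlas :: "('a set \<times> ('a \<Rightarrow> complex)) set"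

definition riemann_surface :: "'a rsurf \<Rightarrow> bool" where
  "riemann_surface R \<longleftrightarrow>
     topspace (rtop R) \<noteq> {} \<and> connected_space (rtop R) \<and> Hausdorff_space (rtop R) \<and>
     (\<Union>(U, \<phi>) \<in> ratlas R. U) = topspace (rtop R) \<and>
     (\<forall>(U, \<phi>) \<in> ratlas R. openin (rtop R) U \<and> open (\<phi> ` U) \<and>
        homeomorphic_map (subtopology (rtop R) U) (top_of_set (\<phi> ` U)) \<phi>) \<and>
     (\<forall>(U, \<phi>) \<in> ratlas R. \<forall>(V, \<psi>) \<in> ratlas R.
        (\<psi> \<circ> inv_into U \<phi>) holomorphic_on \<phi> ` (U \<inter> V))"

definition holomorphic_map :: "'a rsurf \<Rightarrow> 'b rsurf \<Rightarrow> ('a \<Rightarrow> 'b) \<Rightarrow> bool" where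
  "holomorphic_map R S f \<longleftrightarrow>
     continuous_map (rtop R) (rtop S) f \<and>
     (\<forall>(U, \<phi>) \<in> ratlas R. \<forall>(V, \<psi>) \<in> ratlas S.
        (\<psi> \<circ> f \<circ> inv_into U \<phi>) holomorphic_on \<phi> ` (U \<inter> f -` V))"

definition chart_at :: "'a rsurf \<Rightarrow> 'a \<Rightarrow> 'a set \<times> ('a \<Rightarrow> complex)" where
  "chart_at R z = (SOME c. c \<in> ratlas R \<and> z \<in> fst c)"

text \<open>The local degree of \<open>f\<close> at \<open>z\<close> is the order of vanishing of \<open>f - f z\<close> in local coordinates;
  for a non-constant holomorphic map it does not depend on the charts chosen.\<close>

definition local_degree :: "'a rsurf \<Rightarrow> 'b rsurf \<Rightarrow> ('a \<Rightarrow> 'b) \<Rightarrow> 'a \<Rightarrow> nat" where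
  "local_degree R S f z =
     (let (U, \<phi>) = chart_at R z; (V, \<psi>) = chart_at S (f z)
      in nat (zorder (\<lambda>u. \<psi> (f (inv_into U \<phi> u)) - \<psi> (f z)) (\<phi> z)))"

text \<open>Each point of the target has a connected open neighbourhood \<open>U\<close> such that every connected
  component of the preimage of \<open>U\<close> is mapped onto \<open>U\<close> by a proper map.\<close>

definition branched_covering :: "'a rsurf \<Rightarrow> 'b rsurf \<Rightarrow> ('a \<Rightarrow> 'b) \<Rightarrow> bool" where
  "branched_covering R S f \<longleftrightarrow>
     holomorphic_map R S f \<and>
     (\<forall>y \<in> topspace (rtop S). \<exists>U. openin (rtop S) U \<and> y \<in> U \<and> connectedin (rtop S) U \<and>
        (\<forall>C \<in> connected_components_of (subtopology (rtop R) {x \<in> topspace (rtop R). f x \<in> U}).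
           f ` C = U \<and> proper_map (subtopology (rtop R) C) (subtopology (rtop S) U) f))"

definition simply_connected_space :: "'a topology \<Rightarrow> bool" where
  "simply_connected_space X \<longleftrightarrow>
     path_connected_space X \<and>
     (\<forall>g. pathin X g \<and> g 1 = g 0 \<longrightarrow>
        (\<exists>a. homotopic_with (\<lambda>h. h 1 = h 0) (top_of_set {0..1}) X g (\<lambda>_. a)))"


section \<open>Orbifolds\<close>

text \<open>An orbifold is a pair \<open>(R, \<nu>)\<close>. That the points with \<open>\<nu> \<noteq> 1\<close> are isolated means that they
  do not accumulate anywhere in \<open>R\<close>; for compact \<open>R\<close> there are thus only finitely many.\<close>

definition orbifold :: "'a rsurf \<Rightarrow> ('a \<Rightarrow> nat) \<Rightarrow> bool" where
  "orbifold R \<nu> \<longleftrightarrow>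
     riemann_surface R \<and> (\<forall>z \<in> topspace (rtop R). \<nu> z \<ge> 1) \<and>
     rtop R derived_set_of {z \<in> topspace (rtop R). \<nu> z \<noteq> 1} = {}"

definition non_ramified :: "'a rsurf \<Rightarrow> ('a \<Rightarrow> nat) \<Rightarrow> bool" where
  "non_ramified R \<nu> \<longleftrightarrow> (\<forall>z \<in> topspace (rtop R). \<nu> z = 1)"

text \<open>The ramification function of \<open>f\<^sup>*(S, \<nu>)\<close>.\<close>

definition pullback_ramification ::
  "'a rsurf \<Rightarrow> 'b rsurf \<Rightarrow> ('a \<Rightarrow> 'b) \<Rightarrow> ('b \<Rightarrow> nat) \<Rightarrow> 'a \<Rightarrow> nat" where
  "pullback_ramification R S f \<nu> z = \<nu> (f z) div gcd (local_degree R S f z) (\<nu> (f z))"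

definition orbifold_covering ::
  "'a rsurf \<Rightarrow> ('a \<Rightarrow> nat) \<Rightarrow> 'b rsurf \<Rightarrow> ('b \<Rightarrow> nat) \<Rightarrow> ('a \<Rightarrow> 'b) \<Rightarrow> bool" where
  "orbifold_covering R \<nu> S \<mu> f \<longleftrightarrow>
     orbifold R \<nu> \<and> orbifold S \<mu> \<and> branched_covering R S f \<and>
     (\<forall>z \<in> topspace (rtop R). \<mu> (f z) = \<nu> z * local_degree R S f z)"

definition universal_covering :: "'a rsurf \<Rightarrow> ('a \<Rightarrow> 'b) \<Rightarrow> 'b rsurf \<Rightarrow> ('b \<Rightarrow> nat) \<Rightarrow> bool" where
  "universal_covering R' \<theta> R \<nu> \<longleftrightarrow>
     simply_connected_space (rtop R') \<and>
     (\<exists>\<nu>'. non_ramified R' \<nu>' \<and> orbifold_covering R' \<nu>' R \<nu> \<theta>)"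


section \<open>The Riemann sphere and its rational functions\<close>

text \<open>\<open>None\<close> is the point at infinity. The charts are the affine coordinate \<open>z\<close> off infinity and
  \<open>1/z\<close> off \<open>0\<close>.\<close>

definition CP1 :: "complex option rsurf" where
  "CP1 = \<lparr> rtop = Alexandroff_compactification euclidean,
           ratlas = {(range Some, the), (- {Some 0}, case_option 0 inverse)} \<rparr>"

text \<open>The map \<open>p / q\<close>; in the last line the value at infinity is \<open>0\<close> when \<open>degree p < degree q\<close>.\<close>

definition rat_map :: "complex poly \<Rightarrow> complex poly \<Rightarrow> complex option \<Rightarrow> complex option" where
  "rat_map p q z =
     (case z of
        Some x \<Rightarrow> if poly q x = 0 then None else Some (poly p x / poly q x)
      | None \<Rightarrow> if degree p > degree q then None
                else Some (coeff p (degree q) / lead_coeff q))"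

definition represents :: "complex poly \<Rightarrow> complex poly \<Rightarrow> (complex option \<Rightarrow> complex option) \<Rightarrow> bool"
  where
  "represents p q f \<longleftrightarrow> coprime p q \<and> max (degree p) (degree q) > 0 \<and> f = rat_map p q"

definition rational_function :: "(complex option \<Rightarrow> complex option) \<Rightarrow> bool" where
  "rational_function f \<longleftrightarrow> (\<exists>p q. represents p q f)"

definition rational_degree :: "(complex option \<Rightarrow> complex option) \<Rightarrow> nat" where
  "rational_degree f = (THE d. \<exists>p q. represents p q f \<and> d = max (degree p) (degree q))"


section \<open>Orbifolds on the Riemann sphere\<close>

definition good_on_CP1 :: "(complex option \<Rightarrow> nat) \<Rightarrow> bool" where
  "good_on_CP1 \<nu> \<longleftrightarrow>
     \<not> ((\<exists>z. {x. \<nu> x > 1} = {z}) \<or>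
        (\<exists>z\<^sub>1 z\<^sub>2. z\<^sub>1 \<noteq> z\<^sub>2 \<and> {x. \<nu> x > 1} = {z\<^sub>1, z\<^sub>2} \<and> \<nu> z\<^sub>1 \<noteq> \<nu> z\<^sub>2))"

text \<open>The leading \<open>2\<close> is the Euler characteristic of the sphere; points with \<open>\<nu> = 1\<close> contribute
  nothing to the sum.\<close>

definition euler_char_on_CP1 :: "(complex option \<Rightarrow> nat) \<Rightarrow> real" where
  "euler_char_on_CP1 \<nu> = 2 + (\<Sum>z | \<nu> z \<noteq> 1. 1 / real (\<nu> z) - 1)"

end

theory Submission
  imports Defs
begin

text \<open>The hypothesis says that \<open>\<nu> (f z)\<close> divides the local degree of \<open>f\<close> at every \<open>z\<close>. Summing over fibres,
  the Riemann-Hurwitz formula becomes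
  \<open>deg f \<cdot> \<chi> = 2 + (\<Sum>z. deg\<^sub>z f / \<nu> (f z) - 1)\<close>, whose summands are nonnegative, so \<open>\<chi> > 0\<close>.
  Hence \<open>\<nu>\<close> has a spherical signature, and Klein's invariant forms give a rational function \<open>\<theta>\<close>
  with \<open>\<nu> (\<theta> z)\<close> dividing \<open>deg\<^sub>z \<theta>\<close> and \<open>deg \<theta> \<cdot> \<chi> = 2\<close>; the same formula then forces
  \<open>deg\<^sub>z \<theta> = \<nu> (\<theta> z)\<close>, so \<open>\<theta>\<close> is a universal covering.

  For an arbitrary universal covering \<open>\<theta>\<close>, which is a holomorphic self-map of the sphere and hence
  rational, write \<open>\<theta>\<close> locally as \<open>t \<mapsto> t\<^sup>m\<close> and \<open>f\<close> as \<open>G\<^sup>m\<close>: every point has a disc on which all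
  local lifts of \<open>f\<close> through \<open>\<theta>\<close> extend. Therefore a lift on a disc extends to a larger concentric
  one, and thus to the whole plane. Near infinity the lift stays away from any value \<open>c\<close> with
  \<open>\<theta> c \<noteq> f \<infinity>\<close>, so infinity is not an essential singularity and the lift is rational. Counting a
  generic fibre gives the multiplicativity of the degree.\<close>

section \<open>Ramification of a quotient of coprime polynomials\<close>

text \<open>Local degrees are treated algebraically, as root orders of \<open>fibre_poly\<close>, so
  that all counting becomes a matter of degrees of polynomials; \<open>local_degree_rat_map\<close>
  connects them with the analytic definition. The recurring obstacle is the point at infinity. Two
  inversions remove it: \<open>swap\<close> exchanges numerator and denominator and thereby inverts
  values, \<open>rev\<close> reverses coefficients and thereby inverts arguments. Local arguments
  are then needed only at a finite point with a finite value. Since \<theta> is branched, ordinary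
  covering theory does not apply. Lifts still exist over ramified values, because \<nu> divides the
  local degrees of f, but distinct lifts may share a value there. Hence lifts are compared only from
  base points off the finite set \<open>branch_points\<close>. They are merely continuous at first
  and may take the value infinity; holomorphy is recovered off a finite set. Goodness turns a
  signature with at most two ramified points into a cyclic one (1, c, c).\<close>

definition fibre_poly :: "complex poly \<Rightarrow> complex poly \<Rightarrow> complex option \<Rightarrow> complex poly" where
  "fibre_poly p q w = (case w of None \<Rightarrow> q | Some c \<Rightarrow> p - smult c q)"

text \<open>At infinity the degree deficit of the fibre polynomial is the multiplicity of infinity
  as a root, once the polynomial is regarded as a binary form of degree
  \<open>max (degree p) (degree q)\<close>.\<close>

definition ramification :: "complex poly \<Rightarrow> complex poly \<Rightarrow> complex option \<Rightarrow> nat" where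
  "ramification p q z =
     (case z of
        Some x \<Rightarrow> order x (fibre_poly p q (rat_map p q z))
      | None \<Rightarrow> max (degree p) (degree q) - degree (fibre_poly p q (rat_map p q z)))"

section \<open>Roots and Wronskians of complex polynomials\<close>

lemma complex_coprimeI:
  fixes p q :: "complex poly"
  assumes "\<And>x. poly p x = 0 \<Longrightarrow> poly q x \<noteq> 0" and "p \<noteq> 0 \<or> q \<noteq> 0"
  shows "coprime p q"
proof (rule coprimeI, rule ccontr)
  fix d assume d: "d dvd p" "d dvd q" "\<not> is_unit d"
  then have "d \<noteq> 0" using assms(2) by auto
  then have "degree d \<noteq> 0" using d by (simp add: is_unit_iff_degree)
  then have "\<not> constant (poly d)" by (simp add: constant_degree)
  then obtain x where "poly d x = 0" using fundamental_theorem_of_algebra by blast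
  then have "poly p x = 0" "poly q x = 0" using d by (meson dvd_trans poly_eq_0_iff_dvd)+
  then show False using assms(1) by blast
qed

lemma sum_order_roots:
  fixes P :: "complex poly"
  assumes "P \<noteq> 0"
  shows "(\<Sum>x | poly P x = 0. order x P) = degree P"
proof -
  have "degree P = size (proots P)" by (simp add: size_proots_complex)
  also have "\<dots> = (\<Sum>x\<in>set_mset (proots P). count (proots P) x)"
    by (rule size_multiset_overloaded_eq)
  also have "\<dots> = (\<Sum>x | poly P x = 0. order x P)"
    using assms by (intro sum.cong) auto
  finally show ?thesis by simp
qed

text \<open>With e the order of F, the term \<open>pderiv F * G\<close> vanishes exactly to order e
  - 1, and \<open>F * pderiv G\<close>, which vanishes at least to order e, cannot cancel it. The
  expression is the numerator of the derivative of F / G.\<close>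

lemma order_wronskian:
  fixes F G :: "complex poly"
  assumes F: "F \<noteq> 0" "poly F x = 0" and G: "poly G x \<noteq> 0"
  shows "Suc (order x (pderiv F * G - F * pderiv G)) = order x F"
proof -
  define e where "e = order x F"
  have e: "e \<noteq> 0" using F by (simp add: e_def order_root)
  have F': "pderiv F \<noteq> 0"
  proof
    assume "pderiv F = 0"
    then obtain c where "F = [:c:]" by (auto simp: pderiv_eq_0_iff elim: degree_eq_zeroE)
    then show False using F by simp
  qed
  have oF': "order x F = Suc (order x (pderiv F))"
    using F by (intro order_pderiv)
  have G0: "G \<noteq> 0" using G by auto
  have "order x (pderiv F * G) = order x (pderiv F) + order x G"
    using F' G0 by (simp add: order_mult)
  also have "order x G = 0" using G by (rule order_0I)
  finally have o1: "order x (pderiv F * G) = e - 1" using oF' by (simp add: e_def)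
  have d: "[:-x,1:] ^ e dvd F * pderiv G" by (simp add: e_def order_1)
  have "\<not> [:-x,1:] ^ e dvd pderiv F * G"
    unfolding order_divides using o1 e F' G0 by auto
  then have nd: "\<not> [:-x,1:] ^ e dvd pderiv F * G - F * pderiv G"
    using dvd_add[of "[:-x,1:] ^ e" "pderiv F * G - F * pderiv G" "F * pderiv G"] d by auto
  then have nz: "pderiv F * G - F * pderiv G \<noteq> 0" by auto
  have "[:-x,1:] ^ (e-1) dvd pderiv F * G" using o1 order_1 by metis
  moreover have "[:-x,1:] ^ (e-1) dvd F * pderiv G"
    using d by (meson diff_le_self dvd_trans le_imp_power_dvd)
  ultimately have "[:-x,1:] ^ (e-1) dvd pderiv F * G - F * pderiv G" by (rule dvd_diff)
  then have "e - 1 \<le> order x (pderiv F * G - F * pderiv G)" using nz by (simp add: order_divides)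
  moreover have "\<not> e \<le> order x (pderiv F * G - F * pderiv G)" using nd nz by (simp add: order_divides)
  ultimately show ?thesis using e by (simp add: e_def)
qed

text \<open>The leading terms combine to the factor \<open>degree F - degree G\<close>, which is
  nonzero. This is the counterpart of \<open>order_wronskian\<close> at infinity.\<close>

lemma degree_wronskian:
  fixes F G :: "complex poly"
  assumes "F \<noteq> 0" "degree F < degree G"
  shows "Suc (degree (pderiv F * G - F * pderiv G)) = degree F + degree G"
    and "pderiv F * G - F * pderiv G \<noteq> 0"
proof -
  let ?W = "pderiv F * G - F * pderiv G" and ?m = "degree F + degree G - 1"
  have G0: "G \<noteq> 0" using assms by auto
  have c2: "coeff (F * pderiv G) ?m = lead_coeff F * (of_nat (degree G) * lead_coeff G)"
  proof -
    have "?m = degree F + degree (pderiv G)" using assms(2) by (simp add: degree_pderiv)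
    then have "coeff (F * pderiv G) ?m = lead_coeff F * lead_coeff (pderiv G)"
      by (simp only: coeff_mult_degree_sum)
    then show ?thesis using assms(2) by (simp add: degree_pderiv coeff_pderiv)
  qed
  have c1: "coeff (pderiv F * G) ?m = of_nat (degree F) * lead_coeff F * lead_coeff G"
  proof (cases "degree F = 0")
    case True
    then have "pderiv F = 0" by (simp add: pderiv_eq_0_iff)
    then show ?thesis using True by simp
  next
    case False
    then have "?m = degree (pderiv F) + degree G" by (simp add: degree_pderiv)
    then have "coeff (pderiv F * G) ?m = lead_coeff (pderiv F) * lead_coeff G"
      by (simp only: coeff_mult_degree_sum)
    then show ?thesis using False by (simp add: degree_pderiv coeff_pderiv)
  qed
  have "coeff ?W ?m = (of_nat (degree F) - of_nat (degree G)) * (lead_coeff F * lead_coeff G)"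
    unfolding coeff_diff c1 c2 by (simp add: algebra_simps)
  moreover have "(of_nat (degree F) :: complex) \<noteq> of_nat (degree G)" using assms(2) by simp
  ultimately have nz: "coeff ?W ?m \<noteq> 0" using assms(1) G0 by simp
  then show "?W \<noteq> 0" by auto
  have "degree (pderiv F * G) \<le> ?m"
  proof (cases "degree F = 0")
    case True
    then have "pderiv F = 0" by (simp add: pderiv_eq_0_iff)
    then show ?thesis by simp
  next
    case False
    then show ?thesis using degree_mult_le[of "pderiv F" G] by (simp add: degree_pderiv)
  qed
  moreover have "degree (F * pderiv G) \<le> ?m"
    using degree_mult_le[of F "pderiv G"] assms(2) by (simp add: degree_pderiv)
  ultimately have "degree ?W \<le> ?m" by (rule degree_diff_le)
  moreover have "?m \<le> degree ?W" using nz by (rule le_degree)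
  ultimately show "Suc (degree ?W) = degree F + degree G" using assms(2) by linarith
qed

section \<open>Fibres and the Riemann-Hurwitz formula for a coprime pair of polynomials\<close>

locale rat_pair =
  fixes p q :: "complex poly"
  assumes coprime: "coprime p q" and nonconst: "max (degree p) (degree q) > 0"
begin

definition n where "n = max (degree p) (degree q)"

abbreviation "F \<equiv> fibre_poly p q"
abbreviation "R \<equiv> rat_map p q"
abbreviation "e \<equiv> ramification p q"

lemma n_pos: "n > 0" using nonconst by (simp add: n_def)

lemma no_common_root: "poly p x = 0 \<Longrightarrow> poly q x \<noteq> 0"
  using coprime coprime_poly_0 by blast

lemma fibre_nonzero: "F w \<noteq> 0"
proof (cases w)
  case None
  { assume "q = 0"
    then have "is_unit p" using coprime by simp
    then have "degree p = 0" by (metis is_unit_polyE degree_pCons_0)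
    then have False using nonconst \<open>q = 0\<close> by simp }
  then show ?thesis using None by (auto simp: fibre_poly_def)
next
  case (Some c)
  { assume *: "p = smult c q"
    then have "q dvd p" by (metis dvd_refl dvd_smult)
    then have "is_unit q" using coprime by (metis coprime_common_divisor dvd_refl)
    then have "degree q = 0" by (metis is_unit_polyE degree_pCons_0)
    then have False using nonconst degree_smult_le[of c q] by (simp add: *) }
  then show ?thesis using Some by (auto simp: fibre_poly_def)
qed

lemma q_nonzero: "q \<noteq> 0" using fibre_nonzero[of None] by (simp add: fibre_poly_def)

lemma p_nonzero: "p \<noteq> 0" using fibre_nonzero[of "Some 0"] by (simp add: fibre_poly_def)

lemma rat_map_Some_eq_iff: "R (Some x) = w \<longleftrightarrow> poly (F w) x = 0"
  using no_common_root[of x] by (cases w) (auto simp: rat_map_def fibre_poly_def field_simps)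

lemma degree_fibre_le: "degree (F w) \<le> n"
  by (auto simp: fibre_poly_def n_def split: option.split
      intro!: degree_diff_le order.trans[OF degree_smult_le])

text \<open>For w = \<open>Some c\<close> the degree drops when the coefficient
  \<open>coeff p n - c * coeff q n\<close> vanishes, which is the equation defining the value at
  infinity.\<close>

lemma rat_map_None_eq_iff: "R None = w \<longleftrightarrow> degree (F w) < n"
proof (cases w)
  case None
  then show ?thesis by (auto simp: rat_map_def fibre_poly_def n_def)
next
  case (Some c)
  have iff: "degree (F w) < n \<longleftrightarrow> coeff (F w) n = 0"
    using degree_fibre_le[of w] fibre_nonzero[of w] n_pos
    by (metis coeff_eq_0 le_neq_implies_less leading_coeff_neq_0)
  have co: "coeff (F w) n = coeff p n - c * coeff q n" by (simp add: Some fibre_poly_def)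
  show ?thesis
  proof (cases "degree p > degree q")
    case True
    then have "n = degree p" "coeff q n = 0" by (auto simp: n_def coeff_eq_0)
    then have "coeff (F w) n \<noteq> 0" using co p_nonzero by simp
    then show ?thesis using iff True Some by (simp add: rat_map_def)
  next
    case False
    then have nq: "n = degree q" by (simp add: n_def)
    then have "coeff (F w) n = 0 \<longleftrightarrow> coeff p (degree q) / lead_coeff q = c"
      unfolding co using q_nonzero by (auto simp: field_simps)
    then show ?thesis using iff False Some by (simp add: rat_map_def)
  qed
qed

lemma ramification_Some: "R (Some x) = w \<Longrightarrow> e (Some x) = order x (F w)"
  by (auto simp: ramification_def)

lemma ramification_None: "R None = w \<Longrightarrow> e None = n - degree (F w)"
  by (auto simp: ramification_def n_def)

lemma ramification_pos: "e z > 0"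
proof (cases z)
  case None
  then show ?thesis using rat_map_None_eq_iff[of "R None"] ramification_None[of "R None"] by simp
next
  case (Some x)
  then show ?thesis
    using rat_map_Some_eq_iff[of x "R z"] ramification_Some[of x "R z"] fibre_nonzero[of "R z"]
    by (simp add: order_gt_0_iff)
qed

lemma fibre_eq:
  "{z. R z = w} = Some ` {x. poly (F w) x = 0} \<union> (if degree (F w) < n then {None} else {})"
proof (intro set_eqI)
  fix z show "z \<in> {z. R z = w} \<longleftrightarrow> 
      z \<in> Some ` {x. poly (F w) x = 0} \<union> (if degree (F w) < n then {None} else {})"
    by (cases z) (auto simp: rat_map_Some_eq_iff rat_map_None_eq_iff)
qed

lemma finite_fibre: "finite {z. R z = w}"
  using fibre_nonzero[of w] by (simp add: fibre_eq poly_roots_finite)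

text \<open>The affine roots contribute \<open>degree (F w)\<close>; the deficit counted at infinity
  supplies the rest.\<close>

lemma sum_ramification_fibre: "(\<Sum>z | R z = w. e z) = n"
proof -
  let ?A = "{x. poly (F w) x = 0}"
  have fin: "finite ?A" using fibre_nonzero by (simp add: poly_roots_finite)
  have "(\<Sum>z\<in>Some ` ?A. e z) = (\<Sum>x\<in>?A. order x (F w))"
    by (subst sum.reindex) (auto simp: ramification_Some rat_map_Some_eq_iff)
  then have 1: "(\<Sum>z\<in>Some ` ?A. e z) = degree (F w)"
    using sum_order_roots fibre_nonzero by simp
  show ?thesis
  proof (cases "degree (F w) < n")
    case True
    then have "(\<Sum>z | R z = w. e z) = e None + (\<Sum>z\<in>Some ` ?A. e z)"
      using fin by (simp add: fibre_eq)
    then show ?thesis using True 1 ramification_None rat_map_None_eq_iff[of w] by simp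
  next
    case False
    then have "degree (F w) = n" using degree_fibre_le[of w] by simp
    then show ?thesis using 1 by (simp add: fibre_eq)
  qed
qed

\<comment> \<open>The Wronskian vanishes to order \<open>e z - 1\<close> at \<open>z\<close>, also at infinity if it is counted as a form
  of degree \<open>2 n - 2\<close>.\<close>
definition W where "W = pderiv p * q - p * pderiv q"

text \<open>The Wronskian is unchanged when a multiple of q is subtracted from p, and changes sign
  when p and q are exchanged. So at each point it can be written with the polynomial of the fibre
  through that point.\<close>

lemma W_Some: "W = pderiv (F (Some c)) * q - F (Some c) * pderiv q"
  by (simp add: W_def fibre_poly_def pderiv_diff pderiv_smult algebra_simps)

lemma W_None: "- W = pderiv (F None) * p - F None * pderiv p"
  by (simp add: W_def fibre_poly_def algebra_simps)

lemma order_W: "Suc (order x W) = e (Some x)"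
proof (cases "R (Some x)")
  case None
  then have r: "poly (F None) x = 0" using rat_map_Some_eq_iff by simp
  then have "poly p x \<noteq> 0" using no_common_root by (auto simp: fibre_poly_def)
  then have "Suc (order x (- W)) = order x (F None)"
    unfolding W_None using r fibre_nonzero by (intro order_wronskian) auto
  then show ?thesis using None by (simp add: ramification_Some)
next
  case (Some c)
  then have r: "poly (F (Some c)) x = 0" using rat_map_Some_eq_iff by simp
  then have "poly q x \<noteq> 0" using no_common_root by (auto simp: fibre_poly_def)
  then have "Suc (order x W) = order x (F (Some c))"
    unfolding W_Some[of c] using r fibre_nonzero by (intro order_wronskian) auto
  then show ?thesis using Some by (simp add: ramification_Some)
qed

text \<open>The fibre polynomial at the value of infinity has degree below n, so its partner has
  degree exactly n and \<open>degree_wronskian\<close> applies.\<close>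

lemma degree_W: "degree W + e None + 1 = 2 * n" and W_nonzero: "W \<noteq> 0"
proof -
  have "degree W + e None + 1 = 2 * n \<and> W \<noteq> 0"
  proof (cases "R None")
    case None
    then have d: "degree (F None) < n" using rat_map_None_eq_iff by simp
    then have p: "degree p = n" by (auto simp: fibre_poly_def n_def)
    have "Suc (degree (- W)) = degree (F None) + n" "- W \<noteq> 0"
      unfolding W_None using degree_wronskian[of "F None" p] d p fibre_nonzero by auto
    then show ?thesis using None d by (simp add: ramification_None)
  next
    case (Some c)
    then have d: "degree (F (Some c)) < n" using rat_map_None_eq_iff by simp
    have "\<not> degree p > degree q" using Some by (auto simp: rat_map_def)
    then have q: "degree q = n" by (simp add: n_def)
    have "Suc (degree W) = degree (F (Some c)) + n" "W \<noteq> 0"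
      unfolding W_Some[of c] using degree_wronskian[of "F (Some c)" q] d q fibre_nonzero by auto
    then show ?thesis using Some d by (simp add: ramification_None)
  qed
  then show "degree W + e None + 1 = 2 * n" "W \<noteq> 0" by auto
qed

lemma ramified_subset: "{z. e z \<noteq> 1} \<subseteq> insert None (Some ` {x. poly W x = 0})"
proof
  fix z assume z: "z \<in> {z. e z \<noteq> 1}"
  show "z \<in> insert None (Some ` {x. poly W x = 0})"
  proof (cases z)
    case (Some x)
    then have "order x W \<noteq> 0" using z order_W[of x] by auto
    then show ?thesis using Some by (auto simp: order_root)
  qed simp
qed

lemma finite_ramified: "finite {z. e z \<noteq> 1}"
  using ramified_subset by (rule finite_subset) (simp add: poly_roots_finite W_nonzero)

text \<open>The excesses e - 1 at finite points are the root orders of W, and the excess at infinity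
  is what the degree of W lacks to 2 n - 2.\<close>

lemma riemann_hurwitz:
  assumes "finite Z" "{z. e z \<noteq> 1} \<subseteq> Z"
  shows "(\<Sum>z\<in>Z. real (e z) - 1) = 2 * real n - 2"
proof -
  let ?A = "{x. poly W x = 0}" and ?g = "\<lambda>z. real (e z) - 1"
  have fin: "finite ?A" using W_nonzero by (simp add: poly_roots_finite)
  have "(\<Sum>z\<in>Z. ?g z) = (\<Sum>z\<in>Z \<union> insert None (Some ` ?A). ?g z)"
    using assms fin by (intro sum.mono_neutral_left) auto
  also have "\<dots> = (\<Sum>z\<in>insert None (Some ` ?A). ?g z)"
    using assms fin ramified_subset by (intro sum.mono_neutral_right) auto
  also have "\<dots> = ?g None + (\<Sum>x\<in>?A. ?g (Some x))"
    using fin by (simp add: sum.reindex)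
  also have "(\<Sum>x\<in>?A. ?g (Some x)) = (\<Sum>x\<in>?A. real (order x W))"
    by (intro sum.cong) (auto simp flip: order_W)
  also have "\<dots> = real (degree W)"
    using sum_order_roots[OF W_nonzero] by (simp flip: of_nat_sum)
  also have "?g None + real (degree W) = 2 * real n - 2"
    using degree_W by linarith
  finally show ?thesis .
qed

lemma surj_rat_map: "\<exists>z. R z = w"
proof (rule ccontr)
  assume "\<nexists>z. R z = w"
  then have "n = 0" using sum_ramification_fibre[of w] by simp
  then show False using n_pos by simp
qed

text \<open>Split e / \<nu> - 1 into (e - 1) + e (1 / \<nu> - 1). The first part is the ordinary
  formula; the second, collected over fibres, gives n (1 / \<nu> - 1) for each ramified
  value.\<close>

lemma riemann_hurwitz_orbifold:
  fixes \<nu> :: "complex option \<Rightarrow> nat"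
  assumes fin: "finite {w. \<nu> w \<noteq> 1}" and pos: "\<And>w. \<nu> w \<ge> 1"
    and Z: "finite Z" "{z. e z \<noteq> 1 \<or> \<nu> (R z) \<noteq> 1} \<subseteq> Z"
  shows "real n * euler_char_on_CP1 \<nu> = 2 + (\<Sum>z\<in>Z. real (e z) / real (\<nu> (R z)) - 1)"
proof -
  let ?S = "{w. \<nu> w \<noteq> 1}"
  let ?g = "\<lambda>z. real (e z) * (1 / real (\<nu> (R z)) - 1)"
  have finU: "finite (\<Union>w\<in>?S. {z. R z = w})" using fin finite_fibre by blast
  have "(\<Sum>z\<in>Z. ?g z) = (\<Sum>z\<in>(\<Union>w\<in>?S. {z. R z = w}). ?g z)"
    using Z by (intro sum.mono_neutral_right) auto
  also have "\<dots> = (\<Sum>w\<in>?S. \<Sum>z | R z = w. ?g z)"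
    using fin finite_fibre by (intro sum.UNION_disjoint) auto
  also have "\<dots> = (\<Sum>w\<in>?S. real n * (1 / real (\<nu> w) - 1))"
  proof (intro sum.cong refl)
    fix w
    have "(\<Sum>z | R z = w. ?g z) = (\<Sum>z | R z = w. real (e z)) * (1 / real (\<nu> w) - 1)"
      unfolding sum_distrib_right by (intro sum.cong) auto
    then show "(\<Sum>z | R z = w. ?g z) = real n * (1 / real (\<nu> w) - 1)"
      using sum_ramification_fibre[of w] by (simp flip: of_nat_sum)
  qed
  finally have 1: "(\<Sum>z\<in>Z. ?g z) = (\<Sum>w\<in>?S. real n * (1 / real (\<nu> w) - 1))" .
  have "real n * euler_char_on_CP1 \<nu> = 2 * real n + (\<Sum>w\<in>?S. real n * (1 / real (\<nu> w) - 1))"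
    by (simp add: euler_char_on_CP1_def algebra_simps sum_distrib_left)
  also have "\<dots> = 2 + ((\<Sum>z\<in>Z. real (e z) - 1) + (\<Sum>z\<in>Z. ?g z))"
  proof -
    have "{z. e z \<noteq> 1} \<subseteq> Z" using Z(2) by blast
    then show ?thesis using riemann_hurwitz[of Z] Z(1) 1 by linarith
  qed
  also have "(\<Sum>z\<in>Z. real (e z) - 1) + (\<Sum>z\<in>Z. ?g z) = (\<Sum>z\<in>Z. real (e z) / real (\<nu> (R z)) - 1)"
    unfolding sum.distrib[symmetric] by (intro sum.cong) (auto simp: algebra_simps)
  finally show ?thesis .
qed

lemma finite_orbifold_ramified:
  assumes "finite {w. \<nu> w \<noteq> (1::nat)}"
  shows "finite {z. e z \<noteq> 1 \<or> \<nu> (R z) \<noteq> 1}"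
proof -
  have "{z. e z \<noteq> 1 \<or> \<nu> (R z) \<noteq> 1} = {z. e z \<noteq> 1} \<union> (\<Union>w\<in>{w. \<nu> w \<noteq> 1}. {z. R z = w})" by auto
  moreover have "finite \<dots>" using assms finite_ramified finite_fibre by blast
  ultimately show ?thesis by simp
qed

lemma euler_char_pos:
  assumes fin: "finite {w. \<nu> w \<noteq> 1}" and pos: "\<And>w. \<nu> w \<ge> 1"
    and dv: "\<And>z. \<nu> (R z) dvd e z"
  shows "euler_char_on_CP1 \<nu> > 0"
proof -
  let ?Z = "{z. e z \<noteq> 1 \<or> \<nu> (R z) \<noteq> 1}"
  have "(\<Sum>z\<in>?Z. real (e z) / real (\<nu> (R z)) - 1) \<ge> 0"
  proof (intro sum_nonneg)
    fix z
    have "\<nu> (R z) \<le> e z" using dv ramification_pos dvd_imp_le by blast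
    then show "0 \<le> real (e z) / real (\<nu> (R z)) - 1" using pos[of "R z"] by (simp add: field_simps)
  qed
  then have "real n * euler_char_on_CP1 \<nu> > 0"
    using riemann_hurwitz_orbifold[OF fin pos finite_orbifold_ramified[OF fin]] by simp
  then show ?thesis using n_pos by (simp add: zero_less_mult_iff)
qed

lemma ramification_eq_if_dvd:
  assumes fin: "finite {w. \<nu> w \<noteq> 1}" and pos: "\<And>w. \<nu> w \<ge> 1"
    and dv: "\<And>z. \<nu> (R z) dvd e z" and n: "real n * euler_char_on_CP1 \<nu> = 2"
  shows "e z = \<nu> (R z)"
proof (cases "z \<in> {z. e z \<noteq> 1 \<or> \<nu> (R z) \<noteq> 1}")
  case True
  let ?Z = "{z. e z \<noteq> 1 \<or> \<nu> (R z) \<noteq> 1}"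
  have nn: "0 \<le> real (e z) / real (\<nu> (R z)) - 1" for z
  proof -
    have "\<nu> (R z) \<le> e z" using dv ramification_pos dvd_imp_le by blast
    then show ?thesis using pos[of "R z"] by (simp add: field_simps)
  qed
  have "(\<Sum>z\<in>?Z. real (e z) / real (\<nu> (R z)) - 1) = 0"
    using riemann_hurwitz_orbifold[OF fin pos finite_orbifold_ramified[OF fin]] n by simp
  then have "real (e z) / real (\<nu> (R z)) - 1 = 0"
    using True nn finite_orbifold_ramified[OF fin] by (subst (asm) sum_nonneg_eq_0_iff) auto
  then show ?thesis using pos[of "R z"] by (simp add: field_simps)
qed simp

end

section \<open>Spherical signatures and Klein's forms\<close>

lemma order_power:
  fixes A :: "complex poly"
  assumes "A \<noteq> 0"
  shows "order x (A ^ n) = n * order x A"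
  using assms by (induction n) (simp_all add: order_mult)

context rat_pair
begin

text \<open>Root orders of an a-th power are multiples of a. At infinity the deficit is
  \<open>n - a * degree A\<close>, which is where a has to divide n.\<close>

lemma dvd_ramification_if_fibre_power:
  assumes R: "R z = w" and F: "F w = smult k (A ^ a)" and a: "a dvd n"
  shows "a dvd e z"
proof -
  have k: "k \<noteq> 0" and A: "A ^ a \<noteq> 0" using F fibre_nonzero[of w] by auto
  show ?thesis
  proof (cases "a = 0")
    case True
    then show ?thesis using n_pos a by simp
  next
    case False
    then have A0: "A \<noteq> 0" using A by auto
    show ?thesis
    proof (cases z)
      case None
      have "degree (F w) = a * degree A" using k A0 by (simp add: F degree_power_eq)
      then have "e z = n - a * degree A" using None R ramification_None by simp
      then show ?thesis using a by (simp add: dvd_diff_nat)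
    next
      case (Some x)
      then have "e z = a * order x A"
        using R ramification_Some[of x w] k A0 by (simp add: F order_smult order_power)
      then show ?thesis by simp
    qed
  qed
qed

end

lemma ex_rat_pair_three_points:
  fixes A B C :: "complex poly"
  assumes eq: "smult \<alpha> (A ^ a) + smult \<beta> (B ^ b) + smult \<gamma> (C ^ c) = 0"
    and nz: "\<alpha> \<noteq> 0" "\<beta> \<noteq> 0" "\<gamma> \<noteq> 0"
    and root: "\<And>x. poly A x = 0 \<Longrightarrow> poly B x \<noteq> 0"
    and deg: "max (degree (A ^ a)) (degree (B ^ b)) = N" "N > 0"
    and abc: "a > 0" "b > 0" "a dvd N" "b dvd N" "c dvd N"
    and w: "w1 \<noteq> w2" "w2 \<noteq> w3" "w1 \<noteq> w3"
    and \<nu>: "\<nu> w1 = a" "\<nu> w2 = b" "\<nu> w3 = c" "{w. \<nu> w \<noteq> 1} \<subseteq> {w1, w2, w3}"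
  shows "\<exists>p q. rat_pair p q \<and> max (degree p) (degree q) = N \<and>
               (\<forall>z. \<nu> (rat_map p q z) dvd ramification p q z)"
proof -
  \<comment> \<open>\<open>(u w : v w)\<close> are homogeneous coordinates of \<open>w\<close>. The fibres of \<open>p / q\<close> are cut out by the linear
    forms \<open>v w p - u w q\<close>, and those at three points satisfy
    \<open>d w2 w3 L w1 + d w3 w1 L w2 + d w1 w2 L w3 = 0\<close>. So \<open>p\<close> and \<open>q\<close> are found by matching this
    relation with the given one.\<close>
  define u :: "complex option \<Rightarrow> complex" where "u w = (case w of None \<Rightarrow> 1 | Some c \<Rightarrow> c)" for w
  define v :: "complex option \<Rightarrow> complex" where "v w = (case w of None \<Rightarrow> 0 | Some c \<Rightarrow> 1)" for w
  define d where "d w w' = u w * v w' - u w' * v w" for w w'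
  have d: "d w w' \<noteq> 0" if "w \<noteq> w'" for w w'
    using that by (cases w; cases w') (auto simp: d_def u_def v_def)
  define P1 where "P1 = smult \<alpha> (A ^ a)"
  define P2 where "P2 = smult \<beta> (B ^ b)"
  define P3 where "P3 = smult \<gamma> (C ^ c)"
  have P3: "P3 = - P1 - P2" using eq unfolding P1_def P2_def P3_def
    by (simp add: eq_neg_iff_add_eq_0 algebra_simps)
  define F1 where "F1 = smult (1 / d w2 w3) P1"
  define F2 where "F2 = smult (1 / d w3 w1) P2"
  define p where "p = smult (1 / d w1 w2) (smult (u w1) F2 - smult (u w2) F1)"
  define q where "q = smult (1 / d w1 w2) (smult (v w1) F2 - smult (v w2) F1)"
  define L where "L w = smult (v w) p - smult (u w) q" for w
  \<comment> \<open>At infinity u = 1 and v = 0, so the linear form is - q while the fibre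
    polynomial is q; elsewhere the two coincide.\<close>
  have L: "fibre_poly p q w = L w \<or> fibre_poly p q w = - L w" for w
    by (cases w) (auto simp: L_def fibre_poly_def u_def v_def)
  have d0: "d w1 w2 \<noteq> 0" "d w2 w3 \<noteq> 0" "d w3 w1 \<noteq> 0" using d w by auto
  have L1: "L w1 = smult (1 / d w2 w3) P1"
  proof -
    have "smult (d w1 w2) (L w1) = smult (d w1 w2) F1"
      using d0 by (simp add: L_def p_def q_def smult_diff_right mult.commute)
        (simp add: d_def smult_diff_left mult.commute)
    then show ?thesis using d0 unfolding F1_def by (metis smult_cancel)
  qed
  have L2: "L w2 = smult (1 / d w3 w1) P2"
  proof -
    have "smult (d w1 w2) (L w2) = smult (d w1 w2) F2"
      using d0 by (simp add: L_def p_def q_def smult_diff_right mult.commute)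
        (simp add: d_def smult_diff_left mult.commute)
    then show ?thesis using d0 unfolding F2_def by (metis smult_cancel)
  qed
  have L3: "L w3 = smult (1 / d w1 w2) P3"
  proof -
    have "smult (d w1 w2) (L w3) = - smult (d w3 w1) F2 - smult (d w2 w3) F1"
      using d0 by (simp add: L_def p_def q_def smult_diff_right mult.commute)
        (simp add: d_def smult_diff_left mult.commute)
    also have "\<dots> = P3" using d0 by (simp add: F1_def F2_def P3)
    finally have "smult (d w1 w2) (L w3) = smult (d w1 w2) (smult (1 / d w1 w2) P3)" using d0 by simp
    then show ?thesis using d0 by (metis smult_cancel)
  qed
  have fib: "\<exists>k. fibre_poly p q w1 = smult k (A ^ a)" "\<exists>k. fibre_poly p q w2 = smult k (B ^ b)"
    "\<exists>k. fibre_poly p q w3 = smult k (C ^ c)"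
    using L[of w1] L[of w2] L[of w3] unfolding L1 L2 L3 P1_def P2_def P3_def
    by (metis smult_smult smult_minus_left)+
  have le: "degree P1 \<le> N" "degree P2 \<le> N" using deg nz by (auto simp: P1_def P2_def)
  have "degree p \<le> N" "degree q \<le> N"
    unfolding p_def q_def F1_def F2_def
    by (intro order.trans[OF degree_smult_le] degree_diff_le le)+
  \<comment> \<open>Conversely \<open>P1\<close> and \<open>P2\<close> are combinations of p and q,
    so no degree is lost in passing to p and q.\<close>
  moreover have "degree P1 \<le> max (degree p) (degree q)"
  proof -
    have "degree P1 = degree (L w1)" using d0 by (simp add: L1)
    then show ?thesis unfolding L_def
      by (simp only:) (intro degree_diff_le order.trans[OF degree_smult_le]; simp)
  qed
  moreover have "degree P2 \<le> max (degree p) (degree q)"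
  proof -
    have "degree P2 = degree (L w2)" using d0 by (simp add: L2)
    then show ?thesis unfolding L_def
      by (simp only:) (intro degree_diff_le order.trans[OF degree_smult_le]; simp)
  qed
  ultimately have N: "max (degree p) (degree q) = N" using deg nz by (auto simp: P1_def P2_def)
  \<comment> \<open>A common root of p and q would annihilate all linear forms, in particular those
    proportional to the powers of A and B.\<close>
  have "coprime p q"
  proof (rule complex_coprimeI)
    show "p \<noteq> 0 \<or> q \<noteq> 0" using N deg(2) by auto
    fix x assume p0: "poly p x = 0"
    show "poly q x \<noteq> 0"
    proof
      assume "poly q x = 0"
      then have "poly (L w1) x = 0" "poly (L w2) x = 0" using p0 by (simp_all add: L_def)
      then have "poly A x = 0" "poly B x = 0"
        using d0 nz abc unfolding L1 L2 P1_def P2_def by auto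
      then show False using root by blast
    qed
  qed
  then interpret rat_pair p q using N deg(2) by unfold_locales auto
  have nN: "n = N" using N by (simp add: n_def)
  have "\<nu> (R z) dvd e z" for z
  proof -
    consider "R z = w1" | "R z = w2" | "R z = w3" | "\<nu> (R z) = 1" using \<nu>(4) by auto
    then show ?thesis
      using dvd_ramification_if_fibre_power[OF refl, of z] fib \<nu>(1-3) abc nN by cases auto
  qed
  then show ?thesis using rat_pair_axioms N by blast
qed

lemma spherical_triple:
  fixes a b c :: nat
  assumes "1 \<le> a" "a \<le> b" "b \<le> c" and pos: "1 / real a + 1 / real b + 1 / real c > 1"
  shows "a = 1 \<or> (a = 2 \<and> b = 2) \<or> (a = 2 \<and> b = 3 \<and> c \<in> {3, 4, 5})"
proof (rule ccontr)
  assume neg: "\<not> ?thesis"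
  have inv: "1 / real x \<le> 1 / real k" if "k \<le> x" "k > 0" for x k
    using that by (simp add: frac_le)
  \<comment> \<open>The extreme signatures of the three cases, (3, 3, 3), (2, 4, 4) and (2, 3, 6),
    are the Euclidean ones, with reciprocal sum exactly 1.\<close>
  consider "a \<ge> 3" | "a = 2" "b \<ge> 4" | "a = 2" "b = 3" "c \<ge> 6"
    using neg assms(1-3) by force
  then show False
  proof cases
    case 1
    then have "3 \<le> a" "3 \<le> b" "3 \<le> c" using assms by auto
    then show False
      using inv[of 3 a] inv[of 3 b] inv[of 3 c] pos unfolding of_nat_numeral by linarith
  next
    case 2
    then have "4 \<le> b" "4 \<le> c" using assms by auto
    moreover have "1 / real a = 1 / 2" using 2 by simp
    ultimately show False using inv[of 4 b] inv[of 4 c] pos unfolding of_nat_numeral by linarith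
  next
    case 3
    have "1 / real a = 1 / 2" "1 / real b = 1 / 3" using 3 by simp_all
    then show False using inv[of 6 c] pos 3(3) unfolding of_nat_numeral by linarith
  qed
qed

text \<open>The polynomials below are Klein's invariant forms of the cyclic, dihedral, tetrahedral,
  octahedral and icosahedral groups, dehomogenised, with the syzygy between them.\<close>

lemma ex_rat_pair_spherical:
  assumes abc: "(a = 1 \<and> b = c) \<or> (a = 2 \<and> b = 2) \<or> (a = 2 \<and> b = 3 \<and> c \<in> {3, 4, 5})" and c: "c \<ge> 1"
    and w: "w1 \<noteq> w2" "w2 \<noteq> w3" "w1 \<noteq> w3"
    and \<nu>: "\<nu> w1 = a" "\<nu> w2 = b" "\<nu> w3 = c" "{w. \<nu> w \<noteq> 1} \<subseteq> {w1, w2, w3}"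
  shows "\<exists>p q. rat_pair p q \<and>
               real (max (degree p) (degree q)) * (1 / real a + 1 / real b + 1 / real c - 1) = 2 \<and>
               (\<forall>z. \<nu> (rat_map p q z) dvd ramification p q z)"
proof -
  define X :: "complex poly" where "X = [:0, 1:]"
  note ex = ex_rat_pair_three_points[OF _ _ _ _ _ _ _ _ _ _ _ _ w \<nu>]
  have polyX [simp]: "poly X x = x" for x by (simp add: X_def)
  have degX: "degree (X ^ k) = k" for k by (simp add: X_def degree_power_eq)
  have X0: "X \<noteq> 0" by (simp add: X_def)
  have eqI: "P = Q" if "\<And>x. poly P x = poly Q x" for P Q :: "complex poly"
    using that poly_eq_poly_eq_iff by blast
  consider "a = 1" "b = c" | "a = 2" "b = 2" | "a = 2" "b = 3" "c = 3"
    | "a = 2" "b = 3" "c = 4" | "a = 2" "b = 3" "c = 5" using abc by auto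
  then show ?thesis
  proof cases
    case 1
    have deg: "degree (X ^ c + 1) = c"
      using c degX by (subst degree_add_eq_left) auto
    have "\<exists>p q. rat_pair p q \<and> max (degree p) (degree q) = c \<and>
               (\<forall>z. \<nu> (rat_map p q z) dvd ramification p q z)"
    \<comment> \<open>The cyclic cover z^c. The constant 1 is the dehomogenised form whose only zero
      is infinity.\<close>
    proof (rule ex[of "-1" "X ^ c + 1" 1 X 1 1])
      show "max (degree ((X ^ c + 1) ^ a)) (degree (X ^ b)) = c" using 1 deg degX by simp
    qed (use 1 c in \<open>auto intro!: eqI simp: power_0_left\<close>)
    moreover have "real c * (1 / real a + 1 / real b + 1 / real c - 1) = 2" using 1 c by simp
    ultimately show ?thesis by metis
  next
    case 2
    have deg: "degree (X ^ c + 1) = c" "degree (X ^ c - 1) = c"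
      using c degX degree_add_eq_left[of 1 "X ^ c"] degree_add_eq_left[of "-1" "X ^ c"] by auto
    have nz: "X ^ c + 1 \<noteq> 0" "X ^ c - 1 \<noteq> 0" using deg c by auto
    have "\<exists>p q. rat_pair p q \<and> max (degree p) (degree q) = 2 * c \<and>
               (\<forall>z. \<nu> (rat_map p q z) dvd ramification p q z)"
    \<comment> \<open>The syzygy is the difference of the squares of X^c - 1 and X^c + 1. The form X
      stands for the pair of poles 0 and infinity.\<close>
    proof (rule ex[of 1 "X ^ c - 1" "-1" "X ^ c + 1" 4 X])
      show "max (degree ((X ^ c - 1) ^ a)) (degree ((X ^ c + 1) ^ b)) = 2 * c"
        using 2 deg nz by (simp add: degree_power_eq)
    qed (use 2 c in \<open>auto intro!: eqI simp: power2_eq_square algebra_simps\<close>)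
    moreover have "real (2 * c) * (1 / real a + 1 / real b + 1 / real c - 1) = 2" using 2 c by simp
    ultimately show ?thesis by metis
  next
    case 3
    \<comment> \<open>B and C vanish at the vertices of two dual tetrahedra, which brings in the
      square root of -3; A vanishes at 0, the fourth roots of unity and, after homogenising,
      infinity: these are the edge midpoints.\<close>
    define s :: complex where "s = csqrt (-3)"
    have s: "s * s = -3" unfolding s_def by (metis power2_csqrt power2_eq_square)
    then have s0: "s \<noteq> 0" by auto
    define A where "A = X * (X ^ 4 - 1)"
    define B where "B = X ^ 4 + smult (2 * s) (X ^ 2) + 1"
    define C where "C = X ^ 4 - smult (2 * s) (X ^ 2) + 1"
    have A': "A = [:0, -1, 0, 0, 0, 1:]" and B': "B = [:1, 0, 2 * s, 0, 1:]"
      by (simp_all add: A_def B_def X_def numeral_eq_Suc algebra_simps one_pCons)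
    have "\<exists>p q. rat_pair p q \<and> max (degree p) (degree q) = 12 \<and>
               (\<forall>z. \<nu> (rat_map p q z) dvd ramification p q z)"
    proof (rule ex[of "12 * s" A "-1" B 1 C])
      show "max (degree (A ^ a)) (degree (B ^ b)) = 12"
        using 3 by (simp add: A' B' degree_power_eq)
      show "smult (12 * s) (A ^ a) + smult (-1) (B ^ b) + smult 1 (C ^ c) = 0"
        unfolding 3 
      proof (rule eqI)
        fix x
        have "12 * s * (x * (x ^ 4 - 1)) ^ 2 - (x ^ 4 + 2 * s * x ^ 2 + 1) ^ 3
               + (x ^ 4 - 2 * s * x ^ 2 + 1) ^ 3 = 0"
          using s by algebra
        then show "poly (smult (12 * s) (A\<^sup>2) + smult (-1) (B ^ 3) + smult 1 (C ^ 3)) x = poly 0 x"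
          by (simp add: A_def B_def C_def)
      qed
      fix x assume "poly A x = 0"
      then have "x = 0 \<or> x ^ 4 = 1" by (simp add: A_def)
      then show "poly B x \<noteq> 0"
      proof
        assume x: "x ^ 4 = 1"
        show ?thesis
        proof
          assume "poly B x = 0"
          then have "2 + 2 * s * x ^ 2 = 0" using x by (simp add: B_def)
          then have "1 + s * x ^ 2 = 0" by algebra
          then have "s * s * x ^ 4 = 1" by algebra
          then show False using s x by simp
        qed
      qed (simp add: B_def)
    qed (use 3 s0 in auto)
    moreover have "real 12 * (1 / real a + 1 / real b + 1 / real c - 1) = 2" using 3 by simp
    ultimately show ?thesis by metis
  next
    case 4
    \<comment> \<open>The zeros of A, B, C are the 12 edge midpoints, 8 face centres and 6 vertices
      of the octahedron, the sixth vertex being infinity.\<close>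
    define A where "A = X ^ 12 - smult 33 (X ^ 8) - smult 33 (X ^ 4) + 1"
    define B where "B = X ^ 8 + smult 14 (X ^ 4) + 1"
    define C where "C = X * (X ^ 4 - 1)"
    have A': "A = [:1, 0, 0, 0, -33, 0, 0, 0, -33, 0, 0, 0, 1:]"
      and B': "B = [:1, 0, 0, 0, 14, 0, 0, 0, 1:]"
      by (simp_all add: A_def B_def X_def numeral_eq_Suc algebra_simps one_pCons)
    have "\<exists>p q. rat_pair p q \<and> max (degree p) (degree q) = 24 \<and>
               (\<forall>z. \<nu> (rat_map p q z) dvd ramification p q z)"
    proof (rule ex[of "-1" A 1 B "-108" C])
      show "max (degree (A ^ a)) (degree (B ^ b)) = 24"
        using 4 by (simp add: A' B' degree_power_eq)
      show "smult (-1) (A ^ a) + smult 1 (B ^ b) + smult (-108) (C ^ c) = 0"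
        unfolding 4
      proof (rule eqI)
        fix x :: complex
        have "- ((x ^ 12 - 33 * x ^ 8 - 33 * x ^ 4 + 1) ^ 2) + (x ^ 8 + 14 * x ^ 4 + 1) ^ 3
               - 108 * (x * (x ^ 4 - 1)) ^ 4 = 0"
          by algebra
        then show "poly (smult (-1) (A\<^sup>2) + smult 1 (B ^ 3) + smult (-108) (C ^ 4)) x = poly 0 x"
          by (simp add: A_def B_def C_def)
      qed
      fix x assume A0: "poly A x = 0"
      show "poly B x \<noteq> 0"
      proof
        assume B0: "poly B x = 0"
        \<comment> \<open>In y the two conditions are a cubic and a quadratic. Modulo the quadratic
          the cubic is 624 y + 48, whose root -1/13 does not satisfy the quadratic.\<close>
        define y where "y = x ^ 4"
        have "poly A x = y ^ 3 - 33 * y ^ 2 - 33 * y + 1" "poly B x = y ^ 2 + 14 * y + 1"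
          by (simp_all add: A_def B_def y_def flip: power_mult)
        then have "y ^ 3 - 33 * y ^ 2 - 33 * y + 1 = 0" "y ^ 2 + 14 * y + 1 = 0"
          using A0 B0 by simp_all
        then have y: "y ^ 2 = - 14 * y - 1" "y ^ 3 - 33 * y ^ 2 - 33 * y + 1 = 0" by algebra+
        have "(1 :: complex) = 0" using y by algebra
        then show False by simp
      qed
    qed (use 4 in auto)
    moreover have "real 24 * (1 / real a + 1 / real b + 1 / real c - 1) = 2" using 4 by simp
    ultimately show ?thesis by metis
  next
    case 5
    \<comment> \<open>The zeros of A, B, C are the 30 edge midpoints, 20 face centres and 12
      vertices of the icosahedron, the twelfth vertex being infinity.\<close>
    define A where "A = X ^ 30 + 1 + smult 522 (X ^ 25 - X ^ 5) - smult 10005 (X ^ 20 + X ^ 10)"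
    define B where "B = smult 228 (X ^ 15 - X ^ 5) - (X ^ 20 + 1) - smult 494 (X ^ 10)"
    define C where "C = X * (X ^ 10 + smult 11 (X ^ 5) - 1)"
    have A': "A = [:1, 0, 0, 0, 0, -522, 0, 0, 0, 0, -10005, 0, 0, 0, 0, 0, 0, 0, 0, 0,
       -10005, 0, 0, 0, 0, 522, 0, 0, 0, 0, 1:]"
      and B': "B = [:-1, 0, 0, 0, 0, -228, 0, 0, 0, 0, -494, 0, 0, 0, 0, 228, 0, 0, 0, 0, -1:]"
      by (simp_all add: A_def B_def X_def numeral_eq_Suc algebra_simps one_pCons)
    have val: "poly A x = (x ^ 5) ^ 6 + 1 + 522 * ((x ^ 5) ^ 5 - x ^ 5) - 10005 * ((x ^ 5) ^ 4 + (x ^ 5) ^ 2)"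
      "poly B x = 228 * ((x ^ 5) ^ 3 - x ^ 5) - ((x ^ 5) ^ 4 + 1) - 494 * (x ^ 5) ^ 2"
      "poly C x ^ 5 = x ^ 5 * ((x ^ 5) ^ 2 + 11 * x ^ 5 - 1) ^ 5" for x
      by (simp_all add: A_def B_def C_def power_mult_distrib flip: power_mult)
    have id: "A0 ^ 2 + B0 ^ 3 - 1728 * (y * (y ^ 2 + 11 * y - 1) ^ 5) = 0"
      if "A0 = y ^ 6 + 1 + 522 * (y ^ 5 - y) - 10005 * (y ^ 4 + y ^ 2)"
         "B0 = 228 * (y ^ 3 - y) - (y ^ 4 + 1) - 494 * y ^ 2" for A0 B0 y :: complex
      unfolding that by algebra
    have "\<exists>p q. rat_pair p q \<and> max (degree p) (degree q) = 60 \<and>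
               (\<forall>z. \<nu> (rat_map p q z) dvd ramification p q z)"
    proof (rule ex[of 1 A 1 B "-1728" C])
      show "max (degree (A ^ a)) (degree (B ^ b)) = 60"
        using 5 by (simp add: A' B' degree_power_eq)
      show "smult 1 (A ^ a) + smult 1 (B ^ b) + smult (-1728) (C ^ c) = 0"
        unfolding 5
      proof (rule eqI)
        fix x
        show "poly (smult 1 (A\<^sup>2) + smult 1 (B ^ 3) + smult (-1728) (C ^ 5)) x = poly 0 x"
          using id[OF val(1,2), of x] by (simp add: val(3))
      qed
      fix x assume A0: "poly A x = 0"
      show "poly B x \<noteq> 0"
      proof
        assume B0: "poly B x = 0"
        define y where "y = x ^ 5"
        have "y * (y ^ 2 + 11 * y - 1) ^ 5 = 0"
          using id[OF val(1,2), of x] A0 B0 by (simp add: y_def)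
        then have "y = 0 \<or> y ^ 2 + 11 * y - 1 = 0" by simp
        moreover have B: "228 * (y ^ 3 - y) - (y ^ 4 + 1) - 494 * y ^ 2 = 0"
          using B0 by (simp add: val y_def)
        ultimately have y: "y ^ 2 + 11 * y - 1 = 0" by auto
        \<comment> \<open>By the quadratic, y - 1/y = -11 and y^2 + 1/y^2 = 123, so B / y^2 = -2508
          - 123 - 494 = -3125.\<close>
        have "3125 * y ^ 2 = 0" using y B by algebra
        then show False using y by simp
      qed
    qed (use 5 in auto)
    moreover have "real 60 * (1 / real a + 1 / real b + 1 / real c - 1) = 2" using 5 by simp
    ultimately show ?thesis by metis
  qed
qed

lemma ex_three_points: "\<exists>w w' :: complex option. w \<noteq> x \<and> w' \<noteq> x \<and> w \<noteq> y \<and> w' \<noteq> y \<and> w \<noteq> w'"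
proof -
  have "\<not> finite (UNIV :: complex set)" by (rule infinite_UNIV_char_0)
  then have inf: "infinite (UNIV :: complex option set)" by simp
  obtain w where "w \<notin> {x, y}" using ex_new_if_finite[OF inf] by (metis finite.simps)
  moreover obtain w' where "w' \<notin> {x, y, w}" using ex_new_if_finite[OF inf] by (metis finite.simps)
  ultimately show ?thesis by auto
qed

text \<open>Each ramified point lowers the Euler characteristic by at least 1/2, so positivity
  allows at most three. Sorted, their orders form a spherical triple, for which Klein's forms give
  the cover.\<close>

lemma ex_rat_pair_unramified_cover:
  fixes \<nu> :: "complex option \<Rightarrow> nat"
  assumes fin: "finite {w. \<nu> w \<noteq> 1}" and pos: "\<And>w. \<nu> w \<ge> 1"
    and good: "good_on_CP1 \<nu>" and \<chi>: "euler_char_on_CP1 \<nu> > 0"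
  shows "\<exists>p q. rat_pair p q \<and> (\<forall>z. \<nu> (rat_map p q z) = ramification p q z)"
proof -
  let ?S = "{w. \<nu> w \<noteq> 1}"
  have S: "?S = {w. \<nu> w > 1}" using pos by (metis less_one linorder_neqE_nat not_less)
  have half: "1 / real (\<nu> w) - 1 \<le> - 1 / 2" if "w \<in> ?S" for w
  proof -
    have "\<nu> w > 1" using that S by blast
    then have "\<nu> w \<ge> 2" by simp
    then show ?thesis by (simp add: field_simps)
  qed
  have "(\<Sum>w\<in>?S. 1 / real (\<nu> w) - 1) \<le> (\<Sum>w\<in>?S. - 1 / 2)" by (intro sum_mono half)
  then have "real (card ?S) < 4" using \<chi> by (simp add: euler_char_on_CP1_def)
  then have card: "card ?S \<le> 3" by linarith
  \<comment> \<open>Fewer than three ramified points are padded with unramified ones. Goodness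
    excludes a single ramified point and makes the orders of two equal.\<close>
  have sub: "\<exists>w1 w2 w3. w1 \<noteq> w2 \<and> w2 \<noteq> w3 \<and> w1 \<noteq> w3 \<and> ?S \<subseteq> {w1, w2, w3} \<and>
      (?S \<noteq> {w1, w2, w3} \<longrightarrow> \<nu> w1 = 1 \<and> \<nu> w2 = \<nu> w3)"
  proof -
    consider "card ?S = 0" | "card ?S = 1" | "card ?S = 2" | "card ?S = 3" using card by linarith
    then show ?thesis
    proof cases
      case 1
      then have "?S = {}" using fin by simp
      moreover obtain w w' :: "complex option" where "w \<noteq> None" "w' \<noteq> None" "w \<noteq> w'"
        using ex_three_points by blast
      ultimately show ?thesis
        by (intro exI[of _ None] exI[of _ w] exI[of _ w']) auto
    next
      case 2
      then show ?thesis using good S by (auto simp: good_on_CP1_def card_1_singleton_iff)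
    next
      case 3
      then obtain w2 w3 where w: "?S = {w2, w3}" "w2 \<noteq> w3" by (auto simp: card_2_iff)
      then have "\<nu> w2 = \<nu> w3" using good S unfolding good_on_CP1_def by metis
      moreover obtain w1 where "w1 \<noteq> w2" "w1 \<noteq> w3" using ex_three_points[of w2 w3] by metis
      moreover have "\<nu> w1 = 1" using w(1) calculation(2,3) by auto
      moreover have "?S \<subseteq> {w1, w2, w3}" using w(1) by blast
      ultimately show ?thesis using w(2)
        by (intro exI[of _ w1] exI[of _ w2] exI[of _ w3] conjI impI) assumption+
    next
      case 4
      then show ?thesis by (auto simp: card_3_iff)
    qed
  qed
  \<comment> \<open>Sorting prepares for \<open>spherical_triple\<close>. The implication about
    \<nu> w1 = 1 singles out the cyclic case and survives sorting, since without padding all three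
    orders exceed 1.\<close>
  have "\<exists>w1 w2 w3. w1 \<noteq> w2 \<and> w2 \<noteq> w3 \<and> w1 \<noteq> w3 \<and> ?S \<subseteq> {w1, w2, w3} \<and>
      (\<nu> w1 = 1 \<longrightarrow> \<nu> w2 = \<nu> w3) \<and> \<nu> w1 \<le> \<nu> w2 \<and> \<nu> w2 \<le> \<nu> w3"
  proof -
    obtain w1 w2 w3 where w: "w1 \<noteq> w2" "w2 \<noteq> w3" "w1 \<noteq> w3" "?S \<subseteq> {w1, w2, w3}"
      "?S \<noteq> {w1, w2, w3} \<longrightarrow> \<nu> w1 = 1 \<and> \<nu> w2 = \<nu> w3" using sub by blast
    show ?thesis
    proof (cases "?S = {w1, w2, w3}")
      case False
      then show ?thesis using w pos[of w2]
        by (intro exI[of _ w1] exI[of _ w2] exI[of _ w3]) auto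
    next
      case True
      then have ne: "\<nu> w1 \<noteq> 1" "\<nu> w2 \<noteq> 1" "\<nu> w3 \<noteq> 1" by auto
      note ex = exI[of _ w1] exI[of _ w2] exI[of _ w3]
      have "(\<nu> w1 \<le> \<nu> w2 \<and> \<nu> w2 \<le> \<nu> w3) \<or> (\<nu> w1 \<le> \<nu> w3 \<and> \<nu> w3 \<le> \<nu> w2) \<or>
            (\<nu> w2 \<le> \<nu> w1 \<and> \<nu> w1 \<le> \<nu> w3) \<or> (\<nu> w2 \<le> \<nu> w3 \<and> \<nu> w3 \<le> \<nu> w1) \<or>
            (\<nu> w3 \<le> \<nu> w1 \<and> \<nu> w1 \<le> \<nu> w2) \<or> (\<nu> w3 \<le> \<nu> w2 \<and> \<nu> w2 \<le> \<nu> w1)" by linarith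
      moreover have "w2 \<noteq> w1" "w3 \<noteq> w2" "w3 \<noteq> w1" using w by auto
      moreover have "{w1, w2, w3} = {w1, w3, w2}" "{w1, w2, w3} = {w2, w1, w3}" 
         "{w1, w2, w3} = {w2, w3, w1}" "{w1, w2, w3} = {w3, w1, w2}" "{w1, w2, w3} = {w3, w2, w1}"
        by auto
      ultimately show ?thesis using w(1-4) ne by (metis (no_types, lifting))
    qed
  qed
  then obtain w1 w2 w3 where w: "w1 \<noteq> w2" "w2 \<noteq> w3" "w1 \<noteq> w3" "?S \<subseteq> {w1, w2, w3}"
      and eq: "\<nu> w1 = 1 \<longrightarrow> \<nu> w2 = \<nu> w3" and ord: "\<nu> w1 \<le> \<nu> w2" "\<nu> w2 \<le> \<nu> w3" by blast
  have "(\<Sum>w\<in>?S. 1 / real (\<nu> w) - 1) = (\<Sum>w\<in>{w1, w2, w3}. 1 / real (\<nu> w) - 1)"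
    using w(4) by (intro sum.mono_neutral_left) auto
  also have "\<dots> = 1 / real (\<nu> w1) + 1 / real (\<nu> w2) + 1 / real (\<nu> w3) - 3"
    using w(1-3) by simp
  finally have chi: "euler_char_on_CP1 \<nu> = 1 / real (\<nu> w1) + 1 / real (\<nu> w2) + 1 / real (\<nu> w3) - 1"
    by (simp add: euler_char_on_CP1_def)
  have "\<nu> w1 = 1 \<or> (\<nu> w1 = 2 \<and> \<nu> w2 = 2) \<or> (\<nu> w1 = 2 \<and> \<nu> w2 = 3 \<and> \<nu> w3 \<in> {3, 4, 5})"
    using spherical_triple[OF pos ord] \<chi> chi by simp
  then obtain p q where pq: "rat_pair p q"
     "real (max (degree p) (degree q)) * euler_char_on_CP1 \<nu> = 2"
     "\<And>z. \<nu> (rat_map p q z) dvd ramification p q z"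
    using ex_rat_pair_spherical[OF _ pos w(1-3) refl refl refl w(4)] eq unfolding chi by blast
  interpret rat_pair p q by (fact pq(1))
  have "e z = \<nu> (R z)" for z
    using pq(2,3) by (intro ramification_eq_if_dvd fin pos) (auto simp: n_def)
  then show ?thesis using pq(1) by metis
qed

section \<open>The topology of the Riemann sphere\<close>

abbreviation CP1_top :: "complex option topology" where
  "CP1_top \<equiv> Alexandroff_compactification euclidean"

text \<open>The map 1/z on the sphere; composing with it turns statements about infinity into
  statements about 0.\<close>

definition sphere_inv :: "complex option \<Rightarrow> complex option" where
  "sphere_inv z = (case z of None \<Rightarrow> Some 0 | Some x \<Rightarrow> if x = 0 then None else Some (inverse x))"

lemma rtop_CP1 [simp]: "rtop CP1 = CP1_top"
  by (simp add: CP1_def)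

lemma ratlas_CP1: "ratlas CP1 = {(range Some, the), (- {Some 0}, case_option 0 inverse)}"
  by (simp add: CP1_def)

lemma topspace_CP1 [simp]: "topspace CP1_top = UNIV"
  by (auto simp: image_iff)

declare topspace_Alexandroff_compactification [simp del]

lemma Hausdorff_CP1: "Hausdorff_space CP1_top"
  by (simp add: Hausdorff_space_Alexandroff_compactification locally_compact_space_euclidean)

lemma sphere_inv_inv [simp]: "sphere_inv (sphere_inv z) = z"
  by (auto simp: sphere_inv_def split: option.splits if_splits)

lemma sphere_inv_eq_iff [simp]: "sphere_inv z = sphere_inv w \<longleftrightarrow> z = w"
  by (metis sphere_inv_inv)

lemma sphere_inv_simps [simp]:
  "sphere_inv None = Some 0" "sphere_inv (Some 0) = None"
  "x \<noteq> 0 \<Longrightarrow> sphere_inv (Some x) = Some (inverse x)"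
  by (auto simp: sphere_inv_def)

lemma sphere_inv_eq_None [simp]: "sphere_inv z = None \<longleftrightarrow> z = Some 0"
  by (metis sphere_inv_inv sphere_inv_simps(1,2))

text \<open>Neighbourhoods of infinity are complements of compact sets, so the content is that 1/z
  exchanges them with neighbourhoods of 0. The cases ask whether V contains infinity and whether it
  contains 0.\<close>

lemma openin_vimage_sphere_inv:
  assumes "openin CP1_top V"
  shows "openin CP1_top (sphere_inv -` V)"
proof -
  have pre: "open {x. x \<noteq> 0 \<and> inverse x \<in> U}" if "open U" for U :: "complex set"
  proof -
    have "open ((- {0}) \<inter> inverse -` U)"
      using that by (intro continuous_open_preimage) (auto intro!: continuous_intros)
    moreover have "(- {0}) \<inter> inverse -` U = {x. x \<noteq> 0 \<and> inverse x \<in> U}" by auto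
    ultimately show ?thesis by simp
  qed
  \<comment> \<open>The point 0 is listed separately because it is sent to infinity, whereas the
    convention inverse 0 = 0 would place it in U.\<close>
  have bd: "bounded {x. x = 0 \<or> inverse x \<notin> U}" if U: "open U" "0 \<in> U" for U :: "complex set"
  proof -
    obtain r where r: "r > 0" "ball 0 r \<subseteq> U" using U openE by blast
    have "norm x \<le> inverse r" if "x = 0 \<or> inverse x \<notin> U" for x
    proof (cases "x = 0")
      case False
      then have "inverse x \<notin> ball 0 r" using that r by auto
      then have "r \<le> inverse (norm x)" by (simp add: norm_inverse)
      then show ?thesis using r False by (simp add: field_simps)
    qed (use r in auto)
    then show ?thesis by (intro boundedI) blast
  qed
  consider (fin) U where "open U" "V = Some ` U"
    | (inf) K where "compact K" "V = insert None (Some ` (- K))"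
    using assms by (auto simp: openin_Alexandroff_compactification Compl_eq_Diff_UNIV)
  then show ?thesis
  proof cases
    case (fin U)
    show ?thesis
    proof (cases "0 \<in> U")
      case True
      let ?K = "{x. x = 0 \<or> inverse x \<notin> U}"
      have "- ?K = {x. x \<noteq> 0 \<and> inverse x \<in> U}" by auto
      then have "closed ?K" using pre[OF fin(1)] by (simp add: closed_def)
      then have K: "compact ?K" using bd[OF fin(1) True] by (simp add: compact_eq_bounded_closed)
      have "sphere_inv -` V = insert None (Some ` (UNIV - ?K))"
      proof (intro set_eqI)
        fix z show "z \<in> sphere_inv -` V \<longleftrightarrow> z \<in> insert None (Some ` (UNIV - ?K))"
          using True fin(2) by (cases z) (auto simp: sphere_inv_def)
      qed
      then show ?thesis using K compact_imp_closed[OF K]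
        unfolding openin_Alexandroff_compactification by auto
    next
      case False
      have "sphere_inv -` V = Some ` {x. x \<noteq> 0 \<and> inverse x \<in> U}"
      proof (intro set_eqI)
        fix z show "z \<in> sphere_inv -` V \<longleftrightarrow> z \<in> Some ` {x. x \<noteq> 0 \<and> inverse x \<in> U}"
          using False fin(2) by (cases z) (auto simp: sphere_inv_def)
      qed
      then show ?thesis using pre[OF fin(1)] by simp
    qed
  next
    case (inf K)
    let ?D = "{x. x \<noteq> 0 \<and> inverse x \<in> K}"
    have "bounded K" using inf compact_imp_bounded by blast
    then obtain M where M: "M > 0" "\<And>x. x \<in> K \<Longrightarrow> norm x \<le> M"
      using bounded_pos by blast
    \<comment> \<open>A bound M on K keeps these points at distance at least 1/M from 0, so inverse
      is continuous on a closed set containing them.\<close>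
    have D: "?D = {x. norm x \<ge> inverse M} \<inter> inverse -` K"
    proof (intro set_eqI iffI)
      fix x assume x: "x \<in> ?D"
      then have "inverse (norm x) \<le> M" using M(2)[of "inverse x"] by (simp add: norm_inverse)
      then have "inverse M \<le> norm x" using x M by (simp add: field_simps)
      then show "x \<in> {x. norm x \<ge> inverse M} \<inter> inverse -` K" using x by simp
    qed (use M in auto)
    have clD: "closed ?D" unfolding D
    proof (intro continuous_closed_preimage)
      show "continuous_on {x :: complex. norm x \<ge> inverse M} inverse"
        using M by (intro continuous_intros) auto
      show "closed {x :: complex. inverse M \<le> norm x}"
        by (intro closed_Collect_le continuous_intros)
    qed (use inf compact_imp_closed in auto)
    show ?thesis
    proof (cases "0 \<in> K")
      case True
      have "sphere_inv -` V = Some ` (- ?D)"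
      proof (intro set_eqI)
        fix z show "z \<in> sphere_inv -` V \<longleftrightarrow> z \<in> Some ` (- ?D)"
          using True inf(2) by (cases z) (auto simp: sphere_inv_def)
      qed
      then show ?thesis using clD by (simp add: open_Compl)
    next
      case False
      have "?D \<subseteq> {x. x = 0 \<or> inverse x \<notin> - K}" by auto
      moreover have "open (- K)" "0 \<in> - K" using inf compact_imp_closed False by auto
      ultimately have "bounded ?D" using bd bounded_subset by blast
      then have "compact ?D" using clD by (simp add: compact_eq_bounded_closed)
      moreover have "sphere_inv -` V = insert None (Some ` (UNIV - ?D))"
      proof (intro set_eqI)
        fix z show "z \<in> sphere_inv -` V \<longleftrightarrow> z \<in> insert None (Some ` (UNIV - ?D))"
          using False inf(2) by (cases z) (auto simp: sphere_inv_def)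
      qed
      ultimately show ?thesis using clD unfolding openin_Alexandroff_compactification by auto
    qed
  qed
qed

lemma continuous_map_sphere_inv: "continuous_map CP1_top CP1_top sphere_inv"
  using openin_vimage_sphere_inv unfolding continuous_map_def vimage_def by simp

lemma openin_image_sphere_inv: "openin CP1_top V \<Longrightarrow> openin CP1_top (sphere_inv ` V)"
proof -
  have "sphere_inv ` V = sphere_inv -` V" by force
  then show "openin CP1_top V \<Longrightarrow> openin CP1_top (sphere_inv ` V)"
    using openin_vimage_sphere_inv by simp
qed

lemma continuous_map_to_CP1I:
  assumes "\<And>x. x \<in> topspace X \<Longrightarrow> \<exists>U g. openin X U \<and> x \<in> U \<and>
      continuous_map (subtopology X U) euclidean g \<and>
      ((\<forall>y\<in>U. f y = Some (g y)) \<or> (\<forall>y\<in>U. f y = sphere_inv (Some (g y))))"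
  shows "continuous_map X CP1_top f"
proof -
  have "\<exists>U. openin X U \<and> x \<in> U \<and> continuous_map (subtopology X U) CP1_top f" if x: "x \<in> topspace X" for x
  proof -
    obtain U g where U: "openin X U" "x \<in> U" and g: "continuous_map (subtopology X U) euclidean g"
      and f: "(\<forall>y\<in>U. f y = Some (g y)) \<or> (\<forall>y\<in>U. f y = sphere_inv (Some (g y)))"
      using assms[OF x] by blast
    have 1: "continuous_map (subtopology X U) CP1_top (Some \<circ> g)"
      "continuous_map (subtopology X U) CP1_top (sphere_inv \<circ> (Some \<circ> g))"
      using continuous_map_compose[OF g continuous_map_Some]
        continuous_map_compose[OF continuous_map_compose[OF g continuous_map_Some] continuous_map_sphere_inv]
      by simp_all
    from f have "continuous_map (subtopology X U) CP1_top f"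
    proof (elim disjE)
      assume "\<forall>y\<in>U. f y = Some (g y)"
      then show ?thesis by (rule_tac continuous_map_eq[OF 1(1)]) auto
    next
      assume "\<forall>y\<in>U. f y = sphere_inv (Some (g y))"
      then show ?thesis by (rule_tac continuous_map_eq[OF 1(2)]) auto
    qed
    then show ?thesis using U by blast
  qed
  then obtain U where U: "\<And>x. x \<in> topspace X \<Longrightarrow> openin X (U x)"
    "\<And>x. x \<in> topspace X \<Longrightarrow> x \<in> U x"
    "\<And>x. x \<in> topspace X \<Longrightarrow> continuous_map (subtopology X (U x)) CP1_top f" by metis
  show ?thesis
    by (rule pasting_lemma[where I = "topspace X" and T = U and f = "\<lambda>_. f"]) (use U in auto)
qed

lemma CP1_cases: "(\<exists>x. z = Some x) \<or> z = sphere_inv (Some 0)"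
  by (cases z) auto

lemma continuous_map_from_CP1I:
  assumes f: "continuous_map euclidean Y (\<lambda>x. f (Some x))"
    and fJ: "continuous_map euclidean Y (\<lambda>x. f (sphere_inv (Some x)))"
  shows "continuous_map CP1_top Y f"
  unfolding continuous_map_def
proof (intro conjI allI impI)
  show "f \<in> topspace CP1_top \<rightarrow> topspace Y"
  proof
    fix z
    have "f (Some x) \<in> topspace Y" "f (sphere_inv (Some x)) \<in> topspace Y" for x
      using continuous_map_image_subset_topspace[OF f]
        continuous_map_image_subset_topspace[OF fJ] by auto
    then show "f z \<in> topspace Y" using CP1_cases[of z] by metis
  qed
  fix V assume V: "openin Y V"
  have "open {x. f (Some x) \<in> V}" "open {x. f (sphere_inv (Some x)) \<in> V}"
    using openin_continuous_map_preimage[OF f V] openin_continuous_map_preimage[OF fJ V] by auto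
  then have "openin CP1_top (Some ` {x. f (Some x) \<in> V} \<union> sphere_inv ` Some ` {x. f (sphere_inv (Some x)) \<in> V})"
    by (intro openin_Un openin_image_sphere_inv) auto
  moreover have "Some ` {x. f (Some x) \<in> V} \<union> sphere_inv ` Some ` {x. f (sphere_inv (Some x)) \<in> V}
     = {z \<in> topspace CP1_top. f z \<in> V}"
  proof (intro set_eqI)
    fix z show "z \<in> Some ` {x. f (Some x) \<in> V} \<union> sphere_inv ` Some ` {x. f (sphere_inv (Some x)) \<in> V}
       \<longleftrightarrow> z \<in> {z \<in> topspace CP1_top. f z \<in> V}"
    proof (cases z)
      case None
      then have z: "z = sphere_inv (Some 0)" by simp
      show ?thesis unfolding z by (auto simp del: sphere_inv_simps)
    qed auto
  qed
  ultimately show "openin CP1_top {z \<in> topspace CP1_top. f z \<in> V}" by simp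
qed

text \<open>This is x^n p(1/x). Unlike \<open>reflect_poly\<close> it reverses with respect to a
  prescribed n, so that numerator and denominator are reversed compatibly.\<close>

definition rev_poly :: "nat \<Rightarrow> complex poly \<Rightarrow> complex poly" where
  "rev_poly n p = monom 1 (n - degree p) * reflect_poly p"

lemma coeff_rev_poly:
  assumes "degree p \<le> n"
  shows "coeff (rev_poly n p) i = (if i \<le> n then coeff p (n - i) else 0)"
proof -
  have "coeff (rev_poly n p) i
      = (if n - degree p \<le> i then coeff (reflect_poly p) (i - (n - degree p)) else 0)"
    by (simp add: rev_poly_def coeff_monom_mult)
  also have "\<dots> = (if i \<le> n then coeff p (n - i) else 0)"
    using assms by (auto simp: coeff_reflect_poly coeff_eq_0 intro!: arg_cong[of _ _ "coeff p"])
  finally show ?thesis .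
qed

lemma degree_rev_poly_le: "degree p \<le> n \<Longrightarrow> degree (rev_poly n p) \<le> n"
  by (rule degree_le) (auto simp: coeff_rev_poly)

lemma poly_rev_poly_0: "degree p \<le> n \<Longrightarrow> poly (rev_poly n p) 0 = coeff p n"
  by (simp add: poly_0_coeff_0 coeff_rev_poly)

lemma poly_rev_poly:
  assumes "degree p \<le> n" "x \<noteq> 0"
  shows "poly (rev_poly n p) x = x ^ n * poly p (inverse x)"
  using assms by (simp add: rev_poly_def poly_monom poly_reflect_poly_nz flip: power_add mult.assoc)

lemma order_0_rev_poly:
  assumes "p \<noteq> 0"
  shows "order 0 (rev_poly n p) = n - degree p"
proof -
  have "order 0 (reflect_poly p) = 0" using assms by (intro order_0I) simp
  then show ?thesis using assms by (simp add: rev_poly_def order_mult)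
qed

text \<open>Reversal turns a factor X - x into 1 - x X, whose root is 1/x, and the cofactor stays
  nonzero there.\<close>

lemma order_rev_poly:
  assumes "p \<noteq> 0" "x \<noteq> 0"
  shows "order (inverse x) (rev_poly n p) = order x p"
proof -
  obtain r where r: "p = [:- x, 1:] ^ order x p * r" "\<not> [:- x, 1:] dvd r"
    using order_decomp[OF assms(1)] by blast
  define k where "k = order x p"
  have rx: "poly r x \<noteq> 0" using r(2) by (simp add: poly_eq_0_iff_dvd)
  have "[:1, - x:] = smult (- x) [:- inverse x, 1:]" using assms by simp
  then have "order (inverse x) [:1, - x:] = order (inverse x) (smult (- x) [:- inverse x, 1:])"
    by (simp only:)
  also have "\<dots> = 1" using assms order_power_n_n[of "inverse x" 1] by (subst order_smult) auto
  finally have o1: "order (inverse x) [:1, - x:] = 1" .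
  have "poly (reflect_poly r) (inverse x) \<noteq> 0"
    using rx assms by (simp add: poly_reflect_poly_nz)
  then have o2: "order (inverse x) (reflect_poly r) = 0" and r0: "reflect_poly r \<noteq> 0"
    by (auto intro: order_0I)
  have o3: "order (inverse x) (monom 1 (n - degree p)) = 0"
    using assms by (intro order_0I) (simp add: poly_monom)
  have "reflect_poly [:- x, 1:] = [:1, - x:]" using assms by (simp add: reflect_poly_pCons one_pCons)
  then have "reflect_poly p = [:1, - x:] ^ k * reflect_poly r"
    by (subst r(1)) (simp add: k_def reflect_poly_mult reflect_poly_power)
  then have "order (inverse x) (reflect_poly p) = k"
    using o1 o2 r0 by (simp add: order_mult order_power)
  then show ?thesis using o3 assms by (simp add: rev_poly_def order_mult k_def)
qed

section \<open>Inverting the coordinate of the target and of the source\<close>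

context rat_pair
begin

lemma swap: "rat_pair q p"
  using coprime nonconst by unfold_locales (auto simp: coprime_commute max.commute)

text \<open>Exchanging p and q composes with 1/z in the target; the fibre polynomials then agree up
  to a factor 1 or - 1/c.\<close>

lemma fibre_swap: "\<exists>k. k \<noteq> 0 \<and> fibre_poly q p (sphere_inv w) = smult k (F w)"
proof (cases w)
  case None
  then show ?thesis by (intro exI[of _ 1]) (auto simp: fibre_poly_def)
next
  case (Some c)
  show ?thesis
  proof (cases "c = 0")
    case True
    then show ?thesis using Some by (intro exI[of _ 1]) (auto simp: fibre_poly_def)
  next
    case False
    then show ?thesis using Some
      by (intro exI[of _ "- inverse c"]) (auto simp: fibre_poly_def smult_diff_right)
  qed
qed

lemma rat_map_swap: "rat_map q p z = sphere_inv (R z)"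
proof -
  interpret s: rat_pair q p by (rule swap)
  obtain k where k: "k \<noteq> 0" "fibre_poly q p (sphere_inv (R z)) = smult k (F (R z))"
    using fibre_swap by blast
  have "s.n = n" by (simp add: s.n_def n_def max.commute)
  then show ?thesis
    using k rat_map_None_eq_iff[of "R z"] rat_map_Some_eq_iff[of _ "R z"]
    by (cases z) (auto simp: s.rat_map_None_eq_iff s.rat_map_Some_eq_iff)
qed

lemma ramification_swap: "ramification q p z = e z"
proof -
  interpret s: rat_pair q p by (rule swap)
  obtain k where k: "k \<noteq> 0" "fibre_poly q p (sphere_inv (R z)) = smult k (F (R z))"
    using fibre_swap by blast
  have "s.n = n" by (simp add: s.n_def n_def max.commute)
  then show ?thesis
    using k s.ramification_Some[OF rat_map_swap] s.ramification_None[OF rat_map_swap]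
      ramification_Some[OF refl] ramification_None[OF refl]
    by (cases z) (simp_all add: order_smult)
qed

abbreviation "p' \<equiv> rev_poly n p"
abbreviation "q' \<equiv> rev_poly n q"

lemma degree_le_n: "degree p \<le> n" "degree q \<le> n" by (auto simp: n_def)

lemma fibre_rev: "fibre_poly p' q' w = rev_poly n (F w)"
proof (cases w)
  case None
  then show ?thesis by (simp add: fibre_poly_def)
next
  case (Some c)
  have "degree (p - smult c q) \<le> n" using degree_fibre_le[of w] Some by (simp add: fibre_poly_def)
  then show ?thesis
    using Some degree_le_n by (auto simp: fibre_poly_def poly_eq_iff coeff_rev_poly)
qed

lemma max_degree_rev: "max (degree p') (degree q') = n"
proof -
  have "coeff p' n \<noteq> 0 \<or> coeff q' n \<noteq> 0"
    using no_common_root[of 0] degree_le_n by (auto simp: coeff_rev_poly poly_0_coeff_0)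
  then have "n \<le> degree p' \<or> n \<le> degree q'" using le_degree by blast
  then show ?thesis using degree_rev_poly_le[OF degree_le_n(1)] degree_rev_poly_le[OF degree_le_n(2)]
    by auto
qed

lemma rev: "rat_pair p' q'"
proof
  show "max (degree p') (degree q') > 0" using max_degree_rev n_pos by simp
  show "coprime p' q'"
  proof (rule complex_coprimeI)
    show "p' \<noteq> 0 \<or> q' \<noteq> 0" using max_degree_rev n_pos by auto
    fix x assume "poly p' x = 0"
    moreover have "coeff p n \<noteq> 0 \<or> coeff q n \<noteq> 0"
      using p_nonzero q_nonzero leading_coeff_neq_0 unfolding n_def max_def by auto
    ultimately show "poly q' x \<noteq> 0"
      using no_common_root[of "inverse x"] degree_le_n
      by (cases "x = 0") (auto simp: poly_rev_poly poly_rev_poly_0)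
  qed
qed

lemma rat_map_rev: "rat_map p' q' z = R (sphere_inv z)"
proof -
  interpret r: rat_pair p' q' by (rule rev)
  define w where "w = R (sphere_inv z)"
  have rn: "r.n = n" using max_degree_rev by (simp add: r.n_def)
  have deg: "degree P < n \<longleftrightarrow> coeff P n = 0" if "degree P \<le> n" "P \<noteq> 0" for P
    using that n_pos by (metis coeff_eq_0 le_neq_implies_less leading_coeff_neq_0)
  have "rat_map p' q' z = w"
  proof (cases z)
    case None
    then have "poly (F w) 0 = 0" using rat_map_Some_eq_iff[of 0 w] by (simp add: w_def)
    then have "coeff (fibre_poly p' q' w) n = 0"
      using degree_fibre_le[of w] by (simp add: fibre_rev coeff_rev_poly poly_0_coeff_0)
    then show ?thesis
      using r.rat_map_None_eq_iff[of w] deg[of "r.F w"] r.degree_fibre_le[of w] r.fibre_nonzero[of w]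
      by (simp add: None rn)
  next
    case (Some x)
    show ?thesis
    proof (cases "x = 0")
      case True
      then have "degree (F w) < n" using Some rat_map_None_eq_iff[of w] by (simp add: w_def)
      then have "poly (fibre_poly p' q' w) x = 0"
        using True by (simp add: fibre_rev poly_rev_poly_0 coeff_eq_0)
      then show ?thesis using r.rat_map_Some_eq_iff Some by simp
    next
      case False
      then have "poly (F w) (inverse x) = 0"
        using rat_map_Some_eq_iff[of "inverse x" w] Some by (simp add: w_def)
      then have "poly (fibre_poly p' q' w) x = 0"
        using False degree_fibre_le by (simp add: fibre_rev poly_rev_poly)
      then show ?thesis using r.rat_map_Some_eq_iff Some by simp
    qed
  qed
  then show ?thesis by (simp add: w_def)
qed

lemma ramification_rev: "ramification p' q' z = e (sphere_inv z)"
proof -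
  interpret r: rat_pair p' q' by (rule rev)
  define w where "w = R (sphere_inv z)"
  have rn: "r.n = n" using max_degree_rev by (simp add: r.n_def)
  show ?thesis
  proof (cases z)
    case None
    have e: "e (Some 0) = order 0 (F w)" using None by (intro ramification_Some) (simp add: w_def)
    \<comment> \<open>Reversal forgets a factor X^k of the fibre polynomial, so the reversed
      polynomial has degree n - k, and its deficit is the order k at 0.\<close>
    have "r.n - degree (rev_poly n (F w)) = order 0 (F w)"
    proof -
      obtain r where r: "F w = [:- 0, 1:] ^ order 0 (F w) * r" "\<not> [:- 0, 1:] dvd r"
        using order_decomp[OF fibre_nonzero] by blast
      define k where "k = order 0 (F w)"
      have r0: "coeff r 0 \<noteq> 0" using r(2) by (simp add: poly_0_coeff_0 poly_eq_0_iff_dvd flip: poly_0_coeff_0)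
      have Fw: "F w = monom 1 k * r" using r(1) by (simp add: monom_altdef k_def)
      have "r \<noteq> 0" using r0 by auto
      then have d: "degree (F w) = k + degree r"
        by (subst Fw) (simp add: degree_mult_eq degree_monom_eq)
      have X1: "reflect_poly [:0, 1 :: complex:] = 1" by (simp add: reflect_poly_def)
      have "reflect_poly (F w) = reflect_poly r"
        using X1 by (subst Fw) (simp add: reflect_poly_mult monom_altdef reflect_poly_power)
      then have "degree (reflect_poly (F w)) = degree r" using r0 by simp
      then have "degree (rev_poly n (F w)) = n - degree (F w) + degree r"
        using fibre_nonzero[of w] by (simp add: rev_poly_def degree_mult_eq degree_monom_eq)
      then show ?thesis using d degree_fibre_le[of w] by (simp add: rn k_def)
    qed
    then show ?thesis using r.ramification_None[of w] None e rat_map_rev[of z]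
      by (simp add: fibre_rev w_def)
  next
    case (Some x)
    have r: "ramification p' q' z = order x (rev_poly n (F w))"
      using r.ramification_Some[of x w] Some rat_map_rev[of z] by (simp add: fibre_rev w_def)
    show ?thesis
    proof (cases "x = 0")
      case True
      then show ?thesis using r ramification_None[of w] Some fibre_nonzero
        by (simp add: order_0_rev_poly w_def)
    next
      case False
      then show ?thesis using r ramification_Some[of "inverse x" w] Some fibre_nonzero[of w]
          order_rev_poly[of "F w" "inverse x" n]
        by (simp add: w_def)
    qed
  qed
qed

lemma continuous_map_rat_map_Some: "continuous_map euclidean CP1_top (\<lambda>x. R (Some x))"
proof (rule continuous_map_to_CP1I)
  fix x :: complex
  let ?A = "\<lambda>P. {x. poly P x \<noteq> 0}"
  have op: "open (?A P)" for P :: "complex poly"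
    by (intro open_Collect_neq continuous_intros)
  have co: "continuous_on (?A Q) (\<lambda>x. poly P x / poly Q x)" for P Q :: "complex poly"
    by (intro continuous_on_divide continuous_intros) auto
  show "\<exists>U g. openin euclidean U \<and> x \<in> U \<and> continuous_map (subtopology euclidean U) euclidean g \<and>
      ((\<forall>y\<in>U. R (Some y) = Some (g y)) \<or> (\<forall>y\<in>U. R (Some y) = sphere_inv (Some (g y))))"
  proof (cases "poly q x = 0")
    case False
    then show ?thesis using op[of q] co[of q p]
      by (intro exI[of _ "?A q"] exI[of _ "\<lambda>x. poly p x / poly q x"])
        (auto simp: rat_map_def continuous_map_iff_continuous2)
  next
    case True
    then have "poly p x \<noteq> 0" using no_common_root by blast
    then show ?thesis using op[of p] co[of p q]
      by (intro exI[of _ "?A p"] exI[of _ "\<lambda>x. poly q x / poly p x"])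
        (auto simp: rat_map_def sphere_inv_def continuous_map_iff_continuous2)
  qed
qed

lemma continuous_map_rat_map: "continuous_map CP1_top CP1_top R"
  using continuous_map_from_CP1I[OF continuous_map_rat_map_Some]
    rat_pair.continuous_map_rat_map_Some[OF rev] by (simp add: rat_map_rev)

end

section \<open>Rational functions as orbifold coverings\<close>

lemma inv_into_chart_affine: "inv_into (range Some) the u = Some u"
  by (rule inv_into_f_eq) (auto intro: inj_onI)

lemma inv_into_chart_infinity: "inv_into (- {Some 0}) (case_option 0 inverse) u = sphere_inv (Some (u :: complex))"
proof (rule inv_into_f_eq)
  show "inj_on (case_option 0 inverse) (- {Some (0 :: complex)})"
    by (auto simp: inj_on_def split: option.splits)
  show "sphere_inv (Some u) \<in> - {Some 0}" by (auto simp: sphere_inv_def)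
  show "case_option 0 inverse (sphere_inv (Some u)) = u" by (auto simp: sphere_inv_def)
qed

text \<open>Since \<open>chart_at\<close> chooses by \<open>SOME\<close>, the chart on the overlap
  is unknown; computations of local degrees therefore have to cover both charts.\<close>

lemma chart_at_CP1:
  "(chart_at CP1 z = (range Some, the) \<and> z \<noteq> None) \<or>
   (chart_at CP1 z = (- {Some 0}, case_option 0 inverse) \<and> z \<noteq> Some 0)"
proof -
  have "\<exists>c. c \<in> ratlas CP1 \<and> z \<in> fst c" by (cases z) (auto simp: ratlas_CP1)
  then have "chart_at CP1 z \<in> ratlas CP1 \<and> z \<in> fst (chart_at CP1 z)"
    unfolding chart_at_def by (rule someI_ex)
  then show ?thesis by (auto simp: ratlas_CP1)
qed

context rat_pair
begin

text \<open>Near x the function is (u - x)^e times r / q, which is nonzero at x. Nothing is asked of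
  h at the zeros of q, where \<open>the\<close> and division produce default values.\<close>

lemma zorder_quotient:
  assumes R: "R (Some x) = Some c"
    and h: "\<And>u. poly q u \<noteq> 0 \<Longrightarrow> h u = poly p u / poly q u - c"
  shows "zorder h x = int (e (Some x))"
proof -
  obtain r where r: "F (Some c) = [:- x, 1:] ^ order x (F (Some c)) * r" "\<not> [:- x, 1:] dvd r"
    using order_decomp[OF fibre_nonzero] by blast
  have e: "e (Some x) = order x (F (Some c))" using R by (rule ramification_Some)
  have qx: "poly q x \<noteq> 0" using R by (auto simp: rat_map_def split: if_splits)
  have rx: "poly r x \<noteq> 0" using r(2) by (simp add: poly_eq_0_iff_dvd)
  show ?thesis
  proof (rule zorder_eqI[where g = "\<lambda>u. poly r u / poly q u" and S = "{u. poly q u \<noteq> 0}"])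
    show "open {u. poly q u \<noteq> 0}" by (intro open_Collect_neq continuous_intros)
    show "(\<lambda>u. poly r u / poly q u) holomorphic_on {u. poly q u \<noteq> 0}"
      by (intro holomorphic_intros) auto
    fix w assume w: "w \<in> {u. poly q u \<noteq> 0}"
    have "poly (F (Some c)) w = (w - x) ^ e (Some x) * poly r w"
      by (subst r(1)) (simp add: e)
    then show "h w = poly r w / poly q w * (w - x) powi int (e (Some x))"
      using w h[of w] by (simp add: fibre_poly_def field_simps power_int_def)
  qed (use qx rx in auto)
qed

lemma zorder_target_chart:
  assumes "(V, \<psi>) \<in> ratlas CP1" "R (Some x) \<in> V"
  shows "zorder (\<lambda>u. \<psi> (R (Some u)) - \<psi> (R (Some x))) x = int (e (Some x))"
proof -
  consider "\<psi> = the" "R (Some x) \<noteq> None" | "\<psi> = case_option 0 inverse" "R (Some x) \<noteq> Some 0"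
    using assms by (auto simp: ratlas_CP1)
  then show ?thesis
  proof cases
    case 1
    then obtain c where c: "R (Some x) = Some c" by auto
    have "zorder (\<lambda>u. the (R (Some u)) - c) x = int (e (Some x))"
      by (rule zorder_quotient[OF c]) (simp add: rat_map_def)
    then show ?thesis using c 1 by simp
  next
    case 2
    interpret s: rat_pair q p by (rule swap)
    obtain c where c: "s.R (Some x) = Some c"
      using 2 by (cases "s.R (Some x)") (auto simp: rat_map_swap)
    have "\<psi> (R (Some x)) = c"
      using c 2 by (auto simp: rat_map_swap sphere_inv_def split: option.splits if_splits)
    moreover have "zorder (\<lambda>u. \<psi> (R (Some u)) - c) x = int (s.e (Some x))"
      by (rule s.zorder_quotient[OF c]) (simp add: 2 rat_map_def)
    ultimately show ?thesis by (simp add: ramification_swap)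
  qed
qed

lemma local_degree_rat_map: "local_degree CP1 CP1 R z = e z"
proof -
  obtain V \<psi> where V: "chart_at CP1 (R z) = (V, \<psi>)" by force
  then have atl: "(V, \<psi>) \<in> ratlas CP1" "R z \<in> V"
    using chart_at_CP1[of "R z"] by (auto simp: ratlas_CP1)
  show ?thesis
    using chart_at_CP1[of z]
  proof (elim disjE conjE)
    assume c: "chart_at CP1 z = (range Some, the)" and "z \<noteq> None"
    then obtain x where x: "z = Some x" by auto
    then show ?thesis using zorder_target_chart[OF atl(1), of x] atl(2) V c
      by (simp add: local_degree_def inv_into_chart_affine)
  next
    assume c: "chart_at CP1 z = (- {Some 0}, case_option 0 inverse)" and z: "z \<noteq> Some 0"
    interpret r: rat_pair p' q' by (rule rev)
    obtain x where x: "z = sphere_inv (Some x)" by (metis z not_None_eq sphere_inv_eq_None sphere_inv_inv)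
    have x2: "case_option 0 inverse (sphere_inv (Some x)) = x" by (auto simp: sphere_inv_def)
    have "zorder (\<lambda>u. \<psi> (r.R (Some u)) - \<psi> (r.R (Some x))) x = int (r.e (Some x))"
      using atl x by (intro r.zorder_target_chart) (auto simp: rat_map_rev)
    then have "zorder (\<lambda>u. \<psi> (R (sphere_inv (Some u))) - \<psi> (R z)) x = int (e z)"
      using x by (simp add: rat_map_rev ramification_rev)
    then show ?thesis using V c x2 unfolding x
      by (simp add: local_degree_def inv_into_chart_infinity)
  qed
qed

lemma holomorphic_target_chart:
  assumes "(V, \<psi>) \<in> ratlas CP1"
  shows "(\<lambda>u. \<psi> (R (Some u))) holomorphic_on {u. R (Some u) \<in> V}"
proof -
  consider "\<psi> = the" "V = range Some" | "\<psi> = case_option 0 inverse" "V = - {Some 0}"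
    using assms by (auto simp: ratlas_CP1)
  then show ?thesis
  proof cases
    case 1
    have "(\<lambda>u. poly p u / poly q u) holomorphic_on {u. R (Some u) \<in> V}"
      using 1 by (intro holomorphic_intros) (auto simp: rat_map_def)
    then show ?thesis
      by (rule holomorphic_transform) (use 1 in \<open>auto simp: rat_map_def split: if_splits\<close>)
  next
    case 2
    have "poly p u \<noteq> 0" if "R (Some u) \<noteq> Some 0" for u
      using that no_common_root[of u] by (auto simp: rat_map_def split: if_splits)
    then have "(\<lambda>u. poly q u / poly p u) holomorphic_on {u. R (Some u) \<in> V}"
      using 2 by (intro holomorphic_intros) auto
    then show ?thesis
      by (rule holomorphic_transform) (use 2 in \<open>auto simp: rat_map_def split: if_splits\<close>)
  qed
qed

lemma holomorphic_map_rat_map: "holomorphic_map CP1 CP1 R"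
proof -
  have "(\<psi> \<circ> R \<circ> inv_into U \<phi>) holomorphic_on \<phi> ` (U \<inter> R -` V)"
    if U: "(U, \<phi>) \<in> ratlas CP1" and V: "(V, \<psi>) \<in> ratlas CP1" for U \<phi> V \<psi>
  proof -
    consider "\<phi> = the" "U = range Some" | "\<phi> = case_option 0 inverse" "U = - {Some 0}"
      using U by (auto simp: ratlas_CP1)
    then show ?thesis
    proof cases
      case 1
      show ?thesis
        using holomorphic_target_chart[OF V]
        by (rule holomorphic_on_subset[THEN holomorphic_transform])
          (use 1 in \<open>auto simp: inv_into_chart_affine\<close>)
    next
      case 2
      interpret r: rat_pair p' q' by (rule rev)
      have "sphere_inv (Some (case_option 0 inverse z)) = z" if "z \<noteq> Some 0" for z
        using that by (cases z) (auto simp: sphere_inv_def)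
      then show ?thesis
        using r.holomorphic_target_chart[OF V] 
        by (intro holomorphic_on_subset[THEN holomorphic_transform, OF r.holomorphic_target_chart[OF V]])
          (use 2 in \<open>auto simp: inv_into_chart_infinity rat_map_rev\<close>)
    qed
  qed
  then show ?thesis
    using continuous_map_rat_map by (auto simp: holomorphic_map_def)
qed

text \<open>The whole sphere serves as the neighbourhood U: its preimage is one component, mapped
  onto U, and a continuous map from a compact to a Hausdorff space is proper.\<close>

lemma branched_covering_rat_map:
  assumes conn: "connected_space CP1_top"
  shows "branched_covering CP1 CP1 R"
proof -
  have "CP1_top \<noteq> trivial_topology" using topspace_CP1 by (metis topspace_discrete_topology UNIV_not_empty)
  then have comp: "connected_components_of CP1_top = {UNIV}"
    using conn by (simp add: connected_components_of_connected_space)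
  have "range R = UNIV" using surj_rat_map by (auto simp: image_iff) metis
  moreover have "proper_map CP1_top CP1_top R"
    by (intro continuous_imp_proper_map continuous_map_rat_map Hausdorff_imp_kc_space
        Hausdorff_CP1 compact_space_Alexandroff_compactification)
  moreover have "connectedin CP1_top UNIV" using conn by (simp add: connectedin_def)
  moreover have "openin CP1_top UNIV" by (metis openin_topspace topspace_CP1)
  moreover have "subtopology CP1_top UNIV = CP1_top" by simp
  ultimately show ?thesis
    unfolding branched_covering_def using holomorphic_map_rat_map comp
    by (auto intro!: exI[of _ UNIV])
qed

end

section \<open>Stereographic projection and simple connectedness of the sphere\<close>

lemma CP1_homeomorphic_sphere:
  "\<exists>\<sigma> h. homeomorphic_maps (top_of_set (sphere (0 :: complex \<times> real) 1)) CP1_top \<sigma> h"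
proof -
  let ?S = "sphere (0 :: complex \<times> real) 1"
  define \<sigma> where "\<sigma> = (\<lambda>(z :: complex, t :: real). if t = 1 then None else Some (z / of_real (1 - t)))"
  have S: "(z, t) \<in> ?S \<longleftrightarrow> z * cnj z = of_real ((1 - t) * (1 + t))" for z t
  proof -
    have "(z, t) \<in> ?S \<longleftrightarrow> (norm z)\<^sup>2 + t\<^sup>2 = 1" by (simp add: norm_Pair)
    also have "\<dots> \<longleftrightarrow> (norm z)\<^sup>2 = (1 - t) * (1 + t)" by (auto simp: power2_eq_square algebra_simps)
    also have "\<dots> \<longleftrightarrow> z * cnj z = of_real ((1 - t) * (1 + t))"
      unfolding complex_norm_square[symmetric] by (simp only: of_real_eq_iff)
    finally show ?thesis .
  qed
  \<comment> \<open>On the sphere \<open>z * cnj z = (1 - t) * (1 + t)\<close>, so z / (1 - t) has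
    the reciprocal cnj z / (1 + t), which is continuous at the north pole.\<close>
  have alt: "\<sigma> (z, t) = sphere_inv (Some (cnj z / of_real (1 + t)))" if "(z, t) \<in> ?S" "t \<noteq> -1" for z t
  proof (cases "t = 1")
    case True
    then show ?thesis using that S[of z t] by (simp add: \<sigma>_def)
  next
    case False
    have z: "z * cnj z = (1 - of_real t) * (1 + of_real t)" using that S by simp
    have nz: "1 - complex_of_real t \<noteq> 0" "1 + complex_of_real t \<noteq> 0"
      using False that(2) by (auto simp: complex_eq_iff)
    then have "cnj z \<noteq> 0" using z by auto
    then show ?thesis using False nz z by (simp add: \<sigma>_def field_simps)
  qed
  have "continuous_map (top_of_set ?S) CP1_top \<sigma>"
  proof (rule continuous_map_to_CP1I)
    fix y assume y: "y \<in> topspace (top_of_set ?S)"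
    have op: "openin (top_of_set ?S) (?S \<inter> {y. snd y \<noteq> s})" for s
      by (intro openin_open_Int open_Collect_neq continuous_intros)
    show "\<exists>U g. openin (top_of_set ?S) U \<and> y \<in> U \<and>
      continuous_map (subtopology (top_of_set ?S) U) euclidean g \<and>
      ((\<forall>y\<in>U. \<sigma> y = Some (g y)) \<or> (\<forall>y\<in>U. \<sigma> y = sphere_inv (Some (g y))))"
    proof (cases "snd y = 1")
      case False
      have "continuous_on (?S \<inter> {y. snd y \<noteq> 1}) (\<lambda>y. fst y / of_real (1 - snd y))"
        by (intro continuous_intros) auto
      then show ?thesis using op[of 1] False y
        by (intro exI[of _ "?S \<inter> {y. snd y \<noteq> 1}"] exI[of _ "\<lambda>y. fst y / of_real (1 - snd y)"])
          (auto simp: \<sigma>_def subtopology_subtopology)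
    next
      case True
      have "continuous_on (?S \<inter> {y. snd y \<noteq> -1}) (\<lambda>y. cnj (fst y) / of_real (1 + snd y))"
        by (intro continuous_intros) (auto simp: complex_eq_iff)
      then show ?thesis using op[of "-1"] True y alt
        by (intro exI[of _ "?S \<inter> {y. snd y \<noteq> -1}"] exI[of _ "\<lambda>y. cnj (fst y) / of_real (1 + snd y)"])
          (auto simp: subtopology_subtopology)
    qed
  qed
  moreover have "\<sigma> ` ?S = UNIV"
  proof -
    have "\<exists>y\<in>?S. \<sigma> y = w" for w
    proof (cases w)
      case None
      then show ?thesis using S[of 0 1] by (intro bexI[of _ "(0, 1)"]) (auto simp: \<sigma>_def)
    next
      case (Some x)
      define m where "m = (norm x)\<^sup>2"
      \<comment> \<open>The height of the preimage, obtained by solving m (1 - t) = 1 + t.\<close>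
      define t where "t = (m - 1) / (m + 1)"
      have m: "m + 1 > 0" by (simp add: m_def add_nonneg_pos)
      have t: "1 - t = 2 / (m + 1)" "1 + t = 2 * m / (m + 1)"
        using m by (simp_all add: t_def field_simps)
      have t1: "t \<noteq> 1" using m t(1) by auto
      have "x * cnj x = of_real m" unfolding m_def complex_norm_square ..
      then have "(x * of_real (1 - t)) * cnj (x * of_real (1 - t)) = of_real (m * (1 - t) * (1 - t))"
        by simp
      also have "m * (1 - t) * (1 - t) = (1 - t) * (1 + t)"
        unfolding t using m by (simp add: field_simps)
      finally have "(x * of_real (1 - t), t) \<in> ?S" using S by blast
      then show ?thesis using t1 Some
        by (intro bexI[of _ "(x * of_real (1 - t), t)"]) (auto simp: \<sigma>_def)
    qed
    then show ?thesis by (auto simp: image_iff) metis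
  qed
  moreover have "inj_on \<sigma> ?S"
  proof (rule inj_onI)
    fix y y' assume y: "y \<in> ?S" and y': "y' \<in> ?S" and eq: "\<sigma> y = \<sigma> y'"
    obtain z t where yz: "y = (z, t)" by force
    obtain z' t' where yz': "y' = (z', t')" by force
    show "y = y'"
    proof (cases "t = 1")
      case True
      then have "t' = 1" using eq by (auto simp: yz yz' \<sigma>_def split: if_splits)
      then show ?thesis using y y' True S[of z t] S[of z' t'] by (simp add: yz yz')
    next
      case False
      then have f': "t' \<noteq> 1" using eq by (auto simp: yz yz' \<sigma>_def split: if_splits)
      define x where "x = z / of_real (1 - t)"
      have "z' / of_real (1 - t') = x" using False f' eq by (simp add: x_def yz yz' \<sigma>_def)
      then have z: "z = x * of_real (1 - t)" "z' = x * of_real (1 - t')"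
      proof -
        have nz: "complex_of_real (1 - t) \<noteq> 0" "complex_of_real (1 - t') \<noteq> 0"
          using False f' by (simp_all only: of_real_eq_0_iff)
        show "z = x * of_real (1 - t)" unfolding x_def using nz by (intro nonzero_divide_eq_eq[THEN iffD1]) auto
        show "z' = x * of_real (1 - t')"
          using nz(2) \<open>z' / of_real (1 - t') = x\<close> by (intro nonzero_divide_eq_eq[THEN iffD1]) auto
      qed
      \<comment> \<open>The projected point x determines the height s, because this equation is
        linear in s with the nonzero coefficient |x|^2 + 1.\<close>
      have m: "(norm x)\<^sup>2 * (1 - s) = 1 + s" if "(x * of_real (1 - s), s) \<in> ?S" "s \<noteq> 1" for s
      proof -
        have "x * cnj x = of_real ((norm x)\<^sup>2)" unfolding complex_norm_square ..
        then have "(x * of_real (1 - s)) * cnj (x * of_real (1 - s))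
            = of_real ((norm x)\<^sup>2) * of_real ((1 - s) * (1 - s))"
          by (simp add: mult_ac)
        also have "\<dots> = of_real ((1 - s) * ((norm x)\<^sup>2 * (1 - s)))"
          by (simp only: of_real_mult[symmetric] mult_ac)
        finally have "complex_of_real ((1 - s) * ((norm x)\<^sup>2 * (1 - s))) = of_real ((1 - s) * (1 + s))"
          using S[of "x * of_real (1 - s)" s] that(1) by metis
        then show ?thesis using that(2) by (simp only: of_real_eq_iff) simp
      qed
      have "(norm x)\<^sup>2 * (1 - t) = 1 + t" "(norm x)\<^sup>2 * (1 - t') = 1 + t'"
        using m y y' False f' z by (auto simp: yz yz')
      then have "((norm x)\<^sup>2 + 1) * (t - t') = 0" by (simp add: algebra_simps)
      moreover have "(norm x)\<^sup>2 + 1 > 0" by (simp add: add_nonneg_pos)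
      ultimately have "t = t'" by simp
      then show ?thesis using z by (simp add: yz yz')
    qed
  qed
  moreover have "compact_space (top_of_set ?S)" by (simp add: compact_space_subtopology)
  ultimately have "homeomorphic_map (top_of_set ?S) CP1_top \<sigma>"
    by (intro bijective_closed_imp_homeomorphic_map continuous_imp_closed_map_gen
        Hausdorff_imp_kc_space Hausdorff_CP1) auto
  then show ?thesis by (auto simp: homeomorphic_map_maps)
qed

lemma simply_connected_CP1: "simply_connected_space CP1_top"
proof -
  let ?S = "sphere (0 :: complex \<times> real) 1"
  obtain \<sigma> h where \<sigma>h: "homeomorphic_maps (top_of_set ?S) CP1_top \<sigma> h"
    using CP1_homeomorphic_sphere by blast
  have sc: "simply_connected ?S" by (rule simply_connected_sphere) simp
  have \<sigma>: "continuous_map (top_of_set ?S) CP1_top \<sigma>" and h: "continuous_map CP1_top (top_of_set ?S) h"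
    and id: "\<And>z. \<sigma> (h z) = z" using \<sigma>h by (auto simp: homeomorphic_maps_def)
  have hS: "h z \<in> ?S" for z using continuous_map_image_subset_topspace[OF h]
    unfolding topspace_CP1 topspace_euclidean_subtopology by blast
  have "path_connected ?S" using sc by (rule simply_connected_imp_path_connected)
  then have "path_connectedin (top_of_set ?S) ?S"
    by (simp add: path_connectedin_subtopology)
  then have "path_connectedin CP1_top (\<sigma> ` ?S)" by (rule path_connectedin_continuous_map_image[OF \<sigma>])
  moreover have "\<sigma> ` ?S = UNIV" using hS id by (metis UNIV_eq_I image_eqI)
  ultimately have "path_connected_space CP1_top"
    by (metis path_connectedin_topspace topspace_CP1)
  moreover have "\<exists>a. homotopic_with (\<lambda>h. h 1 = h 0) (top_of_set {0..1}) CP1_top g (\<lambda>_. a)"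
    if g: "pathin CP1_top g" "g 1 = g 0" for g
  proof -
    have "continuous_map (top_of_set {0..1}) (top_of_set ?S) (h \<circ> g)"
      using g(1) h continuous_map_compose unfolding pathin_def by blast
    then have "path (h \<circ> g)" "path_image (h \<circ> g) \<subseteq> ?S"
      by (auto simp: path_def path_image_def continuous_map_subtopology_eu)
    moreover have "pathfinish (h \<circ> g) = pathstart (h \<circ> g)"
      using g by (simp add: pathfinish_def pathstart_def)
    moreover define a where "a = h None"
    have "path (\<lambda>_ :: real. a)" "path_image (\<lambda>_ :: real. a) \<subseteq> ?S"
      "pathfinish (\<lambda>_ :: real. a) = pathstart (\<lambda>_ :: real. a)"
      using hS[of None] by (auto simp: path_def path_image_def pathfinish_def pathstart_def a_def)
    ultimately have "homotopic_loops ?S (h \<circ> g) (\<lambda>_. a)"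
      using sc unfolding simply_connected_def by blast
    then have "homotopic_with (\<lambda>k. k 1 = k 0) (top_of_set {0..1}) CP1_top (\<sigma> \<circ> (h \<circ> g)) (\<sigma> \<circ> (\<lambda>_. a))"
      unfolding homotopic_loops_def
      by (rule homotopic_with_compose_continuous_map_left[OF _ \<sigma>])
        (simp add: pathfinish_def pathstart_def)
    moreover have "\<sigma> \<circ> (h \<circ> g) = g" "\<sigma> \<circ> (\<lambda>_. a) = (\<lambda>_ :: real. None)"
      by (auto simp: id a_def)
    ultimately show ?thesis by auto
  qed
  ultimately show ?thesis by (simp add: simply_connected_space_def)
qed

lemma connected_CP1: "connected_space CP1_top"
  using simply_connected_CP1 by (simp add: simply_connected_space_def path_connected_imp_connected_space)

lemma (in rat_pair) universal_covering_rat_map: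
  assumes orb: "orbifold CP1 \<nu>" and \<nu>: "\<And>z. \<nu> (R z) = e z"
  shows "universal_covering CP1 R CP1 \<nu>"
proof -
  have "orbifold CP1 (\<lambda>_. 1)" using orb by (simp add: orbifold_def)
  then have "orbifold_covering CP1 (\<lambda>_. 1) CP1 \<nu> R"
    using orb branched_covering_rat_map[OF connected_CP1]
    by (simp add: orbifold_covering_def \<nu> local_degree_rat_map)
  moreover have "non_ramified CP1 (\<lambda>_. 1)" by (simp add: non_ramified_def)
  ultimately show ?thesis using simply_connected_CP1 by (auto simp: universal_covering_def)
qed

lemma finite_ramified_orbifold:
  assumes "orbifold CP1 \<nu>"
  shows "finite {w. \<nu> w \<noteq> 1}"
proof (rule ccontr)
  assume "infinite {w. \<nu> w \<noteq> 1}"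
  moreover have "compact_space CP1_top" by simp
  ultimately have "CP1_top derived_set_of {w. \<nu> w \<noteq> 1} \<noteq> {}"
    by (intro compact_space_imp_Bolzano_Weierstrass) auto
  then show False using assms by (simp add: orbifold_def)
qed

section \<open>Lifting through an orbifold covering\<close>

context rat_pair
begin

text \<open>Near x the fibre polynomial is (u - x)^k s, with s and q nonvanishing on a small disc.
  There s / q has a logarithm, hence a k-th root g, and h = (u - x) g is a local coordinate.\<close>

lemma local_power_form:
  assumes R: "R (Some x) = Some c"
  obtains r h where "r > 0" "h holomorphic_on ball x r" "h x = 0" "deriv h x \<noteq> 0"
    "\<And>u. u \<in> ball x r \<Longrightarrow> R (Some u) = Some (c + h u ^ e (Some x))"
proof -
  define k where "k = e (Some x)"
  have k1: "k = order x (F (Some c))" unfolding k_def using R by (rule ramification_Some)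
  have "k > 0" unfolding k_def by (rule ramification_pos)
  note k = k1 this
  obtain s where s: "F (Some c) = [:- x, 1:] ^ k * s" "\<not> [:- x, 1:] dvd s"
    using order_decomp[OF fibre_nonzero] k(1) by metis
  have sx: "poly s x \<noteq> 0" using s(2) by (simp add: poly_eq_0_iff_dvd)
  have qx: "poly q x \<noteq> 0" using R by (auto simp: rat_map_def split: if_splits)
  have "open ({u. poly q u \<noteq> 0} \<inter> {u. poly s u \<noteq> 0})"
    by (intro open_Int open_Collect_neq continuous_intros)
  then obtain r where r: "r > 0" and ball: "ball x r \<subseteq> {u. poly q u \<noteq> 0} \<inter> {u. poly s u \<noteq> 0}"
    using sx qx openE[of _ x] by blast
  have "(\<lambda>u. poly s u / poly q u) holomorphic_on ball x r"
    using ball by (intro holomorphic_intros) auto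
  moreover have "poly s u / poly q u \<noteq> 0" if "u \<in> ball x r" for u using ball that by auto
  ultimately obtain l where l: "l holomorphic_on ball x r"
      "\<And>u. u \<in> ball x r \<Longrightarrow> poly s u / poly q u = exp (l u)"
    using contractible_imp_holomorphic_log[OF _ convex_imp_contractible[OF convex_ball]] by blast
  define g where "g u = exp (l u / of_nat k)" for u
  define h where "h u = (u - x) * g u" for u
  have g: "g holomorphic_on ball x r" unfolding g_def using l(1) k(2) by (intro holomorphic_intros) auto
  then have h: "h holomorphic_on ball x r" unfolding h_def by (intro holomorphic_intros)
  have "(g has_field_derivative deriv g x) (at x)"
    using g r by (intro holomorphic_derivI[of g "ball x r"]) auto
  then have "(h has_field_derivative g x) (at x)"
    unfolding h_def by (auto intro!: derivative_eq_intros)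
  then have dh: "deriv h x \<noteq> 0" by (simp add: DERIV_imp_deriv g_def)
  have "R (Some u) = Some (c + h u ^ k)" if u: "u \<in> ball x r" for u
  proof -
    have qu: "poly q u \<noteq> 0" using ball u by auto
    have "g u ^ k = poly s u / poly q u" using l(2)[OF u] k(2) by (simp add: g_def flip: exp_of_nat_mult)
    then have "h u ^ k = (u - x) ^ k * poly s u / poly q u" by (simp add: h_def power_mult_distrib)
    also have "(u - x) ^ k * poly s u = poly (F (Some c)) u" by (subst s(1)) simp
    finally have "c + h u ^ k = poly p u / poly q u"
      using qu by (simp add: fibre_poly_def field_simps)
    then show ?thesis using qu by (simp add: rat_map_def)
  qed
  then show ?thesis using that[OF r h _ dh] by (simp add: h_def k_def)
qed

text \<open>The local coordinate of \<open>local_power_form\<close> is inverted near 0. Openness of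
  the image makes it usable as a neighbourhood of x.\<close>

lemma local_section_affine:
  assumes R: "R (Some x) = Some c"
  obtains \<rho> k where "\<rho> > 0" "k holomorphic_on ball 0 \<rho>" "k 0 = x" "open (k ` ball 0 \<rho>)"
    "\<And>t. t \<in> ball 0 \<rho> \<Longrightarrow> R (Some (k t)) = Some (c + t ^ e (Some x))"
proof -
  obtain r h where r: "r > 0" and h: "h holomorphic_on ball x r" "h x = 0" "deriv h x \<noteq> 0"
    and eq: "\<And>u. u \<in> ball x r \<Longrightarrow> R (Some u) = Some (c + h u ^ e (Some x))"
    using local_power_form[OF R] by metis
  obtain s where s: "s > 0" "ball x s \<subseteq> ball x r" and inj: "inj_on h (ball x s)"
    using has_complex_derivative_locally_injective[OF h(1) _ _ h(3)] r by auto
  have hs: "h holomorphic_on ball x s" using h(1) s(2) holomorphic_on_subset by blast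
  have op: "open (h ` ball x s)" using open_mapping_thm3[OF hs _ inj] by simp
  obtain k where k: "k holomorphic_on h ` ball x s" "\<And>u. u \<in> ball x s \<Longrightarrow> k (h u) = u"
    using holomorphic_has_inverse[OF hs open_ball inj] by metis
  have "0 \<in> h ` ball x s" using h(2) s(1) by (metis centre_in_ball image_eqI)
  then obtain \<rho> where \<rho>: "\<rho> > 0" "ball 0 \<rho> \<subseteq> h ` ball x s" using op openE by blast
  have k\<rho>: "k holomorphic_on ball 0 \<rho>" using k(1) \<rho>(2) holomorphic_on_subset by blast
  have hk: "k t \<in> ball x s" "h (k t) = t" if t: "t \<in> ball 0 \<rho>" for t
  proof -
    obtain u where "u \<in> ball x s" "t = h u" using \<rho>(2) t by auto
    then show "k t \<in> ball x s" "h (k t) = t" using k(2) by auto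
  qed
  have "inj_on k (ball 0 \<rho>)" using hk(2) by (metis inj_onI)
  then have "open (k ` ball 0 \<rho>)" using open_mapping_thm3[OF k\<rho>] by simp
  moreover have "k 0 = x" using k(2)[of x] h(2) s(1) by simp
  moreover have "R (Some (k t)) = Some (c + t ^ e (Some x))" if "t \<in> ball 0 \<rho>" for t
    using eq[of "k t"] hk[OF that] s(2) by auto
  ultimately show ?thesis using that \<rho>(1) k\<rho> by blast
qed

text \<open>Only continuity is claimed because y may be infinity, where the section is taken from
  the reversed pair.\<close>

lemma local_section:
  assumes R: "R y = Some c"
  obtains \<rho> s where "\<rho> > 0" "continuous_map (top_of_set (ball 0 \<rho>)) CP1_top s" "s 0 = y"
    "openin CP1_top (s ` ball 0 \<rho>)" "\<And>t. t \<in> ball 0 \<rho> \<Longrightarrow> R (s t) = Some (c + t ^ e y)"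
proof (cases y)
  case (Some x)
  obtain \<rho> k where k: "\<rho> > 0" "k holomorphic_on ball 0 \<rho>" "k 0 = x" "open (k ` ball 0 \<rho>)"
    "\<And>t. t \<in> ball 0 \<rho> \<Longrightarrow> R (Some (k t)) = Some (c + t ^ e (Some x))"
    using local_section_affine R Some by metis
  have "continuous_map (top_of_set (ball 0 \<rho>)) euclidean k"
    using k(2) holomorphic_on_imp_continuous_on by auto
  then have "continuous_map (top_of_set (ball 0 \<rho>)) CP1_top (Some \<circ> k)"
    using continuous_map_Some by (rule continuous_map_compose)
  moreover have "openin CP1_top ((Some \<circ> k) ` ball 0 \<rho>)" using k(4) by (simp flip: image_image)
  ultimately show ?thesis using that[of \<rho> "Some \<circ> k"] k Some by simp
next
  case None
  interpret r: rat_pair p' q' by (rule rev)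
  have "r.R (Some 0) = Some c" using R None by (simp add: rat_map_rev)
  then obtain \<rho> k where k: "\<rho> > 0" "k holomorphic_on ball 0 \<rho>" "k 0 = 0" "open (k ` ball 0 \<rho>)"
    "\<And>t. t \<in> ball 0 \<rho> \<Longrightarrow> r.R (Some (k t)) = Some (c + t ^ r.e (Some 0))"
    using r.local_section_affine by metis
  have "continuous_map (top_of_set (ball 0 \<rho>)) euclidean k"
    using k(2) holomorphic_on_imp_continuous_on by auto
  then have "continuous_map (top_of_set (ball 0 \<rho>)) CP1_top (sphere_inv \<circ> (Some \<circ> k))"
    by (intro continuous_map_compose[OF _ continuous_map_sphere_inv]
        continuous_map_compose[OF _ continuous_map_Some])
  moreover have "openin CP1_top (sphere_inv ` Some ` k ` ball 0 \<rho>)"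
    using k(4) by (intro openin_image_sphere_inv) simp
  then have "openin CP1_top ((sphere_inv \<circ> (Some \<circ> k)) ` ball 0 \<rho>)" by (simp add: image_comp)
  moreover have "R ((sphere_inv \<circ> (Some \<circ> k)) t) = Some (c + t ^ e y)" if "t \<in> ball 0 \<rho>" for t
    using k(5)[OF that] None by (simp only: rat_map_rev ramification_rev o_def sphere_inv_simps)
  moreover have "(sphere_inv \<circ> (Some \<circ> k)) 0 = y" using k(3) None by simp
  ultimately show ?thesis using that[OF k(1)] by blast
qed

text \<open>With local degree 1 the map inverts its section on the image; a value infinity is first
  moved to 0 by exchanging p and q.\<close>

lemma locally_injective:
  assumes "e y = 1"
  obtains N where "openin CP1_top N" "y \<in> N" "inj_on R N"
proof -
  have *: "\<exists>N. openin CP1_top N \<and> y \<in> N \<and> inj_on (rat_map p q) N"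
    if r: "rat_pair p q" "ramification p q y = 1" "rat_map p q y = Some c" for c p q
  proof -
    interpret r: rat_pair p q by (rule r)
    obtain \<rho> s where s: "\<rho> > 0" "s 0 = y" "openin CP1_top (s ` ball 0 \<rho>)"
      "\<And>t. t \<in> ball 0 \<rho> \<Longrightarrow> r.R (s t) = Some (c + t ^ r.e y)"
      using r.local_section[OF r(3)] by metis
    have "inj_on r.R (s ` ball 0 \<rho>)"
      using s(4) r(2) by (auto simp: inj_on_def)
    moreover have "y \<in> s ` ball 0 \<rho>" using s(1,2) by (metis centre_in_ball image_eqI)
    ultimately show ?thesis using s(3) by blast
  qed
  show ?thesis
  proof (cases "R y")
    case (Some c)
    then show ?thesis using * that rat_pair_axioms assms by blast
  next
    case None
    then have "rat_map q p y = Some 0" by (simp add: rat_map_swap)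
    then obtain N where "openin CP1_top N" "y \<in> N" "inj_on (rat_map q p) N"
      using *[OF swap] assms ramification_swap by metis
    then show ?thesis using that by (auto simp: inj_on_def rat_map_swap)
  qed
qed

text \<open>The map is closed by compactness, so the image of the points outside all N y is closed.
  It misses w, and its complement is V.\<close>

lemma ex_neighbourhood_fibre:
  assumes N: "\<And>y. R y = w \<Longrightarrow> openin CP1_top (N y) \<and> y \<in> N y"
  obtains V where "openin CP1_top V" "w \<in> V" "\<And>y. R y \<in> V \<Longrightarrow> \<exists>y'. R y' = w \<and> y \<in> N y'"
proof -
  let ?C = "- (\<Union>y\<in>{y. R y = w}. N y)"
  have "openin CP1_top (\<Union>y\<in>{y. R y = w}. N y)" using N by blast
  then have "closedin CP1_top ?C" by (simp add: closedin_def Compl_eq_Diff_UNIV double_diff)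
  moreover have "closed_map CP1_top CP1_top R"
    by (intro continuous_imp_closed_map_gen continuous_map_rat_map Hausdorff_imp_kc_space
        Hausdorff_CP1 compact_space_Alexandroff_compactification)
  ultimately have "closedin CP1_top (R ` ?C)" by (auto simp: closed_map_def)
  then have "openin CP1_top (- (R ` ?C))" by (simp add: closedin_def Compl_eq_Diff_UNIV)
  moreover have "w \<in> - (R ` ?C)" using N by blast
  moreover have "\<exists>y'. R y' = w \<and> y \<in> N y'" if "R y \<in> - (R ` ?C)" for y using that by blast
  ultimately show ?thesis using that by blast
qed

end

lemma balls_meet_inside:
  fixes z :: complex
  assumes "R > 0" "p \<in> sphere z R" "p' \<in> sphere z R" "ball p r \<inter> ball p' r' \<noteq> {}"
  shows "ball p r \<inter> ball p' r' \<inter> ball z R \<noteq> {}"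
proof -
  obtain v where v: "v \<in> ball p r" "v \<in> ball p' r'" using assms(4) by blast
  \<comment> \<open>The projection onto the disc is nonexpansive and fixes \<open>p\<close> and \<open>p'\<close>.\<close>
  define w where "w = closest_point (cball z R) v"
  have ne: "cball z R \<noteq> {}" using assms(1) by simp
  have "dist (closest_point (cball z R) x) w \<le> dist x v" for x
    unfolding w_def using ne by (intro closest_point_lipschitz) auto
  moreover have "closest_point (cball z R) p = p" "closest_point (cball z R) p' = p'"
    using assms by (auto intro!: closest_point_self)
  ultimately have "w \<in> ball p r" "w \<in> ball p' r'" using v by (metis mem_ball order_le_less_trans)+
  moreover have "w \<in> closure (ball z R)"
    using closest_point_in_set[of "cball z R" v] ne assms(1) by (simp add: w_def closure_ball)
  ultimately show ?thesis
    using open_Int_closure_eq_empty[of "ball p r \<inter> ball p' r'" "ball z R"] by blast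
qed

section \<open>Continuous lifts of f through \<theta>\<close>

locale orbifold_lift = th: rat_pair p q + f: rat_pair a b
  for p q a b :: "complex poly" +
  fixes \<nu> :: "complex option \<Rightarrow> nat"
  assumes ramification_th: "ramification p q y = \<nu> (rat_map p q y)"
    and dvd_ramification_f: "\<nu> (rat_map a b z) dvd ramification a b z"
    and finite_ramified_values: "finite {w. \<nu> w \<noteq> 1}"
begin

abbreviation "\<theta> \<equiv> rat_map p q"
abbreviation "\<phi> \<equiv> rat_map a b"

text \<open>Continuity suffices at this stage: gluing stays purely topological and the value
  infinity needs no special treatment.\<close>

definition lift_on :: "complex set \<Rightarrow> (complex \<Rightarrow> complex option) \<Rightarrow> bool" where
  "lift_on S g \<longleftrightarrow> continuous_map (top_of_set S) CP1_top g \<and> (\<forall>z\<in>S. \<theta> (g z) = \<phi> (Some z))"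

text \<open>Exchanging both pairs inverts the values of \<theta> and f together. The lifts remain
  the same, so a value infinity of f reduces to the value 0.\<close>

lemma swap_lift: "orbifold_lift q p b a (\<nu> \<circ> sphere_inv)"
proof -
  interpret ths: rat_pair q p by (rule th.swap)
  interpret fs: rat_pair b a by (rule f.swap)
  have "{w. (\<nu> \<circ> sphere_inv) w \<noteq> 1} = sphere_inv ` {w. \<nu> w \<noteq> 1}"
    by (auto simp: image_iff) (metis sphere_inv_inv)
  then have "finite {w. (\<nu> \<circ> sphere_inv) w \<noteq> 1}" using finite_ramified_values by simp
  then show ?thesis
    by unfold_locales (auto simp: th.ramification_swap f.ramification_swap ramification_th
        th.rat_map_swap f.rat_map_swap dvd_ramification_f)
qed

text \<open>A lift through y0 is a section of \<theta> over c composed with a multiple of an m-th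
  root G of f - c. One radius has to serve all starting pairs, since \<open>lift_on_ball\<close>
  picks the starting point after the disc.\<close>

lemma local_lift_finite:
  assumes c: "\<phi> (Some x) = Some c"
  shows "\<exists>r>0. \<forall>z0\<in>ball x r. \<forall>y0. \<theta> y0 = \<phi> (Some z0) \<longrightarrow> (\<exists>g. lift_on (ball x r) g \<and> g z0 = y0)"
proof -
  define m where "m = \<nu> (Some c)"
  have "\<exists>\<rho> s. \<rho> > 0 \<and> continuous_map (top_of_set (ball 0 \<rho>)) CP1_top s \<and> s 0 = y \<and>
      openin CP1_top (s ` ball 0 \<rho>) \<and> (\<forall>t\<in>ball 0 \<rho>. \<theta> (s t) = Some (c + t ^ m))"
    if y: "\<theta> y = Some c" for y
    using th.local_section[OF y] ramification_th[of y] y unfolding m_def by metis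
  then have "\<forall>y. \<exists>\<rho> s. \<theta> y = Some c \<longrightarrow> \<rho> > 0 \<and> continuous_map (top_of_set (ball 0 \<rho>)) CP1_top s \<and>
      s 0 = y \<and> openin CP1_top (s ` ball 0 \<rho>) \<and> (\<forall>t\<in>ball 0 \<rho>. \<theta> (s t) = Some (c + t ^ m))"
    by blast
  then obtain \<rho> s where \<rho>s: "\<forall>y. \<theta> y = Some c \<longrightarrow> \<rho> y > 0 \<and>
      continuous_map (top_of_set (ball 0 (\<rho> y))) CP1_top (s y) \<and> s y 0 = y \<and>
      openin CP1_top (s y ` ball 0 (\<rho> y)) \<and> (\<forall>t\<in>ball 0 (\<rho> y). \<theta> (s y t) = Some (c + t ^ m))"
    unfolding choice_iff by blast
  have \<rho>: "\<And>y. \<theta> y = Some c \<Longrightarrow> \<rho> y > 0"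
    and s: "\<And>y. \<theta> y = Some c \<Longrightarrow> continuous_map (top_of_set (ball 0 (\<rho> y))) CP1_top (s y)"
      "\<And>y. \<theta> y = Some c \<Longrightarrow> s y 0 = y"
      "\<And>y. \<theta> y = Some c \<Longrightarrow> openin CP1_top (s y ` ball 0 (\<rho> y))"
      "\<And>y t. \<theta> y = Some c \<Longrightarrow> t \<in> ball 0 (\<rho> y) \<Longrightarrow> \<theta> (s y t) = Some (c + t ^ m)"
    using \<rho>s by blast+
  have inN: "y \<in> s y ` ball 0 (\<rho> y)" if "\<theta> y = Some c" for y
    using \<rho> s(2) that by (metis centre_in_ball image_eqI)
  \<comment> \<open>Over values near c every point lies on one of the chosen sections; this puts an
    arbitrary y0 into the form \<open>s y t\<close>.\<close>
  obtain V where V: "openin CP1_top V" "Some c \<in> V"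
    "\<And>y. \<theta> y \<in> V \<Longrightarrow> \<exists>y'. \<theta> y' = Some c \<and> y \<in> s y' ` ball 0 (\<rho> y')"
    using th.ex_neighbourhood_fibre[of "Some c" "\<lambda>y. s y ` ball 0 (\<rho> y)"] s(3) inN by metis
  obtain r h where r: "r > 0" and h: "h holomorphic_on ball x r" "h x = 0"
    and eq: "\<And>u. u \<in> ball x r \<Longrightarrow> \<phi> (Some u) = Some (c + h u ^ f.e (Some x))"
    using f.local_power_form[OF c] by metis
  obtain l where l: "f.e (Some x) = m * l"
    using dvd_ramification_f[of "Some x"] c by (auto simp: m_def)
  have ml: "m > 0" "l > 0" using l f.ramification_pos[of "Some x"] by auto
  define G where "G u = h u ^ l" for u
  have G: "continuous_on (ball x r) G" unfolding G_def
    using h(1) holomorphic_on_imp_continuous_on by (intro continuous_intros) auto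
  have Gx: "G x = 0" using h(2) ml by (simp add: G_def)
  have eqG: "\<phi> (Some u) = Some (c + G u ^ m)" if "u \<in> ball x r" for u
    using eq[OF that] by (simp add: G_def l mult.commute flip: power_mult)
  \<comment> \<open>A common radius for the finitely many sections over c.\<close>
  define \<rho>0 where "\<rho>0 = Min (\<rho> ` {y. \<theta> y = Some c})"
  have ne: "{y. \<theta> y = Some c} \<noteq> {}" using th.surj_rat_map by auto
  have \<rho>0: "\<rho>0 > 0" "\<And>y. \<theta> y = Some c \<Longrightarrow> \<rho>0 \<le> \<rho> y"
    unfolding \<rho>0_def using ne th.finite_fibre \<rho> by (auto simp: Min_gr_iff)
  have "open (ball x r \<inter> G -` ball 0 \<rho>0)"
    by (intro continuous_open_preimage G) auto
  moreover have "open {u. \<phi> (Some u) \<in> V}"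
    using openin_continuous_map_preimage[OF f.continuous_map_rat_map_Some V(1)] by simp
  ultimately have "open (ball x r \<inter> G -` ball 0 \<rho>0 \<inter> {u. \<phi> (Some u) \<in> V})" by blast
  moreover have "x \<in> ball x r \<inter> G -` ball 0 \<rho>0 \<inter> {u. \<phi> (Some u) \<in> V}"
    using r Gx \<rho>0 V(2) c by simp
  ultimately obtain r' where r': "r' > 0" "ball x r' \<subseteq> ball x r \<inter> G -` ball 0 \<rho>0 \<inter> {u. \<phi> (Some u) \<in> V}"
    by (meson openE)
  have "\<exists>g. lift_on (ball x r') g \<and> g z0 = y0"
    if z0: "z0 \<in> ball x r'" and y0: "\<theta> y0 = \<phi> (Some z0)" for z0 y0
  proof -
    have "\<theta> y0 \<in> V" using z0 r'(2) y0 by auto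
    then obtain y t where y: "\<theta> y = Some c" and t: "t \<in> ball 0 (\<rho> y)" "y0 = s y t"
      using V(3) by blast
    have "\<theta> y0 = Some (c + t ^ m)" using s(4)[OF y t(1)] t(2) by simp
    then have tG: "t ^ m = G z0 ^ m" using y0 eqG[of z0] z0 r'(2) by auto
    \<comment> \<open>Any two \<open>m\<close>-th roots differ by a root of unity, which is constant along the lift.\<close>
    define \<zeta> where "\<zeta> = (if G z0 = 0 then 1 else t / G z0)"
    have \<zeta>: "\<zeta> ^ m = 1" "t = \<zeta> * G z0"
    proof -
      show "\<zeta> ^ m = 1" using tG ml by (simp add: \<zeta>_def power_divide)
      show "t = \<zeta> * G z0"
      proof (cases "G z0 = 0")
        case True
        then have "t ^ m = 0" using tG ml by (simp add: power_0_left)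
        then show ?thesis using True by simp
      qed (simp add: \<zeta>_def)
    qed
    have "norm \<zeta> ^ m = 1 ^ m" using \<zeta>(1) by (metis norm_power norm_one power_one)
    then have n\<zeta>: "norm \<zeta> = 1" by (rule power_eq_imp_eq_base) (use ml in simp_all)
    have sub: "\<zeta> * G u \<in> ball 0 (\<rho> y)" if "u \<in> ball x r'" for u
    proof -
      have "norm (G u) < \<rho>0" using that r'(2) by auto
      then show ?thesis using \<rho>0(2)[OF y] n\<zeta> by (simp add: norm_mult)
    qed
    have "continuous_on (ball x r') (\<lambda>u. \<zeta> * G u)"
      using G r'(2) continuous_on_subset by (intro continuous_intros) auto
    then have "continuous_map (top_of_set (ball x r')) (top_of_set (ball 0 (\<rho> y))) (\<lambda>u. \<zeta> * G u)"
      using sub by auto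
    then have "continuous_map (top_of_set (ball x r')) CP1_top (s y \<circ> (\<lambda>u. \<zeta> * G u))"
      using s(1)[OF y] by (rule continuous_map_compose)
    moreover have "\<theta> (s y (\<zeta> * G u)) = \<phi> (Some u)" if u: "u \<in> ball x r'" for u
    proof -
      have "\<phi> (Some u) = Some (c + G u ^ m)" using eqG u r'(2) by auto
      then show ?thesis using s(4)[OF y sub[OF u]] \<zeta>(1) by (simp add: power_mult_distrib)
    qed
    ultimately show ?thesis
      using \<zeta>(2) t(2) by (intro exI[of _ "s y \<circ> (\<lambda>u. \<zeta> * G u)"]) (simp add: lift_on_def)
  qed
  then show ?thesis using r'(1) by blast
qed

lemma local_lift:
  "\<exists>r>0. \<forall>z0\<in>ball x r. \<forall>y0. \<theta> y0 = \<phi> (Some z0) \<longrightarrow> (\<exists>g. lift_on (ball x r) g \<and> g z0 = y0)"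
proof (cases "\<phi> (Some x)")
  case (Some c)
  then show ?thesis by (rule local_lift_finite)
next
  case None
  interpret s: orbifold_lift q p b a "\<nu> \<circ> sphere_inv" by (rule swap_lift)
  have "s.lift_on = lift_on"
    by (auto simp: fun_eq_iff s.lift_on_def lift_on_def th.rat_map_swap f.rat_map_swap)
  moreover have "rat_map b a (Some x) = Some 0" using None by (simp add: f.rat_map_swap)
  ultimately show ?thesis using s.local_lift_finite[of x 0]
    by (simp add: th.rat_map_swap f.rat_map_swap)
qed

text \<open>Away from these points \<theta> has local degree 1 at every point of the fibre over f z,
  so lifts agreeing at z agree nearby.\<close>

definition branch_points :: "complex set" where "branch_points = {z. \<nu> (\<phi> (Some z)) \<noteq> 1}"

lemma finite_branch_points: "finite branch_points"
proof -
  have "Some ` branch_points \<subseteq> (\<Union>w\<in>{w. \<nu> w \<noteq> 1}. {z. \<phi> z = w})" by (auto simp: branch_points_def)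
  moreover have "finite \<dots>" using finite_ramified_values f.finite_fibre by blast
  ultimately show ?thesis using finite_subset finite_imageD inj_Some inj_on_subset by (metis subset_UNIV)
qed

lemma ex_not_branch_point:
  assumes "open S" "S \<noteq> {}"
  shows "\<exists>z\<in>S. z \<notin> branch_points"
proof (rule ccontr)
  assume "\<not> ?thesis"
  then have "S \<subseteq> branch_points" by blast
  then have "finite S" using finite_branch_points by (rule finite_subset)
  then show False using assms finite_imp_not_open by blast
qed

text \<open>The agreement set is clopen in S minus \<open>branch_points\<close>, which stays
  connected because only finitely many points of a plane domain are removed. The remaining
  disagreement set is open and finite, hence empty.\<close>

lemma lift_unique:
  assumes S: "open S" "connected S" and g: "lift_on S g1" "lift_on S g2"
    and z0: "z0 \<in> S" "z0 \<notin> branch_points" "g1 z0 = g2 z0" and z: "z \<in> S"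
  shows "g1 z = g2 z"
proof -
  have cg: "continuous_map (top_of_set S) CP1_top g1" "continuous_map (top_of_set S) CP1_top g2"
    using g by (auto simp: lift_on_def)
  have "closedin (top_of_set S) {z \<in> topspace (top_of_set S). g1 z = g2 z}"
    using Hausdorff_CP1 cg by (rule closedin_continuous_maps_eq)
  then have clE: "closedin (top_of_set S) {z \<in> S. g1 z = g2 z}" by simp
  let ?S' = "S - branch_points" and ?E = "{z \<in> S - branch_points. g1 z = g2 z}"
  have opS': "open ?S'" using S(1) finite_branch_points by (simp add: finite_imp_closed open_Diff)
  have conS': "connected ?S'" using S finite_branch_points by (intro connected_open_delete_finite) auto
  obtain C where C: "closed C" "{z \<in> S. g1 z = g2 z} = S \<inter> C" using clE unfolding closedin_closed by blast
  then have "?E = ?S' \<inter> C" by blast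
  then have "closedin (top_of_set ?S') ?E" using C(1) unfolding closedin_closed by blast
  moreover have "open ?E"
    unfolding open_contains_ball
  proof safe
    fix v assume v: "v \<in> S" "v \<notin> branch_points" "g1 v = g2 v"
    have "\<theta> (g1 v) = \<phi> (Some v)" using g(1) v(1) by (simp add: lift_on_def)
    then have "th.e (g1 v) = 1" using ramification_th[of "g1 v"] v(2) by (simp add: branch_points_def)
    then obtain N where N: "openin CP1_top N" "g1 v \<in> N" "inj_on \<theta> N" using th.locally_injective by metis
    have "openin (top_of_set S) {z \<in> S. g1 z \<in> N}" "openin (top_of_set S) {z \<in> S. g2 z \<in> N}"
      using openin_continuous_map_preimage[OF cg(1) N(1)] openin_continuous_map_preimage[OF cg(2) N(1)]
      by simp_all
    then have "open {z \<in> S. g1 z \<in> N}" "open {z \<in> S. g2 z \<in> N}"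
      using S(1) openin_open_trans by blast+
    then have "open ({z \<in> S. g1 z \<in> N} \<inter> {z \<in> S. g2 z \<in> N} \<inter> ?S')" using opS' by blast
    moreover have "v \<in> {z \<in> S. g1 z \<in> N} \<inter> {z \<in> S. g2 z \<in> N} \<inter> ?S'" using v N(2) by auto
    ultimately obtain d where d: "d > 0" "ball v d \<subseteq> {z \<in> S. g1 z \<in> N} \<inter> {z \<in> S. g2 z \<in> N} \<inter> ?S'"
      by (meson openE)
    have "g1 u = g2 u" if "u \<in> ball v d" for u
    proof -
      have u: "u \<in> S" "g1 u \<in> N" "g2 u \<in> N" using d(2) that by auto
      moreover have "\<theta> (g1 u) = \<theta> (g2 u)" using g u(1) by (simp add: lift_on_def)
      ultimately show ?thesis using N(3) by (auto dest: inj_onD)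
    qed
    then show "\<exists>e>0. ball v e \<subseteq> ?E" using d by (intro exI[of _ d]) auto
  qed
  then have "openin (top_of_set ?S') ?E" by (intro open_subset) auto
  ultimately have E: "?E = ?S'" using conS' z0 unfolding connected_clopen by blast
  have "openin (top_of_set S) (S - {z \<in> S. g1 z = g2 z})" using clE by (simp add: openin_diff)
  then have "open (S - {z \<in> S. g1 z = g2 z})" using S(1) openin_open_trans by blast
  moreover have "S - {z \<in> S. g1 z = g2 z} \<subseteq> branch_points" using E by blast
  ultimately have "S - {z \<in> S. g1 z = g2 z} = {}" using ex_not_branch_point by blast
  then show ?thesis using z by blast
qed

lemma lift_on_subset: "lift_on S g \<Longrightarrow> T \<subseteq> S \<Longrightarrow> lift_on T g"
  unfolding lift_on_def using continuous_map_from_subtopology_mono by blast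

lemma lift_glue:
  assumes op: "\<And>i. i \<in> I \<Longrightarrow> open (T i)" and l: "\<And>i. i \<in> I \<Longrightarrow> lift_on (T i) (g i)"
    and eq: "\<And>i j z. i \<in> I \<Longrightarrow> j \<in> I \<Longrightarrow> z \<in> T i \<Longrightarrow> z \<in> T j \<Longrightarrow> g i z = g j z"
  obtains h where "lift_on (\<Union>i\<in>I. T i) h" "\<And>i z. i \<in> I \<Longrightarrow> z \<in> T i \<Longrightarrow> h z = g i z"
proof -
  let ?U = "\<Union>i\<in>I. T i"
  obtain h where h: "continuous_map (top_of_set ?U) CP1_top h"
    "\<And>z i. i \<in> I \<Longrightarrow> z \<in> topspace (top_of_set ?U) \<inter> T i \<Longrightarrow> h z = g i z"
  proof (rule pasting_lemma_exists[where I = I and T = T and f = g and X = "top_of_set ?U" and Y = CP1_top])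
    show "openin (top_of_set ?U) (T i)" if "i \<in> I" for i
      using op that by (intro open_subset) auto
    show "continuous_map (subtopology (top_of_set ?U) (T i)) CP1_top (g i)" if "i \<in> I" for i
    proof -
      have "?U \<inter> T i = T i" using that by auto
      then show ?thesis using l[OF that] by (simp add: subtopology_subtopology lift_on_def)
    qed
    show "g i z = g j z" if "i \<in> I" "j \<in> I" "z \<in> topspace (top_of_set ?U) \<inter> T i \<inter> T j" for i j z
      using eq that by blast
  next
    fix h assume "continuous_map (top_of_set ?U) CP1_top h"
      "\<And>z i. i \<in> I \<Longrightarrow> z \<in> topspace (top_of_set ?U) \<inter> T i \<Longrightarrow> h z = g i z"
    then show thesis by (rule that)
  qed simp
  have "h z = g i z" if "i \<in> I" "z \<in> T i" for i z using h(2) that by auto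
  then show ?thesis using that[of h] h(1) l by (auto simp: lift_on_def)
qed

text \<open>Continuity method: lifts on all discs below the critical radius R glue to the open disc,
  local lifts at boundary points continue it, and compactness of the closed disc gives a uniform
  margin beyond R. The centre avoids \<open>branch_points\<close> so that lifts of different radii
  can be compared there.\<close>

lemma lift_on_ball:
  assumes z: "z \<notin> branch_points" and y: "\<theta> y = \<phi> (Some z)" and "r > 0"
  shows "\<exists>g. lift_on (ball z r) g \<and> g z = y"
proof (rule ccontr)
  define P where "P r \<longleftrightarrow> (\<exists>g. lift_on (ball z r) g \<and> g z = y)" for r
  assume "\<not> (\<exists>g. lift_on (ball z r) g \<and> g z = y)"
  then have r: "\<not> P r" by (simp add: P_def)
  have mono: "P s" if "P r" "s \<le> r" for r s
    using that lift_on_subset[of "ball z r" _ "ball z s"] unfolding P_def by (metis subset_ball)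
  obtain r0 where r0: "r0 > 0" "P r0"
    using local_lift[of z] y unfolding P_def by (metis centre_in_ball)
  define A where "A = {r. \<not> P r}"
  have A: "A \<noteq> {}" using r by (auto simp: A_def)
  have lb: "r0 \<le> s" if "s \<in> A" for s
    using that mono[OF r0(2), of s] by (cases "s \<le> r0") (auto simp: A_def)
  then have bdd: "bdd_below A" by (rule bdd_belowI)
  \<comment> \<open>The infimum of the radii without a lift.\<close>
  define R where "R = Inf A"
  have R0: "R > 0"
    using r0(1) cInf_greatest[OF A lb] unfolding R_def by (rule less_le_trans)
  have below: "P s" if "s < R" for s
    using that cInf_lower[OF _ bdd, of s] by (auto simp: R_def A_def)
  have above: "\<exists>s. s < t \<and> \<not> P s" if "R < t" for t
    using cInf_lessD[OF A] that by (auto simp: R_def A_def)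
  have "\<forall>s. \<exists>g. s < R \<longrightarrow> lift_on (ball z s) g \<and> g z = y" using below unfolding P_def by blast
  then obtain g where g: "\<And>s. s < R \<Longrightarrow> lift_on (ball z s) (g s)" "\<And>s. s < R \<Longrightarrow> g s z = y" by metis
  have "g i v = g j v" if ij: "i < R" "j < R" "v \<in> ball z i" "v \<in> ball z j" for i j v
  proof -
    define m where "m = min i j"
    have m: "m > 0" "v \<in> ball z m" using ij by (auto simp: m_def min_def intro: le_less_trans[OF zero_le_dist])
    have "lift_on (ball z m) (g i)" "lift_on (ball z m) (g j)"
      using g(1)[OF ij(1)] g(1)[OF ij(2)] by (auto intro: lift_on_subset simp: m_def subset_ball)
    then show ?thesis
      by (rule lift_unique[rotated 2, of _ _ _ z]) (use m z g(2) ij in auto)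
  qed
  then obtain G where G: "lift_on (\<Union>s\<in>{0<..<R}. ball z s) G" "\<And>s v. s \<in> {0<..<R} \<Longrightarrow> v \<in> ball z s \<Longrightarrow> G v = g s v"
    using lift_glue[of "{0<..<R}" "ball z" g] g by (metis open_ball greaterThanLessThan_iff)
  have "(\<Union>s\<in>{0<..<R}. ball z s) = ball z R"
  proof (intro equalityI subsetI)
    fix v assume "v \<in> ball z R"
    then obtain s where "dist z v < s" "s < R" using dense by (auto simp: mem_ball)
    then show "v \<in> (\<Union>s\<in>{0<..<R}. ball z s)" by (auto intro!: bexI[of _ s] intro: le_less_trans[OF zero_le_dist])
  qed auto
  then have GR: "lift_on (ball z R) G" using G(1) by simp
  have Gz: "G z = y" using G(2)[of "R/2" z] g(2)[of "R/2"] R0 by auto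
  have "\<exists>t h. t > 0 \<and> lift_on (ball x t) h \<and> (\<forall>v \<in> ball x t \<inter> ball z R. h v = G v)"
    if x: "x \<in> sphere z R" for x
  proof -
    obtain t where t: "t > 0" "\<And>z0 y0. z0 \<in> ball x t \<Longrightarrow> \<theta> y0 = \<phi> (Some z0) \<Longrightarrow>
        \<exists>g. lift_on (ball x t) g \<and> g z0 = y0" using local_lift[of x] by metis
    have "ball x t \<inter> ball x t \<inter> ball z R \<noteq> {}"
      using t(1) by (intro balls_meet_inside R0 x) auto
    \<comment> \<open>The local lift is made to agree with G at a point where uniqueness can start;
      the overlap is convex, so agreement spreads over all of it.\<close>
    then obtain v0 where v0: "v0 \<in> ball x t \<inter> ball z R" "v0 \<notin> branch_points"
      using ex_not_branch_point[of "ball x t \<inter> ball z R"] open_Int[OF open_ball open_ball] by (metis Int_absorb)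
    have "\<theta> (G v0) = \<phi> (Some v0)" using GR v0 by (auto simp: lift_on_def)
    then obtain h where h: "lift_on (ball x t) h" "h v0 = G v0" using t(2) v0 by blast
    have "h v = G v" if "v \<in> ball x t \<inter> ball z R" for v
      by (rule lift_unique[of "ball x t \<inter> ball z R" h G v0])
        (use that v0 h GR in \<open>auto intro: lift_on_subset intro!: convex_connected convex_Int\<close>)
    then show ?thesis using t(1) h(1) by blast
  qed
  then obtain t h where t: "\<And>x. x \<in> sphere z R \<Longrightarrow> t x > 0"
    and h: "\<And>x. x \<in> sphere z R \<Longrightarrow> lift_on (ball x (t x)) (h x)"
      "\<And>x v. x \<in> sphere z R \<Longrightarrow> v \<in> ball x (t x) \<Longrightarrow> v \<in> ball z R \<Longrightarrow> h x v = G v"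
    by (metis IntI)
  \<comment> \<open>Overlapping boundary discs also meet inside the open disc, by
    \<open>balls_meet_inside\<close>; there both lifts equal G, which supplies the base point for
    uniqueness.\<close>
  have hh: "h x v = h x' v" if x: "x \<in> sphere z R" "x' \<in> sphere z R" 
    and v: "v \<in> ball x (t x)" "v \<in> ball x' (t x')" for x x' v
  proof -
    have "ball x (t x) \<inter> ball x' (t x') \<inter> ball z R \<noteq> {}"
      using v by (intro balls_meet_inside R0 x) auto
    then obtain v0 where v0: "v0 \<in> ball x (t x) \<inter> ball x' (t x') \<inter> ball z R" "v0 \<notin> branch_points"
      using ex_not_branch_point[of "ball x (t x) \<inter> ball x' (t x') \<inter> ball z R"]
        open_Int[OF open_Int[OF open_ball open_ball] open_ball] by metis
    show ?thesis
      by (rule lift_unique[of "ball x (t x) \<inter> ball x' (t x')" "h x" "h x'" v0])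
        (use x v v0 h in \<open>auto intro: lift_on_subset intro!: convex_connected convex_Int\<close>)
  qed
  define I where "I = insert None (Some ` sphere z R)"
  define T where "T i = (case i of None \<Rightarrow> ball z R | Some x \<Rightarrow> ball x (t x))" for i
  define k where "k i = (case i of None \<Rightarrow> G | Some x \<Rightarrow> h x)" for i
  obtain H where H: "lift_on (\<Union>i\<in>I. T i) H" "\<And>i v. i \<in> I \<Longrightarrow> v \<in> T i \<Longrightarrow> H v = k i v"
  proof (rule lift_glue[of I T k])
    show "open (T i)" if "i \<in> I" for i by (auto simp: T_def split: option.split)
    show "lift_on (T i) (k i)" if "i \<in> I" for i
      using that GR h(1) by (auto simp: T_def k_def I_def)
    show "k i v = k j v" if "i \<in> I" "j \<in> I" "v \<in> T i" "v \<in> T j" for i j v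
      using that(1) unfolding I_def
    proof (elim insertE imageE)
      assume i: "i = None"
      show ?thesis
        using that(2) unfolding I_def
      proof (elim insertE imageE)
        fix x assume "j = Some x" "x \<in> sphere z R"
        then show ?thesis using i that(3,4) h(2)[of x v] by (simp add: k_def T_def)
      qed (use i in simp)
    next
      fix x assume i: "i = Some x" "x \<in> sphere z R"
      show ?thesis
        using that(2) unfolding I_def
      proof (elim insertE imageE)
        assume "j = None"
        then show ?thesis using i that(3,4) h(2)[of x v] by (simp add: k_def T_def)
      next
        fix x' assume "j = Some x'" "x' \<in> sphere z R"
        then show ?thesis using i that(3,4) hh[of x x' v] by (simp add: k_def T_def)
      qed
    qed
  next
    fix h' assume "lift_on (\<Union>i\<in>I. T i) h'" "\<And>i v. i \<in> I \<Longrightarrow> v \<in> T i \<Longrightarrow> h' v = k i v"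
    then show thesis by (rule that)
  qed
  have sub: "cball z R \<subseteq> (\<Union>i\<in>I. T i)"
  proof
    fix v assume v: "v \<in> cball z R"
    show "v \<in> (\<Union>i\<in>I. T i)"
    proof (cases "dist z v = R")
      case True
      then have "v \<in> sphere z R" by simp
      then have "Some v \<in> I" "v \<in> T (Some v)" using t by (auto simp: I_def T_def)
      then show ?thesis by blast
    next
      case False
      then have "None \<in> I" "v \<in> T None" using v by (auto simp: I_def T_def)
      then show ?thesis by blast
    qed
  qed
  moreover have "open (\<Union>i\<in>I. T i)" by (intro open_UN ballI) (auto simp: T_def split: option.split)
  ultimately obtain \<epsilon> where \<epsilon>: "\<epsilon> > 0" "(\<Union>x\<in>cball z R. ball x \<epsilon>) \<subseteq> (\<Union>i\<in>I. T i)"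
    using compact_subset_open_imp_ball_epsilon_subset[OF compact_cball] by metis
  have "ball z (R + \<epsilon>) \<subseteq> (\<Union>x\<in>cball z R. ball x \<epsilon>)"
  proof
    fix v assume v: "v \<in> ball z (R + \<epsilon>)"
    show "v \<in> (\<Union>x\<in>cball z R. ball x \<epsilon>)"
    proof (cases "dist z v \<le> R")
      case True
      then show ?thesis using \<epsilon>(1) by (intro UN_I[of v]) auto
    next
      case False
      define d where "d = norm (v - z)"
      have d: "d > R" "d < R + \<epsilon>" using False v by (auto simp: d_def dist_norm norm_minus_commute)
      \<comment> \<open>The radial projection of v to the circle of radius R, at distance d - R <
        \<epsilon> from v.\<close>
      define w where "w = z + of_real (R / d) * (v - z)"
      have "norm (w - z) = R" using d R0 by (simp add: w_def norm_mult norm_divide flip: d_def)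
      moreover have "w - v = of_real (R / d - 1) * (v - z)" by (simp add: w_def algebra_simps)
      then have nwv: "norm (w - v) = \<bar>R / d - 1\<bar> * d" by (simp only: norm_mult norm_of_real d_def)
      have "\<bar>R / d - 1\<bar> = (d - R) / d" using d R0 by (simp add: abs_if diff_divide_distrib)
      then have "norm (w - v) = d - R" using nwv d R0 by simp
      ultimately show ?thesis using d
        by (intro UN_I[of w]) (auto simp: dist_norm norm_minus_commute)
    qed
  qed
  then have "lift_on (ball z (R + \<epsilon>)) H" using H(1) \<epsilon>(2) lift_on_subset by blast
  moreover have "H z = y" using H(2)[of None z] R0 Gz by (simp add: I_def T_def k_def)
  ultimately have "P (R + \<epsilon>)" unfolding P_def by blast
  then show False using above[of "R + \<epsilon>"] \<epsilon>(1) mono by (metis less_add_same_cancel1 less_imp_le)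
qed

lemma ex_lift: "\<exists>g. lift_on UNIV g"
proof -
  obtain z where z: "z \<notin> branch_points" using ex_not_branch_point[of UNIV] by auto
  obtain y where y: "\<theta> y = \<phi> (Some z)" using th.surj_rat_map by blast
  have "\<forall>s. \<exists>g. s > 0 \<longrightarrow> lift_on (ball z s) g \<and> g z = y" using lift_on_ball[OF z y] by blast
  then obtain g where g: "\<And>s. s > 0 \<Longrightarrow> lift_on (ball z s) (g s)" "\<And>s. s > 0 \<Longrightarrow> g s z = y" by metis
  have "g i v = g j v" if ij: "i > 0" "j > 0" "v \<in> ball z i" "v \<in> ball z j" for i j v
  proof -
    define m where "m = min i j"
    have m: "m > 0" "v \<in> ball z m" using ij by (auto simp: m_def)
    have "lift_on (ball z m) (g i)" "lift_on (ball z m) (g j)"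
      using g(1)[OF ij(1)] g(1)[OF ij(2)] by (auto intro: lift_on_subset simp: m_def subset_ball)
    then show ?thesis
      by (rule lift_unique[rotated 2, of _ _ _ z]) (use m z g(2) ij in auto)
  qed
  then obtain G where "lift_on (\<Union>s\<in>{0<..}. ball z s) G"
    using lift_glue[of "{0<..}" "ball z" g] g by (metis open_ball greaterThan_iff)
  moreover have "(\<Union>s\<in>{0<..}. ball z s) = UNIV"
  proof (rule UNIV_eq_I[symmetric])
    fix v
    have "dist z v < dist z v + 1" "0 < dist z v + 1" by (auto simp: add_nonneg_pos)
    then show "v \<in> (\<Union>s\<in>{0<..}. ball z s)" by (intro UN_I[of "dist z v + 1"]) auto
  qed
  ultimately show ?thesis by auto
qed

end

section \<open>Rationality of meromorphic functions\<close>

text \<open>The singularity is removable. If the extension vanishes at a, its zero has finite order;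
  otherwise m = 0 works. Applied to a reciprocal, this bounds the order of a pole.\<close>

lemma nonvanishing_lower_bound:
  assumes k: "k holomorphic_on ball a r - {a}" and r: "r > 0"
    and nz: "\<And>u. u \<in> ball a r - {a} \<Longrightarrow> k u \<noteq> 0"
    and bd: "\<And>u. u \<in> ball a r - {a} \<Longrightarrow> norm (k u) \<le> C"
  obtains m B s where "B > 0" "s > 0" "\<And>u. u \<in> ball a s - {a} \<Longrightarrow> B * norm (u - a) ^ m \<le> norm (k u)"
proof -
  have "eventually (\<lambda>u. norm (k u) \<le> C) (at a)"
    unfolding eventually_at using r bd by (intro exI[of _ r]) (auto simp: dist_commute)
  then obtain g where g: "g holomorphic_on ball a r" "\<And>u. u \<in> ball a r - {a} \<Longrightarrow> g u = k u"
    using holomorphic_on_extend_bounded[OF k] r by auto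
  show ?thesis
  proof (cases "g a = 0")
    case True
    \<comment> \<open>A witness that the extension is not constant.\<close>
    define w where "w = a + of_real (r / 2)"
    have w: "w \<in> ball a r - {a}" using r by (auto simp: w_def dist_norm norm_divide)
    then have "g w \<noteq> g a" "a \<in> ball a r" "w \<in> ball a r" using True g(2) nz r by auto
    then obtain B m s where B: "0 < B" "0 < s" "ball a s \<subseteq> ball a r"
      "\<And>u. u \<in> ball a s \<Longrightarrow> B * norm (u - a) ^ m \<le> norm (g u - g a)"
      using holomorphic_lower_bound_difference[OF g(1) open_ball connected_ball, of a w] by metis
    have "B * norm (u - a) ^ m \<le> norm (k u)" if "u \<in> ball a s - {a}" for u
      using B(4)[of u] B(3) that True g(2)[of u] by auto
    then show ?thesis using that B(1,2) by blast
  next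
    case False
    have "continuous (at a) g"
      using holomorphic_on_imp_continuous_on[OF g(1)] r by (simp add: continuous_on_eq_continuous_at)
    then have "eventually (\<lambda>u. norm (g u) > norm (g a) / 2) (at a)"
      using False order_tendstoD(1)[OF tendsto_norm, of g "g a" "at a" "norm (g a) / 2"]
      by (simp add: continuous_at)
    then obtain d where d: "d > 0" "\<And>u. u \<noteq> a \<Longrightarrow> dist u a < d \<Longrightarrow> norm (g u) > norm (g a) / 2"
      unfolding eventually_at by auto
    have "norm (g a) / 2 * norm (u - a) ^ 0 \<le> norm (k u)" if "u \<in> ball a (min d r) - {a}" for u
      using d(2)[of u] that g(2)[of u] by (auto simp: dist_commute)
    then show ?thesis using that[of "norm (g a) / 2" "min d r" 0] False d(1) r by auto
  qed
qed

text \<open>Multiplying by (z - a)^m makes the function bounded near a, so the singularity is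
  removed; the other poles keep their growth bounds with a larger constant.\<close>

lemma clear_finite_poles:
  assumes "finite F" "h holomorphic_on - F"
    and "\<And>a. a \<in> F \<Longrightarrow> \<exists>m B s. s > 0 \<and> (\<forall>z\<in>ball a s - {a}. norm (h z) * norm (z - a) ^ m \<le> B)"
  shows "\<exists>D K. D \<noteq> 0 \<and> K holomorphic_on UNIV \<and> (\<forall>z\<in>-F. K z = poly D z * h z)"
  using assms
proof (induction F arbitrary: h rule: finite_induct)
  case empty
  then show ?case by (intro exI[of _ 1] exI[of _ h]) auto
next
  case (insert a F)
  obtain m B s where s: "s > 0" and B: "\<And>z. z \<in> ball a s - {a} \<Longrightarrow> norm (h z) * norm (z - a) ^ m \<le> B"
    using insert.prems(2) by (metis insertI1)
  define h1 where "h1 z = (z - a) ^ m * h z" for z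
  have cl: "open (- F)" using insert.hyps(1) by (simp add: finite_imp_closed open_Compl)
  have eq: "- insert a F = - F - {a}" by auto
  have "h1 holomorphic_on - F - {a}"
    unfolding h1_def using insert.prems(1) unfolding eq by (intro holomorphic_intros)
  moreover have "a \<in> interior (- F)" using cl insert.hyps(2) by (simp add: interior_open)
  moreover have "eventually (\<lambda>z. norm (h1 z) \<le> B) (at a)"
    unfolding eventually_at using s B
    by (intro exI[of _ s]) (auto simp: h1_def norm_mult norm_power dist_commute mult.commute)
  ultimately obtain g where g: "g holomorphic_on - F" "\<And>z. z \<in> - F - {a} \<Longrightarrow> g z = h1 z"
    using holomorphic_on_extend_bounded[of h1 "- F" a] by blast
  have "\<exists>m' B' s'. s' > 0 \<and> (\<forall>z\<in>ball b s' - {b}. norm (g z) * norm (z - b) ^ m' \<le> B')"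
    if b: "b \<in> F" for b
  proof -
    obtain m' B' s' where s': "s' > 0" "\<And>z. z \<in> ball b s' - {b} \<Longrightarrow> norm (h z) * norm (z - b) ^ m' \<le> B'"
      using insert.prems(2)[of b] b by (metis insertI2)
    have ab: "a \<noteq> b" using b insert.hyps by auto
    have "finite (insert a F - {b})" using insert.hyps by simp
    then have "open (- (insert a F - {b}))" by (intro open_Compl finite_imp_closed)
    moreover have "b \<in> - (insert a F - {b})" by simp
    ultimately obtain d where d: "d > 0" "ball b d \<subseteq> - (insert a F - {b})" by (meson openE)
    \<comment> \<open>The radius d avoids the other exceptional points, and the cap 1 bounds |z - a|
      by 1 + |b - a|.\<close>
    define t where "t = min s' (min d 1)"
    have "norm (g z) * norm (z - b) ^ m' \<le> (1 + norm (b - a)) ^ m * B'" if z: "z \<in> ball b t - {b}" for z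
    proof -
      have zb: "z \<in> ball b s' - {b}" "z \<in> ball b d" "norm (z - b) < 1"
        using z by (auto simp: t_def dist_norm norm_minus_commute)
      then have "z \<in> - F - {a}" using d(2) by auto
      then have "norm (g z) * norm (z - b) ^ m' = norm (z - a) ^ m * (norm (h z) * norm (z - b) ^ m')"
        using g(2) by (simp add: h1_def norm_mult norm_power)
      also have "\<dots> \<le> (1 + norm (b - a)) ^ m * B'"
      proof (intro mult_mono power_mono s'(2) zb(1))
        show "norm (z - a) \<le> 1 + norm (b - a)"
          using norm_triangle_ineq[of "z - b" "b - a"] zb(3) by simp
      qed auto
      finally show ?thesis .
    qed
    then show ?thesis using s'(1) d(1) by (intro exI[of _ m'] exI[of _ "(1 + norm (b - a)) ^ m * B'"] exI[of _ t]) (auto simp: t_def)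
  qed
  then obtain D K where D: "D \<noteq> 0" "K holomorphic_on UNIV" "\<And>z. z \<in> - F \<Longrightarrow> K z = poly D z * g z"
    using insert.IH[OF g(1)] by blast
  show ?case
  proof (intro exI conjI ballI)
    show "D * [:- a, 1:] ^ m \<noteq> 0" using D(1) by simp
    show "K z = poly (D * [:- a, 1:] ^ m) z * h z" if "z \<in> - insert a F" for z
      using D(3)[of z] g(2)[of z] that by (simp add: h1_def)
  qed (fact D(2))
qed

lemma poly_growth:
  fixes D :: "complex poly"
  obtains B where "B \<ge> 0" "\<And>z. norm z \<ge> 1 \<Longrightarrow> norm (poly D z) \<le> B * norm z ^ degree D"
proof
  let ?B = "\<Sum>i\<le>degree D. norm (coeff D i)"
  show "?B \<ge> 0" by (intro sum_nonneg) auto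
  fix z :: complex assume z: "norm z \<ge> 1"
  have "norm (poly D z) \<le> (\<Sum>i\<le>degree D. norm (coeff D i * z ^ i))"
    unfolding poly_altdef by (rule norm_sum)
  also have "\<dots> \<le> (\<Sum>i\<le>degree D. norm (coeff D i) * norm z ^ degree D)"
    using z by (intro sum_mono) (auto simp: norm_mult norm_power intro!: mult_left_mono power_increasing)
  finally show "norm (poly D z) \<le> ?B * norm z ^ degree D" by (simp add: sum_distrib_right)
qed

lemma reduce_fraction:
  fixes P D :: "complex poly"
  assumes "D \<noteq> 0"
  shows "\<exists>P1 D1. coprime P1 D1 \<and> P1 * D = P * D1"
  using assms
proof (induction "degree D" arbitrary: P D rule: less_induct)
  case less
  show ?case
  proof (cases "coprime P D")
    case False
    then obtain d where d: "d dvd P" "d dvd D" "\<not> is_unit d" using not_coprimeE by blast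
    then obtain P' D' where P: "P = d * P'" and D: "D = d * D'" by (auto elim!: dvdE)
    have nz: "d \<noteq> 0" "D' \<noteq> 0" using less.prems D by auto
    have "degree d \<noteq> 0" using d(3) nz by (simp add: is_unit_iff_degree)
    then have "degree D' < degree D" using nz by (simp add: D degree_mult_eq)
    then obtain P1 D1 where "coprime P1 D1" "P1 * D' = P' * D1" using less.hyps nz by blast
    then have "coprime P1 D1 \<and> P1 * D = P * D1" by (simp add: P D mult.left_commute mult.assoc)
    then show ?thesis by blast
  qed auto
qed

lemma infinite_open_complex: "open S \<Longrightarrow> S \<noteq> {} \<Longrightarrow> infinite (S :: complex set)"
  using finite_imp_not_open by blast

lemma continuous_maps_CP1_eq_cofinite:
  assumes g: "continuous_map euclidean CP1_top g1" "continuous_map euclidean CP1_top g2"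
    and F: "finite F" "\<And>z :: complex. z \<notin> F \<Longrightarrow> g1 z = g2 z"
  shows "g1 z = g2 z"
proof -
  have "closedin euclidean {z \<in> topspace euclidean. g1 z = g2 z}"
    using Hausdorff_CP1 g by (rule closedin_continuous_maps_eq)
  then have "open (- {z. g1 z = g2 z})" by (simp add: open_Compl)
  moreover have "- {z. g1 z = g2 z} \<subseteq> F" using F(2) by blast
  ultimately have "- {z. g1 z = g2 z} = {}" using F(1) infinite_open_complex finite_subset by metis
  then show ?thesis by blast
qed

lemma openin_CP1_Some: "openin CP1_top V \<Longrightarrow> open {z. Some z \<in> V}"
  using openin_continuous_map_preimage[OF continuous_map_Some, of euclidean V] by simp

lemma openin_CP1_None:
  assumes V: "openin CP1_top V" "None \<in> V"
  obtains M where "\<And>z. norm z \<ge> M \<Longrightarrow> Some z \<in> V"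
proof -
  obtain K :: "complex set" where K: "compact K" "V = insert None (Some ` (UNIV - K))"
    using V by (auto simp: openin_Alexandroff_compactification)
  obtain M where M: "\<And>z. z \<in> K \<Longrightarrow> norm z \<le> M"
    using compact_imp_bounded[OF K(1)] unfolding bounded_iff by blast
  have "Some z \<in> V" if "norm z \<ge> M + 1" for z using M[of z] that K(2) by force
  then show ?thesis using that by blast
qed

lemma not_openin_CP1_singleton: "\<not> openin CP1_top {w}"
proof
  assume op: "openin CP1_top {w}"
  show False
  proof (cases w)
    case None
    then obtain M where "\<And>z. norm z \<ge> M \<Longrightarrow> Some z \<in> {w}" using openin_CP1_None[OF op] by auto
    then have "Some (of_real \<bar>M\<bar>) \<in> {w}" by simp
    then show False using None by simp
  next
    case (Some x)
    then have "open {x}" using openin_CP1_Some[OF op] by simp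
    then show False by (simp add: not_open_singleton)
  qed
qed

lemma continuous_maps_CP1_eq:
  assumes g: "continuous_map CP1_top CP1_top g1" "continuous_map CP1_top CP1_top g2"
    and eq: "\<And>x. g1 (Some x) = g2 (Some x)"
  shows "g1 z = g2 z"
proof -
  have "closedin CP1_top {z \<in> topspace CP1_top. g1 z = g2 z}"
    using Hausdorff_CP1 g by (rule closedin_continuous_maps_eq)
  then have op: "openin CP1_top (- {z. g1 z = g2 z})" by (simp add: closedin_def Compl_eq_Diff_UNIV)
  have "g1 None = g2 None"
  proof (rule ccontr)
    assume "g1 None \<noteq> g2 None"
    then have "z \<in> - {z. g1 z = g2 z} \<longleftrightarrow> z = None" for z using eq by (cases z) auto
    then have "- {z. g1 z = g2 z} = {None}" by blast
    then show False using op not_openin_CP1_singleton by metis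
  qed
  then show ?thesis using eq by (cases z) auto
qed

text \<open>Multiplication by a polynomial D removes the poles; the product is entire of polynomial
  growth, because h stays away from c near infinity, and is a polynomial by Liouville. The
  hypothesis \<open>nc\<close> rules out a constant quotient.\<close>

lemma rational_if_holomorphic_cofinite:
  assumes g: "continuous_map euclidean CP1_top g" and F: "finite F"
    and fin: "\<And>z. z \<notin> F \<Longrightarrow> g z \<noteq> None" and hol: "(\<lambda>z. the (g z)) holomorphic_on - F"
    and nc: "\<And>w. \<exists>z. g z \<noteq> w"
    and away: "\<epsilon> > 0" "\<And>z y. norm z \<ge> M \<Longrightarrow> g z = Some y \<Longrightarrow> norm (y - c) \<ge> \<epsilon>"
  shows "\<exists>P D. rat_pair P D \<and> (\<forall>z. g z = rat_map P D (Some z))"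
proof -
  define h where "h z = the (g z)" for z
  have h: "h holomorphic_on - F" using hol unfolding h_def .
  have gh: "g z = Some (h z)" if "z \<notin> F" for z using fin[OF that] by (simp add: h_def)
  have pole: "\<exists>m B s. s > 0 \<and> (\<forall>z\<in>ball a s - {a}. norm (h z) * norm (z - a) ^ m \<le> B)" if a: "a \<in> F" for a
  proof -
    have "open (- (F - {a}))" using F by (intro open_Compl finite_imp_closed) simp
    then obtain d where d: "d > 0" "ball a d \<subseteq> - (F - {a})" by (meson openE ComplI Diff_iff insertI1)
    show ?thesis
    proof (cases "g a")
      case (Some y)
      have "openin CP1_top (Some ` ball y 1)" by simp
      then have "open {z. g z \<in> Some ` ball y 1}" using openin_continuous_map_preimage[OF g] by fastforce
      moreover have "a \<in> {z. g z \<in> Some ` ball y 1}" using Some by simp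
      ultimately obtain s where s: "s > 0" "ball a s \<subseteq> {z. g z \<in> Some ` ball y 1}" by (meson openE)
      have "norm (h z) * norm (z - a) ^ 0 \<le> norm y + 1" if "z \<in> ball a s - {a}" for z
      proof -
        have "g z \<in> Some ` ball y 1" using s(2) that by blast
        then obtain v where "g z = Some v" "v \<in> ball y 1" by blast
        then show ?thesis using norm_triangle_ineq2[of v y]
          by (simp add: h_def dist_norm norm_minus_commute)
      qed
      then show ?thesis using s(1) by blast
    next
      case None
      \<comment> \<open>By continuity |h| > 1 near a pole, so 1/h is bounded and its order of
        vanishing bounds that of the pole.\<close>
      let ?V = "insert None (Some ` (UNIV - cball 0 1))"
      have "openin CP1_top ?V" unfolding openin_Alexandroff_compactification
        by (intro disjI2 exI[of _ "cball 0 1"]) auto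
      then have "open {z. g z \<in> ?V}" using openin_continuous_map_preimage[OF g] by fastforce
      moreover have "a \<in> {z. g z \<in> ?V}" using None by simp
      ultimately obtain s where s: "s > 0" "ball a s \<subseteq> {z. g z \<in> ?V}" by (meson openE)
      define r where "r = min s d"
      have r: "r > 0" using s d by (simp add: r_def)
      have nF: "z \<notin> F" if "z \<in> ball a r - {a}" for z using that d(2) by (auto simp: r_def)
      have big: "norm (h z) > 1" if "z \<in> ball a r - {a}" for z
      proof -
        have "g z \<in> ?V" using that s(2) by (auto simp: r_def)
        then show ?thesis using gh[OF nF[OF that]] by auto
      qed
      then have nz: "h z \<noteq> 0" if "z \<in> ball a r - {a}" for z using that by fastforce
      have "(\<lambda>z. 1 / h z) holomorphic_on ball a r - {a}"
        using holomorphic_on_subset[OF h] nF nz by (intro holomorphic_intros) blast+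
      then obtain m B t where B: "B > 0" "t > 0" "\<And>u. u \<in> ball a t - {a} \<Longrightarrow> B * norm (u - a) ^ m \<le> norm (1 / h u)"
        by (rule nonvanishing_lower_bound[where r = r and C = 1])
          (use r nz big in \<open>auto simp: norm_divide intro!: divide_le_eq_1_pos[THEN iffD2] less_imp_le\<close>)
      have "norm (h z) * norm (z - a) ^ m \<le> 1 / B" if z: "z \<in> ball a (min r t) - {a}" for z
      proof -
        have "norm (h z) > 0" "B * norm (z - a) ^ m \<le> 1 / norm (h z)"
          using nz[of z] B(3)[of z] z by (auto simp: norm_divide)
        then have "B * norm (z - a) ^ m * norm (h z) \<le> 1" by (simp only: pos_le_divide_eq)
        then show ?thesis by (simp only: pos_le_divide_eq[OF B(1)] mult_ac)
      qed
      then show ?thesis using r B(2) by (intro exI[of _ m] exI[of _ "1 / B"] exI[of _ "min r t"]) auto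
    qed
  qed
  obtain D K where D: "D \<noteq> 0" "K holomorphic_on UNIV" "\<And>z. z \<in> - F \<Longrightarrow> K z = poly D z * h z"
    using clear_finite_poles[OF F h pole] by blast
  obtain M1 where M1: "\<And>z. z \<in> F \<Longrightarrow> norm z \<le> M1"
    using finite_imp_bounded[OF F] unfolding bounded_iff by blast
  define M2 where "M2 = max 1 (max (M1 + 1) M)"
  have M2: "M2 \<ge> 1" "\<And>z. norm z \<ge> M2 \<Longrightarrow> z \<notin> F" "\<And>z. norm z \<ge> M2 \<Longrightarrow> norm (h z - c) \<ge> \<epsilon>"
  proof -
    show "M2 \<ge> 1" by (simp add: M2_def)
    show 1: "z \<notin> F" if "norm z \<ge> M2" for z using M1[of z] that by (auto simp: M2_def)
    show "norm (h z - c) \<ge> \<epsilon>" if "norm z \<ge> M2" for z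
      using away(2)[OF _ gh[OF 1[OF that]]] that by (simp add: M2_def)
  qed
  define r where "r = 1 / M2"
  have r: "r > 0" using M2(1) by (simp add: r_def)
  have inv: "norm (inverse u) \<ge> M2" if "u \<in> ball 0 r - {0}" for u :: complex
  proof -
    have "norm u > 0" "norm u * M2 < 1" using that M2(1) by (auto simp: r_def field_simps)
    then show ?thesis by (simp add: inverse_eq_divide norm_divide pos_le_divide_eq mult.commute)
  qed
  have ne: "h (inverse u) - c \<noteq> 0" if "u \<in> ball 0 r - {0}" for u
    using M2(3)[OF inv[OF that]] away(1) by auto
  have "(h \<circ> inverse) holomorphic_on ball 0 r - {0}"
  proof (rule holomorphic_on_compose_gen)
    show "inverse holomorphic_on ball 0 r - {0 :: complex}" by (intro holomorphic_intros) auto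
    show "inverse ` (ball 0 r - {0}) \<subseteq> - F" using M2(2)[OF inv] by blast
  qed (fact h)
  \<comment> \<open>This reciprocal is bounded near u = 0, so a lower bound for it by a power of |u|
    is polynomial growth of h in z = 1/u.\<close>
  then have "(\<lambda>u. 1 / (h (inverse u) - c)) holomorphic_on ball 0 r - {0}"
    using ne by (intro holomorphic_intros) (auto simp: o_def)
  then obtain m B t where B: "B > 0" "t > 0"
    "\<And>u. u \<in> ball 0 t - {0} \<Longrightarrow> B * norm (u - 0) ^ m \<le> norm (1 / (h (inverse u) - c))"
  proof (rule nonvanishing_lower_bound[where r = r and C = "1 / \<epsilon>"])
    fix u assume u: "u \<in> ball 0 r - {0 :: complex}"
    show "1 / (h (inverse u) - c) \<noteq> 0" using ne[OF u] by simp
    show "norm (1 / (h (inverse u) - c)) \<le> 1 / \<epsilon>"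
      using M2(3)[OF inv[OF u]] away(1) by (simp add: norm_divide frac_le)
  qed (use r in auto)
  define M3 where "M3 = max M2 (1 / t + 1)"
  have hb: "norm (h z) \<le> (norm c + 1 / B) * norm z ^ m" if z: "norm z \<ge> M3" for z
  proof -
    have z1: "norm z \<ge> 1" "z \<noteq> 0" using z M2(1) by (auto simp: M3_def)
    have "1 / t < norm z" using z by (simp add: M3_def)
    then have "norm (inverse z) < t" unfolding norm_inverse using B(2) z1 by (simp add: field_simps)
    then have "B * norm (inverse z) ^ m \<le> norm (1 / (h z - c))"
      using B(3)[of "inverse z"] z1 by simp
    moreover have "M2 \<le> norm z" using z by (simp add: M3_def)
    then have "norm (h z - c) > 0" using M2(3)[of z] away(1) by linarith
    ultimately have "norm (h z - c) \<le> 1 / B * norm z ^ m"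
      using B(1) z1 by (simp add: norm_divide norm_inverse power_inverse field_simps)
    moreover have "norm (h z) \<le> norm c + norm (h z - c)" using norm_triangle_ineq[of c "h z - c"] by simp
    moreover have "norm c \<le> norm c * norm z ^ m" using z1 by (simp add: mult_le_cancel_left1)
    ultimately show ?thesis by (simp add: algebra_simps)
  qed
  obtain B' where B': "B' \<ge> 0" "\<And>z. norm z \<ge> 1 \<Longrightarrow> norm (poly D z) \<le> B' * norm z ^ degree D"
    using poly_growth[of D] by blast
  have Kb: "norm (K z) \<le> (B' * (norm c + 1 / B)) * norm z ^ (degree D + m)" if z: "M3 \<le> norm z" for z
  proof -
    have z1: "norm z \<ge> 1" "z \<notin> F" using z M2 by (auto simp: M3_def)
    have "norm (K z) = norm (poly D z) * norm (h z)" using D(3)[of z] z1 by (simp add: norm_mult)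
    also have "\<dots> \<le> (B' * norm z ^ degree D) * ((norm c + 1 / B) * norm z ^ m)"
      by (intro mult_mono B'(2) hb z z1 mult_nonneg_nonneg B'(1)) auto
    finally show ?thesis by (simp add: power_add mult_ac)
  qed
  define P where "P = (\<Sum>k\<le>degree D + m. monom ((deriv ^^ k) K 0 / fact k) k)"
  have K: "K z = poly P z" for z
    unfolding P_def poly_sum poly_monom by (rule Liouville_polynomial[OF D(2) Kb])
  obtain P1 D1 where PD: "coprime P1 D1" "P1 * D = P * D1" using reduce_fraction[OF D(1)] by blast
  \<comment> \<open>At these finitely many points the identity follows from continuity.\<close>
  define Z where "Z = F \<union> {z. poly D z = 0}"
  have Z: "finite Z" using F D(1) by (simp add: Z_def poly_roots_finite)
  have eq: "g z = rat_map P1 D1 (Some z)" if "z \<notin> Z" for z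
  proof -
    have z: "z \<notin> F" "poly D z \<noteq> 0" using that by (auto simp: Z_def)
    have 1: "poly P1 z * poly D z = poly P z * poly D1 z" using PD(2) by (metis poly_mult)
    have "poly D1 z \<noteq> 0"
      using 1 z(2) coprime_poly_0[OF PD(1), of z] by auto
    moreover have "h z = poly P z / poly D z" using D(3)[of z] K[of z] z by (simp add: field_simps)
    ultimately have "h z = poly P1 z / poly D1 z"
      using 1 z(2) by (simp add: frac_eq_eq mult.commute)
    then show ?thesis using gh[OF z(1)] \<open>poly D1 z \<noteq> 0\<close> by (simp add: rat_map_def)
  qed
  show ?thesis
  proof (cases "max (degree P1) (degree D1) > 0")
    case True
    then interpret R: rat_pair P1 D1 using PD(1) by unfold_locales
    have "g z = R.R (Some z)" for z
      by (rule continuous_maps_CP1_eq_cofinite[OF g R.continuous_map_rat_map_Some Z eq])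
    then show ?thesis using R.rat_pair_axioms by blast
  next
    case False
    then obtain a b where ab: "P1 = [:a:]" "D1 = [:b:]" by (auto elim!: degree_eq_zeroE)
    have "g z = rat_map P1 D1 (Some 0)" for z
    proof (rule continuous_maps_CP1_eq_cofinite[OF g _ Z])
      show "continuous_map euclidean CP1_top (\<lambda>z :: complex. rat_map P1 D1 (Some 0))" by simp
      fix z assume "z \<notin> Z"
      then have "g z = rat_map P1 D1 (Some z)" by (rule eq)
      then show "g z = rat_map P1 D1 (Some 0)" by (simp add: rat_map_def ab)
    qed
    then show ?thesis using nc by blast
  qed
qed

section \<open>Factorisation through the universal covering\<close>

context orbifold_lift
begin

text \<open>Off \<open>branch_points\<close> the exponent of the section k is 1, so near z the lift
  is k applied to f - c.\<close>

lemma lift_holomorphic_at: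
  assumes g: "lift_on UNIV g" and z: "z \<notin> branch_points" and y: "g z = Some y" and c: "\<phi> (Some z) = Some c"
  shows "\<exists>d>0. (\<lambda>u. the (g u)) holomorphic_on ball z d"
proof -
  have gz: "\<theta> (g u) = \<phi> (Some u)" for u using g by (simp add: lift_on_def)
  have cg: "continuous_map euclidean CP1_top g" using g by (simp add: lift_on_def)
  have \<theta>y: "\<theta> (Some y) = Some c" using gz[of z] y c by simp
  have e1: "th.e (Some y) = 1" using ramification_th[of "Some y"] z \<theta>y c by (simp add: branch_points_def)
  obtain \<rho> k where \<rho>: "\<rho> > 0" and k: "k holomorphic_on ball 0 \<rho>" "k 0 = y" "open (k ` ball 0 \<rho>)"
    "\<And>t. t \<in> ball 0 \<rho> \<Longrightarrow> \<theta> (Some (k t)) = Some (c + t ^ th.e (Some y))"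
    using th.local_section_affine[OF \<theta>y] by metis
  have "openin CP1_top (Some ` k ` ball 0 \<rho>)" using k(3) by simp
  then have "open {u. g u \<in> Some ` k ` ball 0 \<rho>}"
    using openin_continuous_map_preimage[OF cg] by fastforce
  moreover have "g z \<in> Some ` k ` ball 0 \<rho>" using y k(2) \<rho> by (metis centre_in_ball image_eqI)
  ultimately obtain d where d: "d > 0" "ball z d \<subseteq> {u. g u \<in> Some ` k ` ball 0 \<rho>}"
    by (metis (no_types, lifting) openE mem_Collect_eq)
  have *: "\<phi> (Some u) \<noteq> None \<and> the (\<phi> (Some u)) - c \<in> ball 0 \<rho> \<and> the (g u) = k (the (\<phi> (Some u)) - c)"
    if u: "u \<in> ball z d" for u
  proof -
    have "g u \<in> Some ` k ` ball 0 \<rho>" using d(2) u by blast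
    then obtain t where t: "t \<in> ball 0 \<rho>" "g u = Some (k t)" by blast
    then have "\<phi> (Some u) = Some (c + t)" using gz[of u] k(4)[OF t(1)] e1 by simp
    then show ?thesis using t by simp
  qed
  have "(\<lambda>u. the (\<phi> (Some u))) holomorphic_on {u. \<phi> (Some u) \<in> range Some}"
    by (rule f.holomorphic_target_chart) (simp add: ratlas_CP1)
  then have "(\<lambda>u. the (\<phi> (Some u)) - c) holomorphic_on ball z d"
  proof (intro holomorphic_intros, elim holomorphic_on_subset, intro subsetI)
    fix u assume "u \<in> ball z d"
    then show "u \<in> {u. \<phi> (Some u) \<in> range Some}" using * by (metis mem_Collect_eq not_None_eq rangeI)
  qed
  then have "(k \<circ> (\<lambda>u. the (\<phi> (Some u)) - c)) holomorphic_on ball z d"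
    using k(1) by (rule holomorphic_on_compose_gen) (use * in blast)
  then have "(\<lambda>u. the (g u)) holomorphic_on ball z d"
    by (rule holomorphic_transform) (use * in auto)
  then show ?thesis using d(1) by blast
qed

lemma ex_rational_lift: "\<exists>P D. rat_pair P D \<and> (\<forall>z. \<theta> (rat_map P D z) = \<phi> z)"
proof -
  obtain g where g: "lift_on UNIV g" using ex_lift by blast
  have gz: "\<theta> (g u) = \<phi> (Some u)" for u using g by (simp add: lift_on_def)
  have cg: "continuous_map euclidean CP1_top g" using g by (simp add: lift_on_def)
  \<comment> \<open>Besides \<open>branch_points\<close>, the points where the lift could be
    infinite and the poles of f are removed, so that the lift and f are both finite on the
    complement.\<close>
  define F where "F = branch_points \<union> {z. \<phi> (Some z) = \<theta> None} \<union> {z. \<phi> (Some z) = None}"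
  have fin: "finite {z. \<phi> (Some z) = w}" for w
  proof -
    have "Some ` {z. \<phi> (Some z) = w} \<subseteq> {z. \<phi> z = w}" by auto
    then show ?thesis using f.finite_fibre finite_subset finite_imageD inj_Some inj_on_subset
      by (metis subset_UNIV)
  qed
  have F: "finite F" unfolding F_def using finite_branch_points fin by simp
  have nN: "g z \<noteq> None" if "z \<notin> F" for z
  proof
    assume "g z = None"
    then have "\<phi> (Some z) = \<theta> None" using gz[of z] by simp
    then show False using that by (simp add: F_def)
  qed
  have hol: "(\<lambda>z. the (g z)) holomorphic_on - F"
  proof (rule holomorphic_on_open[THEN iffD2])
    show "open (- F)" using F by (simp add: finite_imp_closed open_Compl)
    show "\<forall>z\<in>- F. \<exists>g'. ((\<lambda>z. the (g z)) has_field_derivative g') (at z)"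
    proof
      fix z assume "z \<in> - F"
      then have z: "z \<notin> F" by simp
      obtain y where y: "g z = Some y" using nN[OF z] by auto
      obtain c where c: "\<phi> (Some z) = Some c" using z by (cases "\<phi> (Some z)") (auto simp: F_def)
      obtain d where "d > 0" "(\<lambda>u. the (g u)) holomorphic_on ball z d"
        using lift_holomorphic_at[OF g _ y c] z by (auto simp: F_def)
      then show "\<exists>g'. ((\<lambda>z. the (g z)) has_field_derivative g') (at z)"
        using holomorphic_derivI[OF _ open_ball] by (metis centre_in_ball)
    qed
  qed
  have nc: "\<exists>z. g z \<noteq> w" for w
  proof (rule ccontr)
    assume "\<nexists>z. g z \<noteq> w"
    then have "{z. \<phi> (Some z) = \<theta> w} = UNIV" using gz by (metis (mono_tags, lifting) UNIV_eq_I mem_Collect_eq)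
    then show False using fin[of "\<theta> w"] infinite_UNIV_char_0 by metis
  qed
  obtain c where c: "\<theta> (Some c) \<noteq> \<phi> None"
  proof (rule ccontr)
    assume "\<not> thesis"
    then have "range Some \<subseteq> {z. \<theta> z = \<phi> None}" using that by blast
    then have "finite (range (Some :: complex \<Rightarrow> _))" using th.finite_fibre finite_subset by blast
    then show False using finite_imageD[OF _ inj_Some] infinite_UNIV_char_0 by blast
  qed
  obtain V1 V2 where V: "openin CP1_top V1" "openin CP1_top V2" "\<theta> (Some c) \<in> V1" "\<phi> None \<in> V2" "disjnt V1 V2"
    using Hausdorff_CP1 c unfolding Hausdorff_space_def by (metis UNIV_I topspace_CP1)
  have "open {y. \<theta> (Some y) \<in> V1}"
    using openin_continuous_map_preimage[OF th.continuous_map_rat_map_Some V(1)] by simp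
  then obtain \<epsilon> where \<epsilon>: "\<epsilon> > 0" "ball c \<epsilon> \<subseteq> {y. \<theta> (Some y) \<in> V1}" using V(3) by (metis openE mem_Collect_eq)
  have "openin CP1_top {z. \<phi> z \<in> V2}"
    using openin_continuous_map_preimage[OF f.continuous_map_rat_map V(2)] by simp
  then obtain M where M: "\<And>z. norm z \<ge> M \<Longrightarrow> \<phi> (Some z) \<in> V2"
    using openin_CP1_None[of "{z. \<phi> z \<in> V2}"] V(4) by (metis mem_Collect_eq)
  have away: "norm (y - c) \<ge> \<epsilon>" if "norm z \<ge> M" "g z = Some y" for z y
  proof (rule ccontr)
    assume "\<not> norm (y - c) \<ge> \<epsilon>"
    then have "y \<in> ball c \<epsilon>" by (simp add: dist_norm norm_minus_commute)
    then have "\<theta> (Some y) \<in> V1" using \<epsilon>(2) by blast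
    moreover have "\<theta> (Some y) \<in> V2" using gz[of z] that M by simp
    ultimately show False using V(5) by (auto simp: disjnt_def)
  qed
  have "\<exists>P D. rat_pair P D \<and> (\<forall>z. g z = rat_map P D (Some z))"
    by (rule rational_if_holomorphic_cofinite[OF cg F nN hol nc \<epsilon>(1) away])
  then obtain P D where PD: "rat_pair P D" "\<And>z. g z = rat_map P D (Some z)" by blast
  interpret q: rat_pair P D by (fact PD(1))
  have "(\<theta> \<circ> q.R) z = \<phi> z" for z
    by (rule continuous_maps_CP1_eq[OF continuous_map_compose[OF q.continuous_map_rat_map th.continuous_map_rat_map]
          f.continuous_map_rat_map]) (simp add: gz flip: PD(2))
  then show ?thesis using PD(1) by auto
qed

end

section \<open>Holomorphic self-maps of the sphere\<close>

lemma poles_accumulate_imp_constant: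
  assumes S: "continuous_map euclidean CP1_top S"
    and hol: "(\<lambda>u. case_option 0 inverse (S u)) holomorphic_on {u :: complex. S u \<noteq> Some 0}"
    and acc: "u0 islimpt {u. S u = None}"
  shows "S u = None"
proof -
  let ?Z = "{u. S u = None}"
  have "closedin CP1_top {None}"
    using Hausdorff_imp_t1_space[OF Hausdorff_CP1] by (simp add: t1_space_closedin_singleton)
  then have clZ: "closed ?Z" using closedin_continuous_map_preimage[OF S, of "{None}"] by simp
  have "closedin CP1_top {Some 0}"
    using Hausdorff_imp_t1_space[OF Hausdorff_CP1] by (simp add: t1_space_closedin_singleton)
  then have "closed {u. S u = Some 0}" using closedin_continuous_map_preimage[OF S, of "{Some 0}"] by simp
  then have op: "open {u. S u \<noteq> Some 0}" by (simp add: closed_def Collect_neg_eq)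
  \<comment> \<open>The limit points of the poles form a closed set, and an open one by the identity
    theorem in the target coordinate 1/z; so a single limit point makes every point a pole.\<close>
  let ?L = "{u. u islimpt ?Z}"
  have LZ: "?L \<subseteq> ?Z" using clZ closed_limpt by blast
  have "open ?L"
    unfolding open_contains_ball
  proof
    fix v assume v: "v \<in> ?L"
    then have "v \<in> {u. S u \<noteq> Some 0}" using LZ by auto
    then obtain r where r: "r > 0" "ball v r \<subseteq> {u. S u \<noteq> Some 0}" using op by (meson openE)
    have lim: "v islimpt (?Z \<inter> ball v r)"
      unfolding islimpt_approachable
    proof (intro allI impI)
      fix \<epsilon> :: real assume "\<epsilon> > 0"
      then have "min \<epsilon> r > 0" using r(1) by simp
      moreover have "v islimpt ?Z" using v by simp
      ultimately obtain x where "x \<in> ?Z" "x \<noteq> v" "dist x v < min \<epsilon> r"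
        unfolding islimpt_approachable by blast
      then show "\<exists>x\<in>?Z \<inter> ball v r. x \<noteq> v \<and> dist x v < \<epsilon>"
        by (intro bexI[of _ x]) (auto simp: dist_commute)
    qed
    have "case_option 0 inverse (S u) = 0" if "u \<in> ball v r" for u
    proof (rule analytic_continuation[where f = "\<lambda>u. case_option 0 inverse (S u)" and S = "ball v r" and U = "?Z \<inter> ball v r" and \<xi> = v])
      show "(\<lambda>u. case_option 0 inverse (S u)) holomorphic_on ball v r"
        using hol r(2) by (rule holomorphic_on_subset)
    qed (use r(1) lim that in auto)
    \<comment> \<open>The coordinate 0 identifies infinity here only because the ball avoids the
      value \<open>Some 0\<close>, which inverse 0 = 0 would also send to 0.\<close>
    then have "S u = None" if "u \<in> ball v r" for u
      using that r(2) by (cases "S u") (force dest: spec)+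
    then have "ball v r \<subseteq> ?Z" by blast
    then have "ball v r \<subseteq> ?L"
    proof (intro subsetI CollectI)
      fix u assume "u \<in> ball v r"
      then have "u islimpt ball v r" using r(1) by (simp add: islimpt_ball)
      then show "u islimpt ?Z" using \<open>ball v r \<subseteq> ?Z\<close> by (rule islimpt_subset)
    qed
    then show "\<exists>e>0. ball v e \<subseteq> ?L" using r(1) by blast
  qed
  moreover have "closed ?L" by (rule closed_limpts)
  ultimately have "?L = {} \<or> ?L = UNIV" using clopen[THEN iffD1, OF conjI] by metis
  moreover have "u0 \<in> ?L" using acc by simp
  ultimately have "u \<in> ?L" by (metis UNIV_I empty_iff)
  then have "u \<in> ?Z" by (rule subsetD[OF LZ])
  then show ?thesis by simp
qed

text \<open>Once the poles are known to be finite in number, the criterion applies, since by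
  continuity T avoids a neighbourhood of some c near infinity.\<close>

lemma holomorphic_map_CP1_imp_rational:
  assumes T: "holomorphic_map CP1 CP1 T" and nc: "\<And>w. \<exists>z. T z \<noteq> w"
  shows "\<exists>P D. rat_pair P D \<and> T = rat_map P D"
proof -
  have cT: "continuous_map CP1_top CP1_top T" using T by (simp add: holomorphic_map_def)
  have c1: "continuous_map euclidean CP1_top (\<lambda>u :: complex. T (Some u))"
    using continuous_map_compose[OF continuous_map_Some cT] by (simp add: o_def)
  have c2: "continuous_map euclidean CP1_top (\<lambda>u :: complex. T (sphere_inv (Some u)))"
    using continuous_map_compose[OF continuous_map_compose[OF continuous_map_Some continuous_map_sphere_inv] cT]
    by (simp add: o_def)
  have hol: "(\<psi> \<circ> T \<circ> inv_into U \<phi>) holomorphic_on \<phi> ` (U \<inter> T -` V)"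
    if "(U, \<phi>) \<in> ratlas CP1" "(V, \<psi>) \<in> ratlas CP1" for U \<phi> V \<psi>
    using T that unfolding holomorphic_map_def by blast
  have im1: "{u. T (Some u) \<in> V} = the ` (range Some \<inter> T -` V)" for V by force
  have im2: "{u. T (sphere_inv (Some u)) \<in> V} = case_option 0 inverse ` (- {Some 0} \<inter> T -` V)" for V
  proof (intro set_eqI iffI)
    fix u assume u: "u \<in> {u. T (sphere_inv (Some u)) \<in> V}"
    have "u = case_option 0 inverse (sphere_inv (Some u))" by (auto simp: sphere_inv_def)
    moreover have "sphere_inv (Some u) \<in> - {Some 0} \<inter> T -` V" using u by (auto simp: sphere_inv_def)
    ultimately show "u \<in> case_option 0 inverse ` (- {Some 0} \<inter> T -` V)" by blast
  next
    fix u assume "u \<in> case_option 0 inverse ` (- {Some 0} \<inter> T -` V)"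
    then obtain z where z: "z \<noteq> Some 0" "T z \<in> V" "u = case_option 0 inverse z" by blast
    then have "sphere_inv (Some u) = z" by (cases z) (auto simp: sphere_inv_def)
    then show "u \<in> {u. T (sphere_inv (Some u)) \<in> V}" using z by simp
  qed
  have atl: "(range Some, the) \<in> ratlas CP1" "(- {Some 0}, case_option 0 inverse) \<in> ratlas CP1"
    by (auto simp: ratlas_CP1)
  have h11: "(\<lambda>u. the (T (Some u))) holomorphic_on {u. T (Some u) \<in> range Some}"
    using hol[OF atl(1) atl(1)] unfolding im1 o_def inv_into_chart_affine .
  have h1: "(\<lambda>u. case_option 0 inverse (T (Some u))) holomorphic_on {u. T (Some u) \<in> - {Some 0}}"
    using hol[OF atl(1) atl(2)] unfolding im1 o_def inv_into_chart_affine .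
  have h2: "(\<lambda>u. case_option 0 inverse (T (sphere_inv (Some u)))) holomorphic_on
      {u. T (sphere_inv (Some u)) \<in> - {Some 0}}"
    using hol[OF atl(2) atl(2)] unfolding im2 o_def inv_into_chart_infinity .
  have fin: "finite {u. T (Some u) = None}"
  proof (rule ccontr)
    assume inf: "infinite {u. T (Some u) = None}"
    \<comment> \<open>The closed unit discs of the two charts cover the sphere, so infinitely many
      poles accumulate in one of them and force T to be constantly infinity.\<close>
    let ?Z1 = "{u. T (Some u) = None} \<inter> cball 0 1"
    let ?Z2 = "{u. T (sphere_inv (Some u)) = None} \<inter> cball 0 1"
    have "{u. T (Some u) = None} \<subseteq> ?Z1 \<union> inverse ` ?Z2"
    proof
      fix u assume u: "u \<in> {u. T (Some u) = None}"
      show "u \<in> ?Z1 \<union> inverse ` ?Z2"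
      proof (cases "norm u \<le> 1")
        case False
        then have "u \<noteq> 0" by auto
        then have "sphere_inv (Some (inverse u)) = Some u" by simp
        moreover have "norm (inverse u) \<le> 1" using False by (simp add: norm_inverse inverse_le_1_iff)
        ultimately have "inverse u \<in> ?Z2" using u by simp
        then have "inverse (inverse u) \<in> inverse ` ?Z2" by (rule imageI)
        then show ?thesis by simp
      qed (use u in auto)
    qed
    then have "infinite ?Z1 \<or> infinite ?Z2" using inf finite_subset by blast
    then have "(\<exists>u0. u0 islimpt ?Z1) \<or> (\<exists>u0. u0 islimpt ?Z2)"
      using Heine_Borel_imp_Bolzano_Weierstrass[OF compact_cball] by (metis inf_le2)
    then have "(\<exists>u0. u0 islimpt {u. T (Some u) = None}) \<or> (\<exists>u0. u0 islimpt {u. T (sphere_inv (Some u)) = None})"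
      by (metis islimpt_subset inf_le1)
    then have "T z = None" for z
    proof (elim disjE exE)
      fix u0 assume lim: "u0 islimpt {u. T (Some u) = None}"
      have 1: "T (Some u) = None" for u
        by (rule poles_accumulate_imp_constant[OF c1 _ lim]) (use h1 in simp)
      show ?thesis by (rule continuous_maps_CP1_eq[OF cT, of "\<lambda>_. None"]) (simp_all add: 1)
    next
      fix u0 assume lim: "u0 islimpt {u. T (sphere_inv (Some u)) = None}"
      have 1: "T (sphere_inv (Some u)) = None" for u
        by (rule poles_accumulate_imp_constant[OF c2 _ lim]) (use h2 in simp)
      have "(T \<circ> sphere_inv) (sphere_inv z) = None"
        by (rule continuous_maps_CP1_eq[OF continuous_map_compose[OF continuous_map_sphere_inv cT],
              of "\<lambda>_. None"]) (simp_all add: 1)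
      then show ?thesis by simp
    qed
    then show False using nc by blast
  qed
  have hol1: "(\<lambda>u. the (T (Some u))) holomorphic_on - {u. T (Some u) = None}"
    using h11 by (rule holomorphic_on_subset) auto
  have nc1: "\<exists>u. T (Some u) \<noteq> w" for w
  proof (rule ccontr)
    assume "\<nexists>u. T (Some u) \<noteq> w"
    then have 1: "T (Some u) = w" for u by blast
    have "T z = w" for z by (rule continuous_maps_CP1_eq[OF cT, of "\<lambda>_. w"]) (simp_all add: 1)
    then show False using nc by blast
  qed
  obtain c where c: "Some c \<noteq> T None" by (metis option.inject zero_neq_one)
  obtain V1 V2 where V: "openin CP1_top V1" "openin CP1_top V2" "Some c \<in> V1" "T None \<in> V2" "disjnt V1 V2"
    using Hausdorff_CP1 c unfolding Hausdorff_space_def by (metis UNIV_I topspace_CP1)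
  obtain \<epsilon> where \<epsilon>: "\<epsilon> > 0" "ball c \<epsilon> \<subseteq> {y. Some y \<in> V1}"
    using openin_CP1_Some[OF V(1)] V(3) by (metis openE mem_Collect_eq)
  have "openin CP1_top {z. T z \<in> V2}" using openin_continuous_map_preimage[OF cT V(2)] by simp
  then obtain M where M: "\<And>z. norm z \<ge> M \<Longrightarrow> T (Some z) \<in> V2"
    using openin_CP1_None[of "{z. T z \<in> V2}"] V(4) by (metis mem_Collect_eq)
  have away: "norm (y - c) \<ge> \<epsilon>" if "norm z \<ge> M" "T (Some z) = Some y" for z y
  proof (rule ccontr)
    assume "\<not> norm (y - c) \<ge> \<epsilon>"
    then have "y \<in> ball c \<epsilon>" by (simp add: dist_norm norm_minus_commute)
    then show False using V(5) \<epsilon>(2) M[OF that(1)] that(2) by (auto simp: disjnt_def)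
  qed
  have "\<exists>P D. rat_pair P D \<and> (\<forall>z. T (Some z) = rat_map P D (Some z))"
    by (rule rational_if_holomorphic_cofinite[OF c1 fin _ hol1 nc1 \<epsilon>(1) away]) simp
  then obtain P D where PD: "rat_pair P D" "\<And>z. T (Some z) = rat_map P D (Some z)" by blast
  interpret q: rat_pair P D by (fact PD(1))
  have "T z = q.R z" for z
    by (rule continuous_maps_CP1_eq[OF cT q.continuous_map_rat_map PD(2)])
  then show ?thesis using PD(1) by blast
qed

text \<open>A component must be mapped onto an open set, and the image of a constant map, a single
  point, is not open.\<close>

lemma branched_covering_CP1_nonconstant:
  assumes "branched_covering CP1 CP1 T"
  shows "\<exists>z. T z \<noteq> w"
proof (rule ccontr)
  assume "\<nexists>z. T z \<noteq> w"
  then have T: "T z = w" for z by simp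
  have "\<exists>U. openin CP1_top U \<and> w \<in> U \<and>
      (\<forall>C\<in>connected_components_of (subtopology CP1_top {x. T x \<in> U}). T ` C = U)"
    using assms unfolding branched_covering_def rtop_CP1 topspace_CP1
    by (elim conjE ballE[of _ _ w]) auto
  then obtain U where U: "openin CP1_top U" "w \<in> U"
    "\<And>C. C \<in> connected_components_of (subtopology CP1_top {x. T x \<in> U}) \<Longrightarrow> T ` C = U"
    by blast
  have "{x. T x \<in> U} = UNIV" using T U(2) by auto
  then have sub: "subtopology CP1_top {x. T x \<in> U} = CP1_top" by simp
  have "CP1_top \<noteq> trivial_topology" using topspace_CP1 by (metis topspace_discrete_topology UNIV_not_empty)
  then have "UNIV \<in> connected_components_of CP1_top"
    using connected_components_of_connected_space[OF connected_CP1] by simp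
  then have "range T = U" using U(3) unfolding sub by blast
  then have "U = {w}" using T by auto
  then show False using U(1) not_openin_CP1_singleton by simp
qed

section \<open>Degrees of rational functions\<close>

lemma represents_iff: "represents p q f \<longleftrightarrow> rat_pair p q \<and> f = rat_map p q"
  by (auto simp: represents_def rat_pair_def)

text \<open>The degree is the sum of the local degrees over a fibre, and \<open>local_degree\<close>
  depends on the map alone, not on the polynomials representing it.\<close>

lemma rational_degree_rat_map:
  assumes "rat_pair p q"
  shows "rational_degree (rat_map p q) = max (degree p) (degree q)"
proof -
  interpret rat_pair p q by fact
  have *: "max (degree p2) (degree q2) = n" if "rat_pair p2 q2" "rat_map p2 q2 = R" for p2 q2
  proof -
    interpret r: rat_pair p2 q2 by fact
    have "r.e z = e z" for z
      using r.local_degree_rat_map[of z] local_degree_rat_map[of z] that(2) by simp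
    then have "r.n = n" using r.sum_ramification_fibre[of None] sum_ramification_fibre[of None] that(2) by simp
    then show ?thesis by (simp add: r.n_def)
  qed
  show ?thesis
    unfolding rational_degree_def represents_iff
  proof (rule the_equality)
    show "\<exists>p' q'. (rat_pair p' q' \<and> R = rat_map p' q') \<and> max (degree p) (degree q) = max (degree p') (degree q')"
      using rat_pair_axioms by blast
    fix d assume "\<exists>p' q'. (rat_pair p' q' \<and> R = rat_map p' q') \<and> d = max (degree p') (degree q')"
    then show "d = max (degree p) (degree q)" using * unfolding n_def by metis
  qed
qed

lemma (in rat_pair) card_fibre:
  assumes "\<And>z. R z = w \<Longrightarrow> e z = 1"
  shows "card {z. R z = w} = n"
proof -
  have "(\<Sum>z | R z = w. e z) = (\<Sum>z | R z = w. 1)" using assms by (intro sum.cong) auto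
  then show ?thesis using sum_ramification_fibre[of w] by simp
qed

lemma degree_composition:
  assumes "rat_pair p q" "rat_pair a b" "rat_pair s t"
    and comp: "\<And>z. rat_map p q (rat_map s t z) = rat_map a b z"
  shows "max (degree a) (degree b) = max (degree p) (degree q) * max (degree s) (degree t)"
proof -
  interpret T: rat_pair p q by fact
  interpret f: rat_pair a b by fact
  interpret g: rat_pair s t by fact
  \<comment> \<open>All critical values of the three maps, those of the inner one pushed forward;
    over any other w every fibre involved is simple.\<close>
  define X where "X = T.R ` {z. T.e z \<noteq> 1} \<union> f.R ` {z. f.e z \<noteq> 1} \<union> T.R ` g.R ` {z. g.e z \<noteq> 1}"
  have "finite X" using T.finite_ramified f.finite_ramified g.finite_ramified by (simp add: X_def)
  moreover have "infinite (UNIV :: complex option set)" using infinite_UNIV_char_0[where 'a = complex] by simp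
  ultimately obtain w where w: "w \<notin> X" using ex_new_if_finite by blast
  have cT: "card {y. T.R y = w} = T.n" using w by (intro T.card_fibre) (auto simp: X_def)
  have cf: "card {z. f.R z = w} = f.n" using w by (intro f.card_fibre) (auto simp: X_def)
  have cg: "card {z. g.R z = y} = g.n" if "T.R y = w" for y
  proof (rule g.card_fibre, rule ccontr)
    fix z assume z: "g.R z = y" "g.e z \<noteq> 1"
    then have "T.R y \<in> T.R ` g.R ` {z. g.e z \<noteq> 1}" by blast
    then show False using w that by (simp add: X_def)
  qed
  have "{z. f.R z = w} = (\<Union>y\<in>{y. T.R y = w}. {z. g.R z = y})" using comp by auto
  then have "f.n = card (\<Union>y\<in>{y. T.R y = w}. {z. g.R z = y})" using cf by simp
  also have "\<dots> = (\<Sum>y | T.R y = w. card {z. g.R z = y})"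
    using T.finite_fibre g.finite_fibre by (intro card_UN_disjoint) auto
  also have "\<dots> = T.n * g.n" using cg cT by simp
  finally show ?thesis by (simp add: T.n_def f.n_def g.n_def)
qed

text \<open>The existence clause keeps the claim about all universal coverings from being vacuous;
  quantifying over all of them reflects that a universal covering is determined only up to an
  automorphism of the sphere.\<close>

theorem theorem1p1:
  fixes f :: "complex option \<Rightarrow> complex option" and \<nu> :: "complex option \<Rightarrow> nat"
  assumes "rational_function f"
    and "orbifold CP1 \<nu>"
    and "good_on_CP1 \<nu>"
    and "non_ramified CP1 (pullback_ramification CP1 CP1 f \<nu>)"
  shows "euler_char_on_CP1 \<nu> > 0 \<and>
    (\<exists>\<theta>. universal_covering CP1 \<theta> CP1 \<nu>) \<and>
    (\<forall>\<theta>. universal_covering CP1 \<theta> CP1 \<nu> \<longrightarrow>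
       rational_function \<theta> \<and>
       (\<exists>q. rational_function q \<and> f = \<theta> \<circ> q) \<and>
       rational_degree \<theta> dvd rational_degree f)"
proof -
  obtain a b where "represents a b f" using assms(1) by (auto simp: rational_function_def)
  then have f: "rat_pair a b" "f = rat_map a b" by (auto simp: represents_iff)
  interpret f: rat_pair a b by (fact f(1))
  have fin: "finite {w. \<nu> w \<noteq> 1}" using assms(2) by (rule finite_ramified_orbifold)
  have pos: "\<nu> w \<ge> 1" for w using assms(2) by (simp add: orbifold_def)
  have dv: "\<nu> (f.R z) dvd f.e z" for z
  proof -
    have "\<nu> (f.R z) div gcd (f.e z) (\<nu> (f.R z)) = 1"
      using assms(4) by (simp add: non_ramified_def pullback_ramification_def f(2) f.local_degree_rat_map)
    then have "gcd (f.e z) (\<nu> (f.R z)) = \<nu> (f.R z)"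
      by (metis dvd_div_mult_self gcd_dvd2 mult_1)
    then show ?thesis by (metis gcd_dvd1)
  qed
  have \<chi>: "euler_char_on_CP1 \<nu> > 0" by (rule f.euler_char_pos[OF fin pos dv])
  moreover have "\<exists>\<theta>. universal_covering CP1 \<theta> CP1 \<nu>"
  proof -
    obtain p q where pq: "rat_pair p q" "\<And>z. \<nu> (rat_map p q z) = ramification p q z"
      using ex_rat_pair_unramified_cover[OF fin pos assms(3) \<chi>] by blast
    then show ?thesis using rat_pair.universal_covering_rat_map[OF pq(1) assms(2) pq(2)] by blast
  qed
  moreover have "rational_function \<theta> \<and> (\<exists>q. rational_function q \<and> f = \<theta> \<circ> q) \<and>
       rational_degree \<theta> dvd rational_degree f" if \<theta>: "universal_covering CP1 \<theta> CP1 \<nu>" for \<theta>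
  proof -
    obtain \<nu>' where \<nu>': "non_ramified CP1 \<nu>'" "orbifold_covering CP1 \<nu>' CP1 \<nu> \<theta>"
      using \<theta> by (auto simp: universal_covering_def)
    then have br: "branched_covering CP1 CP1 \<theta>" by (simp add: orbifold_covering_def)
    then have "holomorphic_map CP1 CP1 \<theta>" by (simp add: branched_covering_def)
    then obtain p q where pq: "rat_pair p q" "\<theta> = rat_map p q"
      using holomorphic_map_CP1_imp_rational branched_covering_CP1_nonconstant[OF br] by blast
    interpret th: rat_pair p q by (fact pq(1))
    have "th.e y = \<nu> (th.R y)" for y
      using \<nu>' by (simp add: orbifold_covering_def non_ramified_def pq(2) th.local_degree_rat_map)
    then interpret L: orbifold_lift p q a b \<nu> using dv fin by unfold_locales auto
    obtain s t where st: "rat_pair s t" "\<And>z. th.R (rat_map s t z) = f.R z"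
      using L.ex_rational_lift by blast
    have "rational_function \<theta>" "rational_function (rat_map s t)"
      using pq st(1) by (auto simp: rational_function_def represents_iff)
    moreover have "f = \<theta> \<circ> rat_map s t" using st(2) by (auto simp: f(2) pq(2))
    moreover have "rational_degree \<theta> dvd rational_degree f"
      using degree_composition[OF pq(1) f(1) st] by (simp add: pq f rational_degree_rat_map)
    ultimately show ?thesis by blast
  qed
  ultimately show ?thesis by blast
qed

end
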